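(* Let $u$ be a normalized covering vector for $R(\mathbb{Z})$ such that $\mathrm{nrm}(u)>3$. If $\delta(\mathcal{A}_{R(\mathbb{Z}),u})<1$, then $E(\mathbb{Z})$ is an infinite-index subgroup of $G(\mathbb{Z})$.
   Context: Fix $\dim\in\{3,4,5\}$. If $\dim=3$, $R(\mathbb{Z})$ is the ring of integers of an imaginary quadratic field; if $\dim=4$, a maximal $\ddagger$-order of a rational definite quaternion algebra $\left(\frac{a,b}{\mathbb{Q}}\right)$ with orthogonal involution $(x+yi+zj+tij)^\ddagger=x+yi+zj-tij$; if $\dim=5$, a maximal order of a rational definite quaternion algebra. $\mathrm{nrm}(\alpha)=\alpha\bar\alpha$. $R(\mathbb{Z})^+$ is the $\ddagger$-fixed part if $\dim=4$ and $R(\mathbb{Z})$ otherwise; $R(\mathbb{R})^+=R(\mathbb{Z})^+\otimes\mathbb{R}$ is Euclidean $\mathbb{R}^{\dim-1}$ (norm $\sqrt{\mathrm{nrm}}$, first coordinate the real part). $G(\mathbb{Z})=SL(2,R(\mathbb{Z}))$ if $\dim=3,5$ (for quaternions: determinant $1$ as $4\times4$ complex matrices via an embedding of the Hamilton quaternions in $\mathrm{Mat}(2,\mathbb{C})$), and $G(\mathbb{Z})=\{M:\hat\ddagger(M)M=M\hat\ddagger(M)=I\}$ if $\dim=4$, with $\hat\ddagger\begin{pmatrix}a&b\\c&d\end{pmatrix}=\begin{pmatrix}d^\ddagger&-b^\ddagger\\-c^\ddagger&a^\ddagger\end{pmatrix}$; $E(\mathbb{Z})$ is the subgroup generated by the upper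 and lower triangular matrices of $G(\mathbb{Z})$. For nonzero $u$, $S_u$ is the hyperplane through $0$ orthogonal to $u$, with interior the open half-space containing $u$; $-S$ is $S$ with reversed orientation. A nonzero $u$ with real part $0$ is a covering vector if open unit balls centered at the points of $S_u\cap R(\mathbb{Z})$ cover $S_u$; normalized if also $u\in R(\mathbb{Z})^+$ and $u/k\notin R(\mathbb{Z})$ for integers $k>1$. Choose $\tau\in R(\mathbb{Z})^+$ in the interior of $S_u$ such that $S_u\cap R(\mathbb{Z})^+$ and $\tau$ generate $R(\mathbb{Z})^+$. $\Gamma_u$ is generated by the translations $z\mapsto z+\omega$, $\omega\in R(\mathbb{Z})^+\cap S_u$, and the inversions in unit spheres centered at points of $R(\mathbb{Z})^+\cap S_u$ and of $R(\mathbb{Z})^+\cap(S_u+\tau)$; $\mathcal{A}_{R(\mathbb{Z}),u}$ is the union of the $\Gamma_u$-orbits of the oriented spheres $S_u$ and $-S_u+\tau$. Its density is $\delta(\mathcal{A}_{R(\mathbb{Z}),u})=\frac{1}{\mathrm{vol}(R(\mathbb{R})^+/R(\mathbb{Z})^+)}\sum\mathrm{vol}(\mathrm{Int}(S))$, the sum over the orbits $S$ of $\mathcal{A}_{R(\mathbb{Z}),u}$ under translation by $R(\mathbb{Z})^+\cap S_u$ with $S\neq S_u,-S_u+\tau$, $\mathrm{Int}(S)$ the interior, vol Lebesgue measure. *)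

theory Defs
  imports
    "HOL-Analysis.Analysis"
    "HOL-Algebra.Generated_Groups"
    "HOL-Computational_Algebra.Polynomial"
    "HOL-Computational_Algebra.Group_Closure"
begin

datatype quat = Quat (qRe: real) (qI: real) (qJ: real) (qK: real)

lemma quat_eq_iff: "x = y \<longleftrightarrow> qRe x = qRe y \<and> qI x = qI y \<and> qJ x = qJ y \<and> qK x = qK y"
  by (cases x; cases y) simp

instantiation quat :: real_algebra_1
begin

definition "0 = Quat 0 0 0 0"
definition "1 = Quat 1 0 0 0"
definition "x + y = Quat (qRe x + qRe y) (qI x + qI y) (qJ x + qJ y) (qK x + qK y)"
definition "- x = Quat (- qRe x) (- qI x) (- qJ x) (- qK x)"
definition "x - y = Quat (qRe x - qRe y) (qI x - qI y) (qJ x - qJ y) (qK x - qK y)"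
definition "r *\<^sub>R x = Quat (r * qRe x) (r * qI x) (r * qJ x) (r * qK x)"
definition "x * y = Quat
  (qRe x * qRe y - qI x * qI y - qJ x * qJ y - qK x * qK y)
  (qRe x * qI y + qI x * qRe y + qJ x * qK y - qK x * qJ y)
  (qRe x * qJ y - qI x * qK y + qJ x * qRe y + qK x * qI y)
  (qRe x * qK y + qI x * qJ y - qJ x * qI y + qK x * qRe y)"

instance
  by standard
    (simp_all add: quat_eq_iff zero_quat_def one_quat_def plus_quat_def uminus_quat_def
      minus_quat_def scaleR_quat_def times_quat_def algebra_simps)

end

instantiation quat :: real_inner
begin

definition "inner x y = qRe x * qRe y + qI x * qI y + qJ x * qJ y + qK x * qK y"
definition "norm (x :: quat) = sqrt (inner x x)"
definition "sgn (x :: quat) = x /\<^sub>R norm x"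
definition "dist (x :: quat) y = norm (x - y)"
definition [code del]: "(uniformity :: (quat \<times> quat) filter) =
  (INF e\<in>{0 <..}. principal {(x, y). dist x y < e})"
definition [code del]: "open (U :: quat set) \<longleftrightarrow>
  (\<forall>x\<in>U. eventually (\<lambda>(x', y). x' = x \<longrightarrow> y \<in> U) uniformity)"

instance
proof
  fix x y z :: quat and r :: real
  show "inner x y = inner y x"
    by (simp add: inner_quat_def)
  show "inner (x + y) z = inner x z + inner y z" "inner (r *\<^sub>R x) y = r * inner x y"
    by (simp_all add: inner_quat_def plus_quat_def scaleR_quat_def algebra_simps)
  show "0 \<le> inner x x"
    by (simp add: inner_quat_def)
  show "inner x x = 0 \<longleftrightarrow> x = 0"
    by (auto simp: inner_quat_def quat_eq_iff zero_quat_def add_nonneg_eq_0_iff)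
qed (rule norm_quat_def sgn_quat_def dist_quat_def uniformity_quat_def open_quat_def)+

end

definition qcnj :: "quat \<Rightarrow> quat"
  where "qcnj x = Quat (qRe x) (- qI x) (- qJ x) (- qK x)"

definition nrm :: "quat \<Rightarrow> real"
  where "nrm x = qRe (x * qcnj x)"

lemma mult_qcnj: "x * qcnj x = of_real (nrm x)"
  by (simp add: nrm_def qcnj_def times_quat_def of_real_def scaleR_quat_def one_quat_def)

lemma norm_quat_eq_sqrt_nrm: "norm x = sqrt (nrm x)"
  by (simp add: norm_quat_def inner_quat_def nrm_def qcnj_def times_quat_def)

definition dag :: "quat \<Rightarrow> quat"
  where "dag x = Quat (qRe x) (qI x) (qJ x) (- qK x)"

definition quat_of_complex :: "complex \<Rightarrow> quat"
  where "quat_of_complex z = Quat (Re z) (Im z) 0 0"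

definition complex_mat :: "quat \<Rightarrow> complex^2^2"
  where "complex_mat x =
    vector [vector [Complex (qRe x) (qI x), Complex (qJ x) (qK x)],
            vector [Complex (- qJ x) (qK x), Complex (qRe x) (- qI x)]]"

lemma complex_mat_mult: "complex_mat (x * y) = complex_mat x ** complex_mat y"
  by (simp add: complex_mat_def matrix_matrix_mult_def vec_eq_iff forall_2 sum_2
      times_quat_def complex_eq_iff algebra_simps)

text \<open>
  All rings are realised inside the quaternions. For negative rationals \<open>a\<close>, \<open>b\<close> the generators
  \<open>i\<close>, \<open>j\<close> of the rational quaternion algebra with \<open>i\<^sup>2 = a\<close>, \<open>j\<^sup>2 = b\<close> are the standard quaternion
  units \<open>i\<close>, \<open>j\<close> scaled by \<open>sqrt (-a)\<close>, \<open>sqrt (-b)\<close>, so that \<^const>\<open>dag\<close> restricts to the involution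
  that changes the sign of \<open>ij\<close>. The algebra is definite iff \<open>a\<close> and \<open>b\<close> are both negative.
\<close>

definition imag_quadratic_integers :: "rat \<Rightarrow> quat set"
  where "imag_quadratic_integers a =
    quat_of_complex ` {z. algebraic_int z \<and>
      (\<exists>x y :: rat. z = Complex (of_rat x) (of_rat y * sqrt (of_rat (- a))))}"

definition quat_algebra :: "rat \<Rightarrow> rat \<Rightarrow> quat set"
  where "quat_algebra a b =
    {Quat (of_rat x) (of_rat y * sqrt (of_rat (- a))) (of_rat z * sqrt (of_rat (- b)))
        (of_rat t * sqrt (of_rat (a * b))) | x y z t. True}"

text \<open>
  An order is a subring that is a finitely generated \<open>\<int>\<close>-module and spans the algebra over \<open>\<rat>\<close>.
\<close>
definition is_order :: "rat \<Rightarrow> rat \<Rightarrow> quat set \<Rightarrow> bool"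
  where "is_order a b R \<longleftrightarrow>
    R \<subseteq> quat_algebra a b \<and> 1 \<in> R \<and> (\<forall>x\<in>R. \<forall>y\<in>R. x * y \<in> R) \<and>
    (\<exists>B. finite B \<and> R = group_closure B) \<and>
    (\<forall>x\<in>quat_algebra a b. \<exists>m::int. m \<noteq> 0 \<and> of_int m * x \<in> R)"

definition is_maximal_order :: "rat \<Rightarrow> rat \<Rightarrow> quat set \<Rightarrow> bool"
  where "is_maximal_order a b R \<longleftrightarrow>
    is_order a b R \<and> (\<forall>R'. is_order a b R' \<and> R \<subseteq> R' \<longrightarrow> R' = R)"

definition is_dag_order :: "rat \<Rightarrow> rat \<Rightarrow> quat set \<Rightarrow> bool"
  where "is_dag_order a b R \<longleftrightarrow> is_order a b R \<and> dag ` R = R"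

definition is_maximal_dag_order :: "rat \<Rightarrow> rat \<Rightarrow> quat set \<Rightarrow> bool"
  where "is_maximal_dag_order a b R \<longleftrightarrow>
    is_dag_order a b R \<and> (\<forall>R'. is_dag_order a b R' \<and> R \<subseteq> R' \<longrightarrow> R' = R)"

text \<open>Throughout, \<open>n \<in> {3, 4, 5}\<close> is the dimension and \<open>R\<close> is the ring \<open>R(\<int>)\<close>.\<close>

definition is_integer_ring :: "nat \<Rightarrow> quat set \<Rightarrow> bool"
  where "is_integer_ring n R \<longleftrightarrow>
    n = 3 \<and> (\<exists>a<0. R = imag_quadratic_integers a) \<or>
    n = 4 \<and> (\<exists>a<0. \<exists>b<0. is_maximal_dag_order a b R) \<or>
    n = 5 \<and> (\<exists>a<0. \<exists>b<0. is_maximal_order a b R)"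

definition plus_part :: "nat \<Rightarrow> quat set \<Rightarrow> quat set"
  where "plus_part n R = (if n = 4 then {x \<in> R. dag x = x} else R)"

definition real_plus_part :: "nat \<Rightarrow> quat set \<Rightarrow> quat set"
  where "real_plus_part n R = span (plus_part n R)"

text \<open>
  The \<open>4 \<times> 4\<close> complex matrix obtained by replacing each entry with its \<open>2 \<times> 2\<close> block; rows and
  columns are indexed by pairs (block index, index within the block).
\<close>
definition block_mat :: "quat^2^2 \<Rightarrow> complex^(2 \<times> 2)^(2 \<times> 2)"
  where "block_mat M = (\<chi> p q. complex_mat (M $ fst p $ fst q) $ snd p $ snd q)"

definition dag_hat :: "quat^2^2 \<Rightarrow> quat^2^2"
  where "dag_hat M =
    vector [vector [dag (M $ 2 $ 2), - dag (M $ 1 $ 2)],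
            vector [- dag (M $ 2 $ 1), dag (M $ 1 $ 1)]]"

definition G_carrier :: "nat \<Rightarrow> quat set \<Rightarrow> (quat^2^2) set"
  where "G_carrier n R =
    {M. (\<forall>i j. M $ i $ j \<in> R) \<and>
      (if n = 3 then M $ 1 $ 1 * M $ 2 $ 2 - M $ 1 $ 2 * M $ 2 $ 1 = 1
       else if n = 4 then dag_hat M ** M = mat 1 \<and> M ** dag_hat M = mat 1
       else det (block_mat M) = 1)}"

definition G_group :: "nat \<Rightarrow> quat set \<Rightarrow> (quat^2^2) monoid"
  where "G_group n R = \<lparr>carrier = G_carrier n R, monoid.mult = (**), one = mat 1\<rparr>"

definition E_group :: "nat \<Rightarrow> quat set \<Rightarrow> (quat^2^2) set"
  where "E_group n R =
    generate (G_group n R) {M \<in> G_carrier n R. M $ 2 $ 1 = 0 \<or> M $ 1 $ 2 = 0}"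

definition hyperplane :: "nat \<Rightarrow> quat set \<Rightarrow> quat \<Rightarrow> quat set"
  where "hyperplane n R u = {x \<in> real_plus_part n R. inner x u = 0}"

definition covering_vector :: "nat \<Rightarrow> quat set \<Rightarrow> quat \<Rightarrow> bool"
  where "covering_vector n R u \<longleftrightarrow>
    u \<in> real_plus_part n R \<and> u \<noteq> 0 \<and> qRe u = 0 \<and>
    hyperplane n R u \<subseteq> (\<Union>c \<in> hyperplane n R u \<inter> R. ball c 1)"

definition normalized_covering_vector :: "nat \<Rightarrow> quat set \<Rightarrow> quat \<Rightarrow> bool"
  where "normalized_covering_vector n R u \<longleftrightarrow>
    covering_vector n R u \<and> u \<in> plus_part n R \<and>
    (\<forall>k::int. k > 1 \<longrightarrow> u /\<^sub>R of_int k \<notin> R)"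

definition admissible_shift :: "nat \<Rightarrow> quat set \<Rightarrow> quat \<Rightarrow> quat \<Rightarrow> bool"
  where "admissible_shift n R u \<tau> \<longleftrightarrow>
    \<tau> \<in> plus_part n R \<and> inner \<tau> u > 0 \<and>
    group_closure (insert \<tau> (hyperplane n R u \<inter> plus_part n R)) = plus_part n R"

text \<open>
  The type \<^typ>\<open>quat option\<close> is the one-point compactification, \<^const>\<open>None\<close> being the point at infinity.
  An oriented generalised sphere is the pair of its point set and its interior, both subsets of
  the compactified \<^const>\<open>real_plus_part\<close>; a transformation acts on both components.
\<close>

type_synonym osphere = "quat option set \<times> quat option set"

definition extended_space :: "nat \<Rightarrow> quat set \<Rightarrow> quat option set"
  where "extended_space n R = insert None (Some ` real_plus_part n R)"

definition transl :: "quat \<Rightarrow> quat option \<Rightarrow> quat option"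
  where "transl w = map_option (\<lambda>z. z + w)"

definition inversion :: "quat \<Rightarrow> quat option \<Rightarrow> quat option"
  where "inversion c p = (case p of None \<Rightarrow> Some c
    | Some z \<Rightarrow> if z = c then None else Some (c + (z - c) /\<^sub>R (norm (z - c))\<^sup>2))"

definition act :: "(quat option \<Rightarrow> quat option) \<Rightarrow> osphere \<Rightarrow> osphere"
  where "act g S = (g ` fst S, g ` snd S)"

definition oriented_hyperplane :: "nat \<Rightarrow> quat set \<Rightarrow> quat \<Rightarrow> osphere"
  where "oriented_hyperplane n R u =
    (insert None (Some ` hyperplane n R u), Some ` {x \<in> real_plus_part n R. inner x u > 0})"

definition reverse :: "nat \<Rightarrow> quat set \<Rightarrow> osphere \<Rightarrow> osphere"
  where "reverse n R S = (fst S, extended_space n R - (fst S \<union> snd S))"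

text \<open>The set of generators is closed under inverses, so closure under composition suffices.\<close>
inductive_set Gamma_u :: "nat \<Rightarrow> quat set \<Rightarrow> quat \<Rightarrow> quat \<Rightarrow> (quat option \<Rightarrow> quat option) set"
  for n R u \<tau>
  where
    one: "id \<in> Gamma_u n R u \<tau>"
  | translation: "g \<in> Gamma_u n R u \<tau> \<Longrightarrow> w \<in> plus_part n R \<inter> hyperplane n R u \<Longrightarrow>
      transl w \<circ> g \<in> Gamma_u n R u \<tau>"
  | inversion: "g \<in> Gamma_u n R u \<tau> \<Longrightarrow>
      c \<in> plus_part n R \<inter> (hyperplane n R u \<union> (+) \<tau> ` hyperplane n R u) \<Longrightarrow>
      inversion c \<circ> g \<in> Gamma_u n R u \<tau>"

definition base_spheres :: "nat \<Rightarrow> quat set \<Rightarrow> quat \<Rightarrow> quat \<Rightarrow> osphere set"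
  where "base_spheres n R u \<tau> =
    {oriented_hyperplane n R u, act (transl \<tau>) (reverse n R (oriented_hyperplane n R u))}"

definition arrangement :: "nat \<Rightarrow> quat set \<Rightarrow> quat \<Rightarrow> quat \<Rightarrow> osphere set"
  where "arrangement n R u \<tau> = {act g S | g S. g \<in> Gamma_u n R u \<tau> \<and> S \<in> base_spheres n R u \<tau>}"

text \<open>
  The region of \<^const>\<open>real_plus_part\<close> enclosed by an oriented sphere. For a hyperplane it is the
  half-space selected by the orientation. For a round sphere it is the open ball that the sphere
  bounds, whichever orientation the sphere carries: \<open>\<tau>\<close> lies in the interior of the base
  hyperplane, so the inversion centred at \<open>\<tau>\<close> sends this interior to the outside of a ball, and
  taking that side would make the density infinite for every \<open>u\<close>.
\<close>
definition Int_region :: "nat \<Rightarrow> quat set \<Rightarrow> osphere \<Rightarrow> quat set"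
  where "Int_region n R S =
    {x \<in> real_plus_part n R.
      Some x \<in> (if None \<in> snd S then snd (reverse n R S) else snd S)}"

text \<open>
  Lebesgue measure on \<^const>\<open>real_plus_part\<close>, which is the span of the first \<open>n - 1\<close> of the
  orthonormal units \<open>1, i, j, k\<close>.
\<close>
definition qunit :: "nat \<Rightarrow> quat"
  where "qunit k = [Quat 1 0 0 0, Quat 0 1 0 0, Quat 0 0 1 0, Quat 0 0 0 1] ! k"

definition coord_measure :: "nat \<Rightarrow> (nat \<Rightarrow> real) measure"
  where "coord_measure n = (\<Pi>\<^sub>M k\<in>{..<n - 1}. lborel)"

definition coord_set :: "nat \<Rightarrow> quat set \<Rightarrow> (nat \<Rightarrow> real) set"
  where "coord_set n A =
    {x \<in> space (coord_measure n). (\<Sum>k<n - 1. x k *\<^sub>R qunit k) \<in> A}"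

definition vol :: "nat \<Rightarrow> quat set \<Rightarrow> ennreal"
  where "vol n A = emeasure (coord_measure n) (coord_set n A)"

definition is_fundamental_domain :: "nat \<Rightarrow> quat set \<Rightarrow> quat set \<Rightarrow> bool"
  where "is_fundamental_domain n L F \<longleftrightarrow>
    F \<subseteq> span L \<and> coord_set n F \<in> sets (coord_measure n) \<and>
    (\<forall>x \<in> span L. \<exists>!y. y \<in> F \<and> x - y \<in> L)"

text \<open>Every measurable set of coset representatives of the lattice \<open>L\<close> has the same volume.\<close>
definition covolume :: "nat \<Rightarrow> quat set \<Rightarrow> ennreal"
  where "covolume n L = vol n (SOME F. is_fundamental_domain n L F)"

definition translation_rel :: "nat \<Rightarrow> quat set \<Rightarrow> quat \<Rightarrow> (osphere \<times> osphere) set"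
  where "translation_rel n R u =
    {(S, act (transl w) S) | S w. w \<in> plus_part n R \<inter> hyperplane n R u}"

text \<open>
  The translations fix both base spheres, so these may be removed before passing to orbits.
\<close>
definition packing_density :: "nat \<Rightarrow> quat set \<Rightarrow> quat \<Rightarrow> quat \<Rightarrow> ennreal"
  where "packing_density n R u \<tau> =
    (\<Sum>\<^sub>\<infinity>X \<in> (arrangement n R u \<tau> - base_spheres n R u \<tau>) // translation_rel n R u.
        vol n (Int_region n R (SOME S. S \<in> X))) / covolume n (plus_part n R)"

end

theory Submission
  imports Defs
begin

text \<open>
  If the closed unit balls around the points of \<open>R(\<int>)\<^sup>+\<close> leave a gap, then they also leave a gap at some
  rational point \<open>x\<close>. Reducing by inversions in unit spheres around lattice points, one sees that an
  element of \<open>E(\<int>)\<close> which fixes \<open>x\<close> is upper triangular, so the infinitely many parabolic elements of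
  \<open>G(\<int>)\<close> fixing \<open>x\<close> lie in different cosets of \<open>E(\<int>)\<close>.

  It remains to see that the density is at least 1 if there is no gap. If the arrangement contains a plane other than
  the two base planes, then its interior is a half-space, whose translates cover everything; this
  happens in particular if the base planes have distance at most 1. Otherwise consider the
  linear action of \<open>\<Gamma>\<^sub>u\<close> on the Lorentz model. The orbit of \<open>\<infinity>\<close> stays between the base planes, and so
  does the orbit of every point \<open>z\<close> that lies between them but in no interior. Always applying an inversion whose
  sphere contains the current point expands a neighbourhood of \<open>z\<close>, and one reaches elements \<open>g\<close> of
  \<open>\<Gamma>\<^sub>u\<close> with arbitrarily large expansion at \<open>z\<close> for which \<open>g z\<close> and \<open>g \<infinity>\<close> are uniformly
  separated. Pulling back a base plane by \<open>g\<close> yields a sphere whose interior is a small ball of radius comparable to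
  its distance from \<open>z\<close>. The points in no interior thus form a uniformly porous set, up to
  countably many exceptions, hence a null set, and the translates of the interiors cover almost everything.
\<close>

section \<open>Quaternions and matrices of size two\<close>

text \<open>An element of E(Z) is an arbitrary word, so greedy reduction helps only if it is
  confluent. Integrality of norms secures this: if an interior point of one unit ball lies in
  another, their centres are less than 2 apart, hence at squared distance 1, 2 or 3, and the two
  inversions satisfy an explicit dihedral relation. This serves twice: for matrices acting at a
  rational point, where rationality makes the levels discrete so that the descent terminates, and
  for the orbit of infinity, where it shows that the orbit never leaves the strip. The obstacle in
  the second half is that the closed balls may cover while the open ones do not. At a point missed
  by all open balls no inversion expands, so there is no uniform expansion by single steps. Such
  points are isolated and finite in number modulo the lattice, and an orbit that comes near one is
  followed until it is at a fixed distance again. Normalization of \<open>u\<close> and the bound on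
  its norm exclude a unit lattice vector parallel to \<open>u\<close>, whose reflection would merely
  exchange base planes at distance 1.\<close>

lemmas quat_defs = zero_quat_def one_quat_def plus_quat_def uminus_quat_def minus_quat_def
  scaleR_quat_def times_quat_def qcnj_def dag_def inner_quat_def

lemma quat_sel [simp]:
  "qRe 0 = 0" "qI 0 = 0" "qJ 0 = 0" "qK 0 = 0"
  "qRe 1 = 1" "qI 1 = 0" "qJ 1 = 0" "qK 1 = 0"
  "qRe (x + y) = qRe x + qRe y" "qI (x + y) = qI x + qI y"
  "qJ (x + y) = qJ x + qJ y" "qK (x + y) = qK x + qK y"
  "qRe (x - y) = qRe x - qRe y" "qI (x - y) = qI x - qI y"
  "qJ (x - y) = qJ x - qJ y" "qK (x - y) = qK x - qK y"
  "qRe (- x) = - qRe x" "qI (- x) = - qI x" "qJ (- x) = - qJ x" "qK (- x) = - qK x"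
  "qRe (r *\<^sub>R x) = r * qRe x" "qI (r *\<^sub>R x) = r * qI x"
  "qJ (r *\<^sub>R x) = r * qJ x" "qK (r *\<^sub>R x) = r * qK x"
  "qRe (qcnj x) = qRe x" "qI (qcnj x) = - qI x" "qJ (qcnj x) = - qJ x" "qK (qcnj x) = - qK x"
  "qRe (dag x) = qRe x" "qI (dag x) = qI x" "qJ (dag x) = qJ x" "qK (dag x) = - qK x"
  by (simp_all add: quat_defs)

lemma quat_sel_mult:
  "qRe (x * y) = qRe x * qRe y - qI x * qI y - qJ x * qJ y - qK x * qK y"
  "qI (x * y) = qRe x * qI y + qI x * qRe y + qJ x * qK y - qK x * qJ y"
  "qJ (x * y) = qRe x * qJ y - qI x * qK y + qJ x * qRe y + qK x * qI y"
  "qK (x * y) = qRe x * qK y + qI x * qJ y - qJ x * qI y + qK x * qRe y"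
  by (simp_all add: times_quat_def)

lemma quat_sel_of_real [simp]:
  "qRe (of_real r) = r" "qI (of_real r) = 0" "qJ (of_real r) = 0" "qK (of_real r) = 0"
  by (simp_all add: of_real_def)

lemma quat_sel_of_int [simp]:
  "qRe (of_int m) = of_int m" "qI (of_int m) = 0" "qJ (of_int m) = 0" "qK (of_int m) = 0"
  using quat_sel_of_real[of "of_int m"] unfolding of_real_of_int_eq by auto

lemma quat_sel_of_nat [simp]:
  "qRe (of_nat m) = of_nat m" "qI (of_nat m) = 0" "qJ (of_nat m) = 0" "qK (of_nat m) = 0"
  using quat_sel_of_int[of "int m"] by auto

lemma quat_sel_numeral [simp]:
  "qRe (numeral w) = numeral w" "qI (numeral w) = 0" "qJ (numeral w) = 0" "qK (numeral w) = 0"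
  using quat_sel_of_nat[of "numeral w"] by auto

lemma nrm_altdef: "nrm x = (qRe x)\<^sup>2 + (qI x)\<^sup>2 + (qJ x)\<^sup>2 + (qK x)\<^sup>2"
  by (simp add: nrm_def quat_sel_mult power2_eq_square)

lemma nrm_nonneg [simp]: "0 \<le> nrm x"
  by (simp add: nrm_altdef)

lemma nrm_eq_norm: "nrm x = (norm x)\<^sup>2"
  by (simp add: norm_quat_eq_sqrt_nrm)

lemma nrm_eq_inner: "nrm x = inner x x"
  by (simp add: nrm_eq_norm power2_norm_eq_inner)

lemma nrm_mult: "nrm (x * y) = nrm x * nrm y"
  by (simp add: nrm_altdef quat_sel_mult power2_eq_square algebra_simps)

lemma norm_quat_mult: "norm (x * y :: quat) = norm x * norm y"
  by (simp add: norm_quat_eq_sqrt_nrm nrm_mult real_sqrt_mult)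

lemma nrm_qcnj [simp]: "nrm (qcnj x) = nrm x"
  by (simp add: nrm_altdef)

lemma nrm_minus [simp]: "nrm (- x) = nrm x"
  by (simp add: nrm_altdef)

lemma nrm_dag [simp]: "nrm (dag x) = nrm x"
  by (simp add: nrm_altdef)

lemma nrm_0 [simp]: "nrm 0 = 0" and nrm_1 [simp]: "nrm 1 = 1"
  by (simp_all add: nrm_altdef)

lemma nrm_eq_0_iff [simp]: "nrm x = 0 \<longleftrightarrow> x = 0"
  by (simp add: nrm_eq_norm)

lemma nrm_add: "nrm (x + y) = nrm x + nrm y + 2 * inner x y"
  by (simp add: nrm_altdef inner_quat_def power2_eq_square algebra_simps)

lemma nrm_diff: "nrm (x - y) = nrm x + nrm y - 2 * inner x y"
  by (simp add: nrm_altdef inner_quat_def power2_eq_square algebra_simps)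

lemma qcnj_mult_self: "qcnj x * x = of_real (nrm x)"
  by (simp add: quat_eq_iff quat_sel_mult nrm_altdef power2_eq_square algebra_simps)

lemma qcnj_qcnj [simp]: "qcnj (qcnj x) = x"
  by (simp add: quat_eq_iff)

lemma qcnj_diff [simp]: "qcnj (x - y) = qcnj x - qcnj y"
  and qcnj_minus [simp]: "qcnj (- x) = - qcnj x"
  and qcnj_0 [simp]: "qcnj 0 = 0" and qcnj_1 [simp]: "qcnj 1 = 1"
  by (simp_all add: quat_eq_iff)

lemma qcnj_conv_trace: "qcnj x = of_real (2 * qRe x) - x"
  by (simp add: quat_eq_iff del: of_real_mult)

lemma dag_mult: "dag (x * y) = dag y * dag x"
  by (simp add: quat_eq_iff quat_sel_mult algebra_simps)

lemma dag_add [simp]: "dag (x + y) = dag x + dag y"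
  and dag_diff [simp]: "dag (x - y) = dag x - dag y"
  and dag_minus [simp]: "dag (- x) = - dag x"
  and dag_0 [simp]: "dag 0 = 0" and dag_1 [simp]: "dag 1 = 1"
  and dag_dag [simp]: "dag (dag x) = x"
  and dag_of_real [simp]: "dag (of_real r) = of_real r"
  by (simp_all add: quat_eq_iff)

lemma unit_qcnj_mult:
  assumes "nrm x = 1"
  shows "x * qcnj x = 1" "qcnj x * x = 1"
  using assms by (simp_all add: mult_qcnj qcnj_mult_self)

lemma unit_qcnj_mult_assoc:
  assumes "nrm x = 1"
  shows "x * (qcnj x * y) = y" "qcnj x * (x * y) = y"
  using unit_qcnj_mult[OF assms] by (simp_all flip: mult.assoc)

lemma inner_mult_left_qcnj: "inner (r * x) y = inner x (qcnj r * y)"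
  by (simp add: inner_quat_def quat_sel_mult algebra_simps)

definition mat2 :: "'a::zero \<Rightarrow> 'a \<Rightarrow> 'a \<Rightarrow> 'a \<Rightarrow> 'a^2^2"
  where "mat2 a b c d = vector [vector [a, b], vector [c, d]]"

lemma mat2_nth [simp]:
  fixes a b c d :: "'a::zero"
  shows "mat2 a b c d $ 1 $ 1 = a" "mat2 a b c d $ 1 $ 2 = b"
    "mat2 a b c d $ 2 $ 1 = c" "mat2 a b c d $ 2 $ 2 = d"
  by (simp_all add: mat2_def)

lemma mat2_eq_iff:
  fixes M N :: "'a^2^2"
  shows "M = N \<longleftrightarrow> M $ 1 $ 1 = N $ 1 $ 1 \<and> M $ 1 $ 2 = N $ 1 $ 2 \<and>
    M $ 2 $ 1 = N $ 2 $ 1 \<and> M $ 2 $ 2 = N $ 2 $ 2"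
  by (auto simp: vec_eq_iff forall_2)

lemma mat2_collapse: "mat2 (M $ 1 $ 1) (M $ 1 $ 2) (M $ 2 $ 1) (M $ 2 $ 2) = (M :: 'a::zero^2^2)"
  by (simp add: mat2_eq_iff)

lemma mat2_mult_nth:
  fixes M N :: "'a::semiring_1^2^2"
  shows "(M ** N) $ i $ j = M $ i $ 1 * N $ 1 $ j + M $ i $ 2 * N $ 2 $ j"
  by (simp add: matrix_matrix_mult_def sum_2)

lemma mat_1_nth [simp]:
  "(mat 1 :: 'a::zero_neq_one^2^2) $ 1 $ 1 = 1" "(mat 1 :: 'a^2^2) $ 1 $ 2 = 0"
  "(mat 1 :: 'a^2^2) $ 2 $ 1 = 0" "(mat 1 :: 'a^2^2) $ 2 $ 2 = 1"
  by (simp_all add: mat_def)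

text \<open>
  \<open>inv_step c M\<close> is the product of \<open>mat2 0 (-1) 1 0\<close>, the translation by \<open>- c\<close> and \<open>M\<close>:
  it continues \<open>M\<close> by the orientation preserving inversion centred at \<open>c\<close>.
\<close>
definition inv_step :: "quat \<Rightarrow> quat^2^2 \<Rightarrow> quat^2^2"
  where "inv_step c M = mat2 (- (M $ 2 $ 1)) (- (M $ 2 $ 2))
    (M $ 1 $ 1 - c * M $ 2 $ 1) (M $ 1 $ 2 - c * M $ 2 $ 2)"

lemma inv_step_conv: "inv_step c M = mat2 0 (-1) 1 0 ** (mat2 1 (- c) 0 1 ** M)"
  by (simp add: inv_step_def mat2_eq_iff mat2_mult_nth)

text \<open>These relations come from following the point \<open>c + r\<close>. A step at
  \<open>c'\<close> acts by \<open>z \<mapsto> -1 / (z - c')\<close>, so the step at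
  \<open>c\<close> sends \<open>c + r\<close> to \<open>- qcnj r / nrm r\<close>, and the further
  steps carry it on to infinity. The composite then agrees with the step at \<open>c + r\<close> up
  to an upper triangular factor. For norm 1 one further step suffices.\<close>

lemma inv_step_dihedral_1:
  assumes "nrm r = 1"
  shows "inv_step (c + r) g = mat2 (qcnj r) 1 0 r ** inv_step (- qcnj r) (inv_step c g)"
  using assms by (simp add: inv_step_def mat2_eq_iff mat2_mult_nth algebra_simps
      unit_qcnj_mult_assoc)

text \<open>The point \<open>c + r\<close> passes through \<open>- qcnj r / 2\<close> and
  \<open>- r\<close> on its way to infinity.\<close>

lemma inv_step_dihedral_2:
  assumes "nrm r = 2"
  shows "inv_step (c + r) g =
    mat2 1 (qcnj r) 0 1 ** inv_step (- r) (inv_step (- qcnj r) (inv_step c g))"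
proof -
  have *: "r * (qcnj r * y) = y + y" "qcnj r * (r * y) = y + y" for y
    using mult_qcnj[of r] qcnj_mult_self[of r] assms by (simp_all flip: mult.assoc add: mult_2)
  show ?thesis
    by (simp add: inv_step_def mat2_eq_iff mat2_mult_nth algebra_simps *)
qed

text \<open>The point \<open>c + r\<close> passes through \<open>- qcnj r / 3\<close>,
  \<open>- r / 2\<close>, \<open>- 2 * qcnj r / 3\<close> and \<open>- r\<close> on its way to
  infinity.\<close>

lemma inv_step_dihedral_3:
  assumes "nrm r = 3"
  shows "inv_step (c + r) g = mat2 1 (qcnj r) 0 1 **
    inv_step (- r) (inv_step (- qcnj r) (inv_step (- r) (inv_step (- qcnj r) (inv_step c g))))"
proof -
  have "3 * y = y + y + y" for y :: quat
    by (simp add: quat_eq_iff quat_sel_mult)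
  then have *: "r * (qcnj r * y) = y + y + y" "qcnj r * (r * y) = y + y + y" for y
    using mult_qcnj[of r] qcnj_mult_self[of r] assms by (simp_all flip: mult.assoc)
  show ?thesis
    by (simp add: inv_step_def mat2_eq_iff mat2_mult_nth algebra_simps *)
qed

section \<open>Reduction by inversions\<close>

text \<open>These are the facts about G(Z) that reduction needs, collected so that the three
  dimensions are treated at once; \<open>L\<close> plays the role of the lattice R(Z)^+. Since
  \<open>nrm d = 1\<close>, the term in \<open>G_upper_L\<close> is the image of \<open>q\<close>
  under the affine map \<open>q \<mapsto> (a * q + b) / d\<close>, which thus preserves
  \<open>L\<close>.\<close>

locale modular_group =
  fixes R L :: "quat set" and G :: "(quat^2^2) set"
  assumes R_1: "1 \<in> R"
    and R_diff: "x \<in> R \<Longrightarrow> y \<in> R \<Longrightarrow> x - y \<in> R"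
    and R_mult: "x \<in> R \<Longrightarrow> y \<in> R \<Longrightarrow> x * y \<in> R"
    and R_nrm: "x \<in> R \<Longrightarrow> nrm x \<in> \<int>"
    and L_subset: "L \<subseteq> R"
    and L_1: "1 \<in> L"
    and L_diff: "x \<in> L \<Longrightarrow> y \<in> L \<Longrightarrow> x - y \<in> L"
    and L_qcnj: "x \<in> L \<Longrightarrow> qcnj x \<in> L"
    and G_entries: "M \<in> G \<Longrightarrow> M $ i $ j \<in> R"
    and G_mult: "M \<in> G \<Longrightarrow> N \<in> G \<Longrightarrow> M ** N \<in> G"
    and G_inverse: "M \<in> G \<Longrightarrow> \<exists>N\<in>G. M ** N = mat 1 \<and> N ** M = mat 1"
    and G_translation: "q \<in> L \<Longrightarrow> mat2 1 q 0 1 \<in> G"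
    and G_inversion: "mat2 0 (-1) 1 0 \<in> G"
    and G_upper_nrm: "mat2 a b 0 d \<in> G \<Longrightarrow> nrm a = 1 \<and> nrm d = 1"
    and G_upper_L: "mat2 a b 0 d \<in> G \<Longrightarrow> q \<in> L \<Longrightarrow> (a * q + b) * qcnj d \<in> L"
    and G_diag: "mat2 a b 0 d \<in> G \<Longrightarrow> mat2 d 0 0 a \<in> G"
begin

lemma R_0: "0 \<in> R" and R_minus: "x \<in> R \<Longrightarrow> - x \<in> R"
  using R_diff[OF R_1 R_1] R_diff[of 0 x] by auto

lemma R_add: "x \<in> R \<Longrightarrow> y \<in> R \<Longrightarrow> x + y \<in> R"
  using R_diff[of x "- y"] R_minus by auto

lemma L_0: "0 \<in> L" and L_minus: "x \<in> L \<Longrightarrow> - x \<in> L"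
  using L_diff[OF L_1 L_1] L_diff[of 0 x] by auto

lemma L_add: "x \<in> L \<Longrightarrow> y \<in> L \<Longrightarrow> x + y \<in> L"
  using L_diff[of x "- y"] L_minus by auto

lemma G_one: "mat 1 \<in> G"
  using G_translation[OF L_0] by (simp add: mat2_eq_iff[of "mat2 1 0 0 1", symmetric]
      mat2_collapse[of "mat 1 :: quat^2^2", simplified])

lemma G_inv_step: "c \<in> L \<Longrightarrow> g \<in> G \<Longrightarrow> inv_step c g \<in> G"
  unfolding inv_step_conv by (intro G_mult G_inversion G_translation L_minus)

lemma G_minus_one: "mat2 (-1) 0 0 (-1) \<in> G"
proof -
  have "mat2 0 (-1) 1 0 ** mat2 0 (-1) 1 0 = mat2 (-1) 0 0 (-1 :: quat)"
    by (simp add: mat2_eq_iff mat2_mult_nth)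
  then show ?thesis
    using G_mult[OF G_inversion G_inversion] by simp
qed

text \<open>The relation \<open>inv_step_dihedral_1\<close> at \<open>c = 0\<close> expresses this
  matrix as a quotient of two products of generators.\<close>

lemma G_unit:
  assumes "r \<in> L" "nrm r = 1"
  shows "mat2 (qcnj r) 1 0 r \<in> G"
proof -
  let ?X = "inv_step (- qcnj r) (inv_step 0 (mat 1))"
  have "?X \<in> G"
    using assms by (intro G_inv_step G_one L_0 L_minus L_qcnj)
  then obtain Y where Y: "Y \<in> G" "?X ** Y = mat 1"
    using G_inverse by blast
  have "inv_step r (mat 1) ** Y = mat2 (qcnj r) 1 0 r ** (?X ** Y)"
    using inv_step_dihedral_1[OF assms(2), of 0 "mat 1"] by (simp add: matrix_mul_assoc)
  moreover have "inv_step r (mat 1) ** Y \<in> G"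
    using assms Y by (intro G_mult G_inv_step G_one)
  ultimately show ?thesis
    using Y by simp
qed

lemma G_upper_inverse_L:
  assumes "mat2 a b 0 d \<in> G" "q \<in> L"
  shows "qcnj a * (q * d - b) \<in> L"
proof -
  obtain N where N: "N \<in> G" "mat2 a b 0 d ** N = mat 1"
    using G_inverse[OF assms(1)] by blast
  have u: "nrm a = 1" "nrm d = 1"
    using G_upper_nrm[OF assms(1)] by auto
  from N(2) have e: "a * N $ 1 $ 1 + b * N $ 2 $ 1 = 1" "a * N $ 1 $ 2 + b * N $ 2 $ 2 = 0"
    "d * N $ 2 $ 1 = 0" "d * N $ 2 $ 2 = 1"
    by (simp_all add: mat2_eq_iff mat2_mult_nth)
  have "N $ 2 $ 1 = 0"
    using arg_cong[OF e(3), of "\<lambda>x. qcnj d * x"] u by (simp add: unit_qcnj_mult_assoc)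
  moreover have "N $ 2 $ 2 = qcnj d"
    using arg_cong[OF e(4), of "\<lambda>x. qcnj d * x"] u by (simp add: unit_qcnj_mult_assoc)
  moreover have "N $ 1 $ 1 = qcnj a"
    using arg_cong[OF e(1), of "\<lambda>x. qcnj a * x"] u \<open>N $ 2 $ 1 = 0\<close>
    by (simp add: unit_qcnj_mult_assoc)
  moreover have "N $ 1 $ 2 = - (qcnj a * (b * qcnj d))"
    using arg_cong[OF e(2), of "\<lambda>x. qcnj a * x"] u \<open>N $ 2 $ 2 = qcnj d\<close>
    by (simp add: unit_qcnj_mult_assoc algebra_simps add_eq_0_iff2)
  ultimately have "N = mat2 (qcnj a) (- (qcnj a * (b * qcnj d))) 0 (qcnj d)"
    by (simp add: mat2_eq_iff)
  then have "(qcnj a * q + - (qcnj a * (b * qcnj d))) * qcnj (qcnj d) \<in> L"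
    using N(1) assms(2) G_upper_L by metis
  then show ?thesis
    using u by (simp add: algebra_simps unit_qcnj_mult)
qed

text \<open>The term \<open>M $ 2 $ 1 * x + M $ 2 $ 2\<close> is the denominator of the action of
  \<open>M\<close> at \<open>x\<close>; its norm is called the level below. Reducibility means that
  some chain of inversions with strictly falling level ends in an upper triangular matrix.\<close>

inductive_set reducible :: "quat \<Rightarrow> (quat^2^2) set" for x
  where
    upper: "M \<in> G \<Longrightarrow> M $ 2 $ 1 = 0 \<Longrightarrow> M \<in> reducible x"
  | step: "M \<in> G \<Longrightarrow> c \<in> L \<Longrightarrow> inv_step c M \<in> reducible x \<Longrightarrow>
      nrm (inv_step c M $ 2 $ 1 * x + inv_step c M $ 2 $ 2) < nrm (M $ 2 $ 1 * x + M $ 2 $ 2) \<Longrightarrow>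
      M \<in> reducible x"

lemma reducible_imp_G: "M \<in> reducible x \<Longrightarrow> M \<in> G"
  by (erule reducible.cases) auto

text \<open>An upper triangular \<open>U\<close> has units on its diagonal, so it changes no level,
  and it turns a step at \<open>c\<close> into a step at the image \<open>c'\<close> of
  \<open>c\<close> under \<open>U\<close>. Moving \<open>U\<close> past the inversion leaves the
  diagonal matrix with \<open>a\<close> and \<open>d\<close> interchanged.\<close>

lemma reducible_upper_mult:
  assumes "M \<in> reducible x" "U \<in> G" "U $ 2 $ 1 = 0"
  shows "U ** M \<in> reducible x"
  using assms
proof (induction M arbitrary: U rule: reducible.induct)
  case (upper M)
  then show ?case
    by (intro reducible.upper G_mult) (auto simp: mat2_mult_nth)
next
  case (step M c)
  define a b d where "a = U $ 1 $ 1" and "b = U $ 1 $ 2" and "d = U $ 2 $ 2"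
  have U: "U = mat2 a b 0 d"
    using step.prems by (simp add: mat2_eq_iff a_def b_def d_def)
  have u: "nrm a = 1" "nrm d = 1"
    using G_upper_nrm step.prems(1) unfolding U by auto
  define c' where "c' = (a * c + b) * qcnj d"
  have c'd: "c' * d = a * c + b" "\<And>y. c' * (d * y) = a * (c * y) + b * y"
    using u by (simp_all add: c'_def algebra_simps unit_qcnj_mult unit_qcnj_mult_assoc)
  have eq: "inv_step c' (U ** M) = mat2 d 0 0 a ** inv_step c M"
    by (simp add: U inv_step_def mat2_eq_iff mat2_mult_nth c'd algebra_simps)
  have "mat2 d 0 0 a ** inv_step c M \<in> reducible x"
    by (rule step.IH) (use G_diag[of a b d] step.prems(1) in \<open>simp_all add: U\<close>)
  moreover have "c' \<in> L"
    unfolding c'_def using step.prems(1) step.hyps(2) unfolding U by (rule G_upper_L)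
  moreover have "nrm (inv_step c' (U ** M) $ 2 $ 1 * x + inv_step c' (U ** M) $ 2 $ 2)
      < nrm ((U ** M) $ 2 $ 1 * x + (U ** M) $ 2 $ 2)"
  proof -
    have "inv_step c' (U ** M) $ 2 $ 1 * x + inv_step c' (U ** M) $ 2 $ 2 =
        a * (inv_step c M $ 2 $ 1 * x + inv_step c M $ 2 $ 2)"
      unfolding eq by (simp add: mat2_mult_nth algebra_simps)
    moreover have "(U ** M) $ 2 $ 1 * x + (U ** M) $ 2 $ 2 = d * (M $ 2 $ 1 * x + M $ 2 $ 2)"
      by (simp add: U mat2_mult_nth algebra_simps)
    ultimately show ?thesis
      using step.hyps(4) u by (simp add: nrm_mult)
  qed
  moreover have "U ** M \<in> G"
    using step.hyps step.prems by (intro G_mult)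
  ultimately show ?case
    using reducible.step[of "U ** M" c' x] by (simp only: eq)
qed

lemma Ints_nonneg_less_4_cases:
  assumes "(k::real) \<in> \<int>" "0 < k" "k < 4"
  shows "k = 1 \<or> k = 2 \<or> k = 3"
proof -
  obtain m where m: "k = of_int m"
    using assms(1) by (auto elim: Ints_cases)
  then have "0 < m" "m < 4"
    using assms by auto
  then have "m = 1 \<or> m = 2 \<or> m = 3"
    by arith
  then show ?thesis
    using m by auto
qed

text \<open>
  The relations \<open>inv_step_dihedral_1\<close> to \<open>inv_step_dihedral_3\<close> make the reduction locally
  confluent: two centres that both lower the level are less than 2 apart, so that their
  difference has norm 1, 2 or 3.
\<close>
lemma reducible_inv_step:
  assumes N: "N > 0" "of_nat N * x \<in> R"
    and hole: "\<And>c. c \<in> L \<Longrightarrow> nrm (x - c) > 1"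
    and "g \<in> reducible x" "q \<in> L"
  shows "inv_step q g \<in> reducible x"
proof -
  define lev where "lev M = nrm (M $ 2 $ 1 * x + M $ 2 $ 2)" for M :: "quat^2^2"
  define rk where "rk M = nat \<lfloor>real N ^ 2 * lev M\<rfloor>" for M
  \<comment> \<open>Clearing the denominator \<open>N\<close> of \<open>x\<close> makes the scaled
    level a nonnegative integer, which is what the induction descends on.\<close>
  have lev_Ints: "real N ^ 2 * lev M \<in> \<int>" if "M \<in> G" for M
  proof -
    have "M $ 2 $ 1 * (of_nat N * x) + M $ 2 $ 2 * of_nat N = of_nat N * (M $ 2 $ 1 * x + M $ 2 $ 2)"
      by (simp add: quat_eq_iff quat_sel_mult algebra_simps)
    moreover have "of_nat N \<in> R"
    proof (induction N)
      case (Suc k)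
      then show ?case using R_add[OF R_1] by auto
    qed (simp add: R_0)
    then have "M $ 2 $ 1 * (of_nat N * x) + M $ 2 $ 2 * of_nat N \<in> R"
      by (intro R_add R_mult[OF G_entries[OF that] N(2)] R_mult[OF G_entries[OF that]])
    ultimately have "nrm (of_nat N * (M $ 2 $ 1 * x + M $ 2 $ 2)) \<in> \<int>"
      using R_nrm by simp
    moreover have "nrm (of_nat N) = real N ^ 2"
      by (simp add: nrm_altdef)
    ultimately show ?thesis
      by (simp add: nrm_mult lev_def)
  qed
  have rk_less: "rk M' < rk M" if lt: "lev M' < lev M" "M \<in> G" "M' \<in> G" for M M'
  proof -
    obtain k k' where k: "real N ^ 2 * lev M = of_int k" "real N ^ 2 * lev M' = of_int k'"
      using lev_Ints[OF lt(2)] lev_Ints[OF lt(3)] by (elim Ints_cases)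
    have "real N ^ 2 * lev M' < real N ^ 2 * lev M" "0 \<le> real N ^ 2 * lev M'"
      using lt(1) N(1) by (simp_all add: lev_def)
    then show ?thesis
      unfolding rk_def k by simp
  qed
  have lev_step: "lev (inv_step c M) = nrm ((M $ 1 $ 1 * x + M $ 1 $ 2) - c * (M $ 2 $ 1 * x + M $ 2 $ 2))"
    for c M
    by (simp add: lev_def inv_step_def algebra_simps)
  have "\<forall>q\<in>L. inv_step q g \<in> reducible x" if "g \<in> reducible x" for g
    using that
  proof (induction "rk g" arbitrary: g rule: less_induct)
    case less
    have gG: "g \<in> G"
      using less.prems by (rule reducible_imp_G)
    show ?case
    proof
      fix q assume q: "q \<in> L"
      show "inv_step q g \<in> reducible x"
      proof (cases "lev g < lev (inv_step q g)")
        case True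
        \<comment> \<open>A step at 0 undoes the step at \<open>q\<close> up to an upper triangular
          factor; as the step at \<open>q\<close> raises the level, undoing it is an admissible
          reduction.\<close>
        have eq: "inv_step 0 (inv_step q g) = mat2 (-1) 0 0 (-1) ** (mat2 1 (- q) 0 1 ** g)"
          by (simp add: inv_step_def mat2_eq_iff mat2_mult_nth)
        have "inv_step 0 (inv_step q g) \<in> reducible x"
          unfolding eq using q
          by (intro reducible_upper_mult less.prems G_minus_one G_translation L_minus) auto
        moreover have "lev (inv_step 0 (inv_step q g)) = lev g"
        proof -
          have "inv_step 0 (inv_step q g) $ 2 $ 1 * x + inv_step 0 (inv_step q g) $ 2 $ 2 =
              - (g $ 2 $ 1 * x + g $ 2 $ 2)"
            by (simp add: inv_step_def algebra_simps)
          then show ?thesis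
            by (simp only: lev_def nrm_minus)
        qed
        ultimately show ?thesis
          using True reducible.step[OF G_inv_step[OF q gG] L_0, of x] by (simp only: lev_def)
      next
        case False
        from less.prems show ?thesis
        proof cases
          case upper
          \<comment> \<open>An upper triangular matrix has level 1, and any step leads to a level
            \<open>nrm (x - c') > 1\<close> for a lattice point \<open>c'\<close>, because
            \<open>x\<close> lies in a gap. So this case does not occur here.\<close>
          define a b d where "a = g $ 1 $ 1" and "b = g $ 1 $ 2" and "d = g $ 2 $ 2"
          have g: "g = mat2 a b 0 d"
            using upper by (simp add: mat2_eq_iff a_def b_def d_def)
          have u: "nrm a = 1" "nrm d = 1"
            using G_upper_nrm gG unfolding g by auto
          have "lev (inv_step q g) = nrm (a * (x - qcnj a * (q * d - b)))"
            using u by (simp add: lev_step g algebra_simps unit_qcnj_mult_assoc)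
          moreover have "qcnj a * (q * d - b) \<in> L"
            using G_upper_inverse_L gG q unfolding g by blast
          ultimately have "lev (inv_step q g) > 1"
            using hole u by (simp add: nrm_mult)
          moreover have "lev g = 1"
            using u by (simp add: lev_def g)
          ultimately show ?thesis
            using False by simp
        next
          case (step c)
          define r where "r = q - c"
          have q_eq: "q = c + r"
            by (simp add: r_def)
          have rL: "r \<in> L"
            using q step by (simp add: r_def L_diff)
          have rcL: "- qcnj r \<in> L" and rmL: "- r \<in> L"
            using rL by (auto intro: L_minus L_qcnj)
          \<comment> \<open>After translation by \<open>- c\<close>, these are the numerator and the
            denominator at \<open>x\<close>. All levels along the dihedral chain are norms of
            combinations of the two, with coefficients built from \<open>r\<close>.\<close>
          define \<alpha> \<beta> where "\<alpha> = (g $ 1 $ 1 * x + g $ 1 $ 2) - c * (g $ 2 $ 1 * x + g $ 2 $ 2)"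
            and "\<beta> = g $ 2 $ 1 * x + g $ 2 $ 2"
          have "lev (inv_step c g) < lev g"
            using step(4) by (simp only: lev_def)
          moreover have "lev (inv_step c g) = nrm \<alpha>" "lev g = nrm \<beta>"
            by (simp_all add: lev_step \<alpha>_def) (simp add: lev_def \<beta>_def)
          moreover have "lev (inv_step q g) = nrm (\<alpha> - r * \<beta>)"
            by (simp add: lev_step \<alpha>_def \<beta>_def q_eq algebra_simps)
          ultimately have lt: "nrm \<alpha> < nrm \<beta>" and le: "nrm (\<alpha> - r * \<beta>) \<le> nrm \<beta>"
            using False by simp_all
          have IH: "inv_step q' g' \<in> reducible x"
            if "g' \<in> reducible x" "lev g' < nrm \<beta>" "q' \<in> L" for g' q'
            using less.hyps[OF rk_less[of g' g]] that gG reducible_imp_G[of g' x]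
            by (auto simp: lev_def[of g] \<beta>_def)
          let ?g1 = "inv_step c g"
          let ?g2 = "inv_step (- qcnj r) ?g1"
          let ?g3 = "inv_step (- r) ?g2"
          let ?g4 = "inv_step (- qcnj r) ?g3"
          have lev1: "lev ?g1 = nrm \<alpha>"
            by (simp add: lev_step \<alpha>_def)
          have red1: "?g1 \<in> reducible x"
            by (rule step)
          have red2: "?g2 \<in> reducible x"
            by (rule IH[OF red1 _ rcL]) (use lt lev1 in simp)
          show ?thesis
          proof (cases "r = 0")
            case True
            then show ?thesis
              using step by (simp add: q_eq)
          next
            case False
            \<comment> \<open>One of the two bounds is strict because \<open>c\<close> properly
              lowers the level; this excludes norm 4.\<close>
            have "norm (r * \<beta>) < 2 * norm \<beta>"
            proof -
              have "norm (r * \<beta>) = norm (\<alpha> - (\<alpha> - r * \<beta>))"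
                by simp
              also have "\<dots> \<le> norm \<alpha> + norm (\<alpha> - r * \<beta>)"
                by (rule norm_triangle_ineq4)
              also have "\<dots> < norm \<beta> + norm \<beta>"
                using lt le by (intro add_less_le_mono) (auto simp: norm_quat_eq_sqrt_nrm)
              finally show ?thesis by simp
            qed
            moreover have "norm \<beta> > 0"
              using le_less_trans[OF nrm_nonneg lt] by auto
            ultimately have "norm r < 2"
              by (simp add: norm_quat_mult)
            then have "nrm r < 4"
              using power_strict_mono[of "norm r" 2 2] by (simp add: nrm_eq_norm)
            moreover have "nrm r \<in> \<int>"
              using rL L_subset R_nrm by auto
            moreover have "nrm r > 0"
              using False nrm_nonneg[of r] by (simp add: less_le del: nrm_nonneg)
            ultimately consider "nrm r = 1" | "nrm r = 2" | "nrm r = 3"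
              using Ints_nonneg_less_4_cases by metis
            then show ?thesis
            proof cases
              case 1
              then show ?thesis
                unfolding q_eq inv_step_dihedral_1[OF 1]
                using red2 rL by (intro reducible_upper_mult G_unit) auto
            next
              case 2
              have lev2: "lev ?g2 = nrm (\<beta> - qcnj r * \<alpha>)"
              proof -
                have "lev ?g2 = nrm (- (\<beta> - qcnj r * \<alpha>))"
                  by (simp add: lev_step[of "- qcnj r"])
                     (simp add: inv_step_def \<alpha>_def \<beta>_def algebra_simps)
                then show ?thesis by (simp only: nrm_minus)
              qed
              have "nrm (\<alpha> - r * \<beta>) = nrm \<alpha> + 2 * nrm \<beta> - 2 * inner \<alpha> (r * \<beta>)"
                using 2 by (simp add: nrm_diff nrm_mult)
              moreover have "nrm (\<beta> - qcnj r * \<alpha>) = nrm \<beta> + 2 * nrm \<alpha> - 2 * inner \<alpha> (r * \<beta>)"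
                using 2 by (simp add: nrm_diff nrm_mult inner_mult_left_qcnj[symmetric] inner_commute)
              ultimately have "lev ?g2 < nrm \<beta>"
                using lt le lev2 by linarith
              then have "?g3 \<in> reducible x"
                by (rule IH[OF red2 _ rmL])
              then show ?thesis
                unfolding q_eq inv_step_dihedral_2[OF 2]
                using rL by (intro reducible_upper_mult G_translation L_qcnj) auto
            next
              case 3
              have three: "3 * y = y + y + y" and two: "2 * y = y + y" for y :: quat
                by (simp_all add: quat_eq_iff quat_sel_mult)
              have **: "r * (qcnj r * y) = y + y + y" "qcnj r * (r * y) = y + y + y" for y
                using mult_qcnj[of r] qcnj_mult_self[of r] 3 by (simp_all flip: mult.assoc add: three)
              \<comment> \<open>The mixed term satisfies
                \<open>2 * ?t \<ge> nrm \<alpha> + 2 * nrm \<beta>\<close>, which bounds the levels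
                of \<open>?g2\<close> and \<open>?g3\<close> by
                \<open>2 * nrm \<alpha> - nrm \<beta>\<close> and that of \<open>?g4\<close> by
                \<open>nrm \<alpha>\<close>. The chain thus stays below \<open>nrm \<beta>\<close>,
                where the induction hypothesis applies.\<close>
              let ?t = "inner \<alpha> (r * \<beta>)"
              have t: "nrm \<alpha> + 3 * nrm \<beta> - 2 * ?t \<le> nrm \<beta>"
                using le 3 by (simp add: nrm_diff nrm_mult)
              have t': "inner \<beta> (qcnj r * \<alpha>) = ?t"
                by (simp add: inner_mult_left_qcnj[symmetric] inner_commute)
              have sc: "nrm 2 = 4" "inner (2 * y) z = 2 * inner y z"
                "inner y (2 * z) = 2 * inner y z" for y z :: quat
                by (simp_all add: nrm_altdef inner_quat_def quat_sel_mult algebra_simps)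
              have a2: "?g2 $ 2 $ 1 * x + ?g2 $ 2 $ 2 = qcnj r * \<alpha> - \<beta>"
                by (simp add: inv_step_def \<alpha>_def \<beta>_def algebra_simps)
              have a3: "?g3 $ 2 $ 1 * x + ?g3 $ 2 $ 2 = 2 * \<alpha> - r * \<beta>"
                by (simp add: inv_step_def \<alpha>_def \<beta>_def algebra_simps two **)
              have a4: "?g4 $ 2 $ 1 * x + ?g4 $ 2 $ 2 = qcnj r * \<alpha> - 2 * \<beta>"
                by (simp add: inv_step_def \<alpha>_def \<beta>_def algebra_simps two **)
              have "lev ?g2 < nrm \<beta>"
                using t lt 3 unfolding lev_def a2
                by (simp add: nrm_diff nrm_mult t' inner_commute[of _ \<beta>])
              then have red3: "?g3 \<in> reducible x"
                by (rule IH[OF red2 _ rmL])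
              have "lev ?g3 < nrm \<beta>"
                using t lt 3 unfolding lev_def a3 by (simp add: nrm_diff nrm_mult sc)
              then have red4: "?g4 \<in> reducible x"
                by (rule IH[OF red3 _ rcL])
              have "lev ?g4 < nrm \<beta>"
                using t lt 3 unfolding lev_def a4
                by (simp add: nrm_diff nrm_mult sc t' inner_commute[of _ \<beta>])
              then have "inv_step (- r) ?g4 \<in> reducible x"
                by (rule IH[OF red4 _ rmL])
              then show ?thesis
                unfolding q_eq inv_step_dihedral_3[OF 3]
                using rL by (intro reducible_upper_mult G_translation L_qcnj) auto
            qed
          qed
        qed
      qed
    qed
  qed
  then show ?thesis
    using assms by auto
qed

definition elem_group :: "(quat^2^2) set"
  where "elem_group = generate \<lparr>carrier = G, monoid.mult = (**), one = mat 1\<rparr>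
    {M \<in> G. M $ 2 $ 1 = 0 \<or> M $ 1 $ 2 = 0}"

lemma group_G: "group \<lparr>carrier = G, monoid.mult = (**), one = mat 1\<rparr>"
proof (rule groupI)
  fix x assume "x \<in> carrier \<lparr>carrier = G, monoid.mult = (**), one = mat 1\<rparr>"
  then show "\<exists>y\<in>carrier \<lparr>carrier = G, monoid.mult = (**), one = mat 1\<rparr>.
      y \<otimes>\<^bsub>\<lparr>carrier = G, monoid.mult = (**), one = mat 1\<rparr>\<^esub> x = \<one>\<^bsub>\<lparr>carrier = G, monoid.mult = (**), one = mat 1\<rparr>\<^esub>"
    using G_inverse[of x] by auto
qed (simp_all add: G_one G_mult matrix_mul_assoc)

text \<open>Conjugation by \<open>mat2 0 (-1) 1 0\<close> exchanges lower and upper triangular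
  matrices, so a lower triangular factor acts through two inversion steps at 0.\<close>

lemma G_lower_conv:
  assumes "M \<in> G" "M $ 1 $ 2 = 0"
  shows "mat2 (M $ 2 $ 2) (- (M $ 2 $ 1)) 0 (M $ 1 $ 1) \<in> G"
    "M ** g = mat2 (-1) 0 0 (-1) ** inv_step 0
      (mat2 (M $ 2 $ 2) (- (M $ 2 $ 1)) 0 (M $ 1 $ 1) ** inv_step 0 g)"
proof -
  have "mat2 (M $ 2 $ 2) (- (M $ 2 $ 1)) 0 (M $ 1 $ 1) =
      mat2 (-1) 0 0 (-1) ** (mat2 0 (-1) 1 0 ** (M ** mat2 0 (-1) 1 0))"
    using assms(2) by (simp add: mat2_eq_iff mat2_mult_nth)
  then show "mat2 (M $ 2 $ 2) (- (M $ 2 $ 1)) 0 (M $ 1 $ 1) \<in> G"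
    using assms(1) G_mult G_minus_one G_inversion by simp
  show "M ** g = mat2 (-1) 0 0 (-1) ** inv_step 0
      (mat2 (M $ 2 $ 2) (- (M $ 2 $ 1)) 0 (M $ 1 $ 1) ** inv_step 0 g)"
    using assms(2) by (simp add: mat2_eq_iff mat2_mult_nth inv_step_def algebra_simps)
qed

lemma triangular_inverse:
  assumes "M \<in> G" "M $ 2 $ 1 = 0 \<or> M $ 1 $ 2 = 0" "M ** N = mat 1"
  shows "N $ 2 $ 1 = 0 \<or> N $ 1 $ 2 = 0"
  using assms(2)
proof
  assume "M $ 2 $ 1 = 0"
  then have M: "M = mat2 (M $ 1 $ 1) (M $ 1 $ 2) 0 (M $ 2 $ 2)"
    by (simp add: mat2_eq_iff)
  have "nrm (M $ 2 $ 2) = 1"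
    using G_upper_nrm assms(1) M by metis
  moreover have "M $ 2 $ 2 * N $ 2 $ 1 = 0"
    using assms(3) \<open>M $ 2 $ 1 = 0\<close> by (simp add: mat2_eq_iff mat2_mult_nth)
  ultimately show ?thesis
    using unit_qcnj_mult_assoc(2)[of "M $ 2 $ 2" "N $ 2 $ 1"] by simp
next
  assume "M $ 1 $ 2 = 0"
  then have "nrm (M $ 1 $ 1) = 1"
    using G_upper_nrm G_lower_conv(1)[OF assms(1)] by blast
  moreover have "M $ 1 $ 1 * N $ 1 $ 2 = 0"
    using assms(3) \<open>M $ 1 $ 2 = 0\<close> by (simp add: mat2_eq_iff mat2_mult_nth)
  ultimately show ?thesis
    using unit_qcnj_mult_assoc(2)[of "M $ 1 $ 1" "N $ 1 $ 2"] by simp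
qed

lemma subgroup_E: "subgroup elem_group \<lparr>carrier = G, monoid.mult = (**), one = mat 1\<rparr>"
  unfolding elem_group_def by (rule group.generate_is_subgroup[OF group_G]) auto

text \<open>Upper triangular generators preserve reducibility by
  \<open>reducible_upper_mult\<close>; lower triangular ones do so by
  \<open>reducible_inv_step\<close> applied to the two steps of \<open>G_lower_conv\<close>.\<close>

lemma E_mult_reducible:
  assumes N: "N > 0" "of_nat N * x \<in> R"
    and hole: "\<And>c. c \<in> L \<Longrightarrow> nrm (x - c) > 1"
    and "e \<in> elem_group" "g \<in> reducible x"
  shows "e ** g \<in> reducible x"
proof -
  have tri: "M ** g \<in> reducible x"
    if "M \<in> G" "M $ 2 $ 1 = 0 \<or> M $ 1 $ 2 = 0" "g \<in> reducible x" for M g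
    using that(2)
  proof
    assume "M $ 2 $ 1 = 0"
    then show ?thesis
      using reducible_upper_mult that by blast
  next
    assume M: "M $ 1 $ 2 = 0"
    have "inv_step 0 g \<in> reducible x"
      by (rule reducible_inv_step[OF N hole that(3) L_0])
    then have "mat2 (M $ 2 $ 2) (- (M $ 2 $ 1)) 0 (M $ 1 $ 1) ** inv_step 0 g \<in> reducible x"
      using G_lower_conv(1)[OF that(1) M] by (intro reducible_upper_mult) auto
    then have "inv_step 0 (mat2 (M $ 2 $ 2) (- (M $ 2 $ 1)) 0 (M $ 1 $ 1) ** inv_step 0 g) \<in> reducible x"
      by (intro reducible_inv_step[OF N hole _ L_0])
    then show ?thesis
      unfolding G_lower_conv(2)[OF that(1) M] by (intro reducible_upper_mult G_minus_one) auto
  qed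
  interpret group "\<lparr>carrier = G, monoid.mult = (**), one = mat 1\<rparr>"
    by (rule group_G)
  show ?thesis
    using assms(4,5) unfolding elem_group_def
  proof (induction e arbitrary: g rule: generate.induct)
    case (inv h)
    let ?k = "m_inv \<lparr>carrier = G, monoid.mult = (**), one = mat 1\<rparr> h"
    have "?k \<in> G" "h ** ?k = mat 1"
      using inv inv_closed[of h] r_inv[of h] by auto
    then show ?case
      using tri[of ?k g] triangular_inverse[of h ?k] inv by auto
  next
    case (eng h1 h2)
    then show ?case
      by (simp flip: matrix_mul_assoc)
  qed (auto intro: tri)
qed

text \<open>Such an \<open>e\<close> is reducible, being the image of the reducible identity matrix.
  It has level 1 and fixes \<open>x\<close>, so a step at \<open>c\<close> would have level
  \<open>nrm (x - c) > 1\<close> and cannot reduce it; hence \<open>e\<close> is already upper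
  triangular.\<close>

lemma E_fix_imp_upper:
  assumes N: "N > 0" "of_nat N * x \<in> R"
    and hole: "\<And>c. c \<in> L \<Longrightarrow> nrm (x - c) > 1"
    and "e \<in> elem_group" "e $ 1 $ 1 * x + e $ 1 $ 2 = x" "e $ 2 $ 1 * x + e $ 2 $ 2 = 1"
  shows "e $ 2 $ 1 = 0"
proof -
  have "mat 1 \<in> reducible x"
    by (intro reducible.upper G_one) simp
  have "e ** mat 1 \<in> reducible x"
    by (rule E_mult_reducible[OF N hole assms(4) \<open>mat 1 \<in> reducible x\<close>])
  then have "e \<in> reducible x"
    by simp
  then show ?thesis
  proof cases
    case (step c)
    have "inv_step c e $ 2 $ 1 * x + inv_step c e $ 2 $ 2 =
        (e $ 1 $ 1 * x + e $ 1 $ 2) - c * (e $ 2 $ 1 * x + e $ 2 $ 2)"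
      by (simp add: inv_step_def algebra_simps)
    then show ?thesis
      using step(4) assms(5,6) hole[OF step(2)] by simp
  qed
qed

text \<open>
  Conjugates of unipotent matrices fixing \<open>x\<close> are never in \<open>elem_group\<close>, so they separate cosets.
\<close>
lemma infinite_rcosets_E:
  assumes N: "N > 0" "of_nat N * x \<in> R"
    and hole: "\<And>c. c \<in> L \<Longrightarrow> nrm (x - c) > 1"
    and parabolic: "\<And>m::int. mat2 1 x 0 1 ** (mat2 1 0 (of_int m * of_nat N * of_nat N) 1 **
      mat2 1 (- x) 0 1) \<in> G"
  shows "infinite (rcosets\<^bsub>\<lparr>carrier = G, monoid.mult = (**), one = mat 1\<rparr>\<^esub> elem_group)"
proof -
  let ?G = "\<lparr>carrier = G, monoid.mult = (**), one = mat 1 :: quat^2^2\<rparr>"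
  define k where "k m = (of_int m * of_nat N * of_nat N :: quat)" for m
  define P where "P m = mat2 1 x 0 1 ** (mat2 1 0 (k m) 1 ** mat2 1 (- x) 0 1)" for m :: int
  interpret group ?G
    by (rule group_G)
  interpret elem_group: subgroup elem_group ?G
    by (rule subgroup_E)
  have P_G: "P m \<in> G" for m
    using parabolic by (simp add: P_def k_def)
  have k_eq_0: "k m = 0 \<longleftrightarrow> m = 0" for m
  proof -
    have "qRe (k m) = of_int m * real N * real N"
      by (simp add: k_def quat_sel_mult)
    moreover have "k 0 = 0"
      by (simp add: k_def)
    ultimately show ?thesis
      using N(1) by (auto simp: quat_eq_iff)
  qed
  have P_mult: "P m ** P m' = P (m + m')" for m m'
  proof -
    have "k (m + m') = k m + k m'"
      by (simp add: k_def algebra_simps)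
    then show ?thesis
      by (simp add: P_def mat2_eq_iff mat2_mult_nth algebra_simps)
  qed
  have P_0: "P 0 = mat 1"
    by (simp add: P_def k_def mat2_eq_iff mat2_mult_nth)
  have P_E: "m = 0" if "P m \<in> elem_group" for m
  proof -
    have "P m $ 2 $ 1 = 0"
      by (rule E_fix_imp_upper[OF N hole that]) (simp_all add: P_def mat2_mult_nth algebra_simps)
    then show ?thesis
      by (simp add: P_def mat2_mult_nth k_eq_0)
  qed
  have "inj (\<lambda>m. elem_group #>\<^bsub>?G\<^esub> P m)"
  proof (rule injI)
    fix m m' assume "elem_group #>\<^bsub>?G\<^esub> P m = elem_group #>\<^bsub>?G\<^esub> P m'"
    moreover have "P m \<in> elem_group #>\<^bsub>?G\<^esub> P m"
      by (rule rcos_self[OF _ subgroup_E]) (simp add: P_G)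
    ultimately obtain e where e: "e \<in> elem_group" "P m = e ** P m'"
      by (auto simp: r_coset_def)
    have "P (m - m') = P m ** P (- m')"
      by (simp add: P_mult)
    also have "\<dots> = e"
      by (simp add: e(2) P_mult P_0 flip: matrix_mul_assoc)
    finally show "m = m'"
      using P_E[of "m - m'"] e(1) by simp
  qed
  then have "infinite (range (\<lambda>m. elem_group #>\<^bsub>?G\<^esub> P m))"
    by (simp add: finite_image_iff)
  moreover have "range (\<lambda>m. elem_group #>\<^bsub>?G\<^esub> P m) \<subseteq> rcosets\<^bsub>?G\<^esub> elem_group"
    using P_G by (auto simp: RCOSETS_def)
  ultimately show ?thesis
    using finite_subset by blast
qed

end

section \<open>Integrality of norms and traces\<close>

lemma UNIV_2x2: "(UNIV :: (2 \<times> 2) set) = {(1,1),(1,2),(2,1),(2,2)}"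
  unfolding UNIV_Times_UNIV[symmetric] UNIV_2 by auto

lemma det_2x2:
  fixes A :: "'a::comm_ring_1^(2 \<times> 2)^(2 \<times> 2)"
  shows "det A =
    A$(1,1)$(1,1) * A$(1,2)$(1,2) * A$(2,1)$(2,1) * A$(2,2)$(2,2)
    - A$(1,1)$(1,1) * A$(1,2)$(1,2) * A$(2,1)$(2,2) * A$(2,2)$(2,1)
    - A$(1,1)$(1,1) * A$(1,2)$(2,1) * A$(2,1)$(1,2) * A$(2,2)$(2,2)
    + A$(1,1)$(1,1) * A$(1,2)$(2,1) * A$(2,1)$(2,2) * A$(2,2)$(1,2)
    + A$(1,1)$(1,1) * A$(1,2)$(2,2) * A$(2,1)$(1,2) * A$(2,2)$(2,1)
    - A$(1,1)$(1,1) * A$(1,2)$(2,2) * A$(2,1)$(2,1) * A$(2,2)$(1,2)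
    - A$(1,1)$(1,2) * A$(1,2)$(1,1) * A$(2,1)$(2,1) * A$(2,2)$(2,2)
    + A$(1,1)$(1,2) * A$(1,2)$(1,1) * A$(2,1)$(2,2) * A$(2,2)$(2,1)
    + A$(1,1)$(1,2) * A$(1,2)$(2,1) * A$(2,1)$(1,1) * A$(2,2)$(2,2)
    - A$(1,1)$(1,2) * A$(1,2)$(2,1) * A$(2,1)$(2,2) * A$(2,2)$(1,1)
    - A$(1,1)$(1,2) * A$(1,2)$(2,2) * A$(2,1)$(1,1) * A$(2,2)$(2,1)
    + A$(1,1)$(1,2) * A$(1,2)$(2,2) * A$(2,1)$(2,1) * A$(2,2)$(1,1)
    + A$(1,1)$(2,1) * A$(1,2)$(1,1) * A$(2,1)$(1,2) * A$(2,2)$(2,2)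
    - A$(1,1)$(2,1) * A$(1,2)$(1,1) * A$(2,1)$(2,2) * A$(2,2)$(1,2)
    - A$(1,1)$(2,1) * A$(1,2)$(1,2) * A$(2,1)$(1,1) * A$(2,2)$(2,2)
    + A$(1,1)$(2,1) * A$(1,2)$(1,2) * A$(2,1)$(2,2) * A$(2,2)$(1,1)
    + A$(1,1)$(2,1) * A$(1,2)$(2,2) * A$(2,1)$(1,1) * A$(2,2)$(1,2)
    - A$(1,1)$(2,1) * A$(1,2)$(2,2) * A$(2,1)$(1,2) * A$(2,2)$(1,1)
    - A$(1,1)$(2,2) * A$(1,2)$(1,1) * A$(2,1)$(1,2) * A$(2,2)$(2,1)
    + A$(1,1)$(2,2) * A$(1,2)$(1,1) * A$(2,1)$(2,1) * A$(2,2)$(1,2)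
    + A$(1,1)$(2,2) * A$(1,2)$(1,2) * A$(2,1)$(1,1) * A$(2,2)$(2,1)
    - A$(1,1)$(2,2) * A$(1,2)$(1,2) * A$(2,1)$(2,1) * A$(2,2)$(1,1)
    - A$(1,1)$(2,2) * A$(1,2)$(2,1) * A$(2,1)$(1,1) * A$(2,2)$(1,2)
    + A$(1,1)$(2,2) * A$(1,2)$(2,1) * A$(2,1)$(1,2) * A$(2,2)$(1,1)"
proof -
  have f1: "finite {(1::2,2::2),(2,1),(2,2)}" "(1,1) \<notin> {(1::2,2::2),(2::2,1::2),(2,2)}" by auto
  have f2: "finite {(2::2,1::2),(2,2)}" "(1,2) \<notin> {(2::2,1::2),(2,2)}" by auto
  have f3: "finite {(2::2,2::2)}" "(2,1) \<notin> {(2::2,2::2)}" by auto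
  show ?thesis
    unfolding det_def UNIV_2x2
    unfolding sum_over_permutations_insert[OF f1]
    unfolding sum_over_permutations_insert[OF f2]
    unfolding sum_over_permutations_insert[OF f3]
    unfolding permutes_sing
    by (simp add: sign_swap_id permutation_swap_id sign_compose sign_id transpose_def permutation_compose algebra_simps)
qed

text \<open>This is the Study determinant of a quaternionic matrix, the square of its Dieudonne
  determinant.\<close>

lemma det_block_mat:
  "det (block_mat M) = of_real (nrm (M$1$1) * nrm (M$2$2) + nrm (M$1$2) * nrm (M$2$1)
    - 2 * qRe (M$1$1 * (qcnj (M$2$1) * (M$2$2 * qcnj (M$1$2)))))"
proof -
  define a b c d where "a = M$1$1" and "b = M$1$2" and "c = M$2$1" and "d = M$2$2"
  show ?thesis
    unfolding det_2x2 unfolding block_mat_def complex_mat_def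
    apply (simp flip: a_def b_def c_def d_def)
    apply (simp add: complex_eq_iff nrm_altdef power2_eq_square quat_sel_mult)
    apply (simp add: algebra_simps)
    done
qed

text \<open>If \<open>q\<close> is the reduced denominator of \<open>r\<close>, then every power of
  \<open>q\<close> divides \<open>M\<close>; already \<open>q ^ nat M\<close> would exceed
  \<open>M\<close> if \<open>q \<ge> 2\<close>.\<close>

lemma Ints_if_bounded_denominator_powers:
  fixes r :: real
  assumes "r \<in> \<rat>" "M > (0::int)" "\<And>k. of_int M * r ^ k \<in> \<int>"
  shows "r \<in> \<int>"
proof -
  obtain p q where pq: "q > 0" "coprime p q" "r = of_int p / of_int q"
    using assms(1) by (elim Rats_cases')
  have dvd: "q ^ k dvd M" for k
  proof -
    obtain m where "of_int M * r ^ k = real_of_int m"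
      using assms(3)[of k] by (auto elim: Ints_cases)
    then have "real_of_int (M * p ^ k) = of_int (m * q ^ k)"
      using pq by (simp add: field_simps)
    then have "M * p ^ k = m * q ^ k"
      by (simp only: of_int_eq_iff)
    then have "q ^ k dvd M * p ^ k"
      by simp
    then show ?thesis
      using pq(2) by (simp add: coprime_dvd_mult_left_iff coprime_commute)
  qed
  have "q = 1"
  proof (rule ccontr)
    assume "q \<noteq> 1"
    then have "2 \<le> q"
      using pq(1) by simp
    have "int (nat M) < 2 ^ nat M"
      using of_nat_less_two_power[of "nat M", where 'a = int] by simp
    also have "(2::int) ^ nat M \<le> q ^ nat M"
      using \<open>2 \<le> q\<close> by (intro power_mono) auto
    also have "\<dots> \<le> M"
      using dvd[of "nat M"] assms(2) by (rule zdvd_imp_le)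
    finally show False
      using assms(2) by simp
  qed
  then show ?thesis
    using pq by simp
qed

text \<open>The multiples by \<open>1 / m\<close> of integral combinations of 1, i, j, ij, where i
  and j square to \<open>a\<close> and \<open>b\<close>. Lying in one such lattice expresses a
  common bound on denominators.\<close>

definition den_lattice :: "rat \<Rightarrow> rat \<Rightarrow> int \<Rightarrow> quat set"
  where "den_lattice a b m =
    {Quat (of_rat x) (of_rat y * sqrt (of_rat (- a))) (of_rat z * sqrt (of_rat (- b)))
        (of_rat t * sqrt (of_rat (a * b))) | x y z t.
      of_int m * x \<in> \<int> \<and> of_int m * y \<in> \<int> \<and> of_int m * z \<in> \<int> \<and> of_int m * t \<in> \<int>}"

lemma den_lattice_diff:
  assumes "v \<in> den_lattice a b m" "w \<in> den_lattice a b m"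
  shows "v - w \<in> den_lattice a b m"
proof -
  obtain x y z t x' y' z' t' where *:
    "v = Quat (of_rat x) (of_rat y * sqrt (of_rat (- a))) (of_rat z * sqrt (of_rat (- b)))
        (of_rat t * sqrt (of_rat (a * b)))"
    "w = Quat (of_rat x') (of_rat y' * sqrt (of_rat (- a))) (of_rat z' * sqrt (of_rat (- b)))
        (of_rat t' * sqrt (of_rat (a * b)))"
    "of_int m * x \<in> \<int>" "of_int m * y \<in> \<int>" "of_int m * z \<in> \<int>" "of_int m * t \<in> \<int>"
    "of_int m * x' \<in> \<int>" "of_int m * y' \<in> \<int>" "of_int m * z' \<in> \<int>" "of_int m * t' \<in> \<int>"
    using assms unfolding den_lattice_def by blast
  show ?thesis
    unfolding den_lattice_def mem_Collect_eq
    by (rule exI[of _ "x - x'"], rule exI[of _ "y - y'"], rule exI[of _ "z - z'"], rule exI[of _ "t - t'"])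
       (use * in \<open>simp add: quat_eq_iff of_rat_diff algebra_simps\<close>)
qed

lemma den_lattice_0: "0 \<in> den_lattice a b m"
  unfolding den_lattice_def mem_Collect_eq by (rule exI[of _ 0])+ (simp add: quat_eq_iff)

lemma den_lattice_add:
  assumes "v \<in> den_lattice a b m" "w \<in> den_lattice a b m"
  shows "v + w \<in> den_lattice a b m"
  using den_lattice_diff[OF assms(1) den_lattice_diff[OF den_lattice_0 assms(2)]] by simp

lemma den_lattice_of_int_mult:
  assumes "v \<in> den_lattice a b m"
  shows "of_int k * v \<in> den_lattice a b m"
proof -
  have *: "of_nat k * v \<in> den_lattice a b m" for k
    by (induction k) (auto simp: den_lattice_0 algebra_simps intro: den_lattice_add assms)
  show ?thesis
  proof (cases "k \<ge> 0")
    case True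
    then show ?thesis using *[of "nat k"] by simp
  next
    case False
    then show ?thesis
      using den_lattice_diff[OF den_lattice_0 *[of "nat (- k)"]] by (simp add: algebra_simps)
  qed
qed

lemma den_lattice_sum:
  assumes "\<And>i. i \<in> A \<Longrightarrow> f i \<in> den_lattice a b m"
  shows "sum f A \<in> den_lattice a b m"
  using assms by (induction A rule: infinite_finite_induct) (auto intro: den_lattice_0 den_lattice_add)

lemma Ints_mult_cancel_left: "of_int m * x \<in> \<int> \<Longrightarrow> of_int (k * m) * x \<in> \<int>"
  for x :: "'a::ring_1"
  using Ints_mult[of "of_int k" "of_int m * x"] by (simp add: mult.assoc)

lemma den_lattice_mono: "v \<in> den_lattice a b m \<Longrightarrow> v \<in> den_lattice a b (k * m)"
  unfolding den_lattice_def using Ints_mult_cancel_left[where 'a = rat] by blast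

lemma rat_denominator: "\<exists>m>0. of_int m * (x::rat) \<in> \<int>"
proof -
  obtain p q where "x = of_int p / of_int q" "q > 0"
    by (metis quotient_of_div quotient_of_denom_pos surj_pair)
  then show ?thesis
    by (intro exI[of _ q]) auto
qed

lemma quat_algebra_den_lattice:
  assumes "w \<in> quat_algebra a b"
  shows "\<exists>m>0. w \<in> den_lattice a b m"
proof -
  obtain x y z t where w: "w = Quat (of_rat x) (of_rat y * sqrt (of_rat (- a))) (of_rat z * sqrt (of_rat (- b)))
        (of_rat t * sqrt (of_rat (a * b)))"
    using assms unfolding quat_algebra_def by blast
  obtain k1 k2 k3 k4 where k: "k1 > 0" "of_int k1 * x \<in> \<int>" "k2 > 0" "of_int k2 * y \<in> \<int>"
    "k3 > 0" "of_int k3 * z \<in> \<int>" "k4 > 0" "of_int k4 * t \<in> \<int>"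
    using rat_denominator by metis
  let ?m = "k1 * k2 * k3 * k4"
  have "of_int ?m * x \<in> \<int>" "of_int ?m * y \<in> \<int>" "of_int ?m * z \<in> \<int>" "of_int ?m * t \<in> \<int>"
    using Ints_mult_cancel_left[OF k(2), of "k2 * k3 * k4"] Ints_mult_cancel_left[OF k(4), of "k1 * k3 * k4"]
      Ints_mult_cancel_left[OF k(6), of "k1 * k2 * k4"] Ints_mult_cancel_left[OF k(8), of "k1 * k2 * k3"]
    by (simp_all add: mult_ac)
  then have "w \<in> den_lattice a b ?m"
    unfolding den_lattice_def w by blast
  moreover have "?m > 0"
    using k by simp
  ultimately show ?thesis by blast
qed

lemma finite_den_lattice:
  assumes "finite B" "B \<subseteq> quat_algebra a b"
  shows "\<exists>m>0. B \<subseteq> den_lattice a b m"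
  using assms
proof (induction B)
  case empty
  then show ?case by (intro exI[of _ 1]) auto
next
  case (insert x B)
  then obtain m m' where m: "m > 0" "B \<subseteq> den_lattice a b m" "m' > 0" "x \<in> den_lattice a b m'"
    using quat_algebra_den_lattice by fastforce
  then have "insert x B \<subseteq> den_lattice a b (m * m')"
    using den_lattice_mono[of _ a b m m'] den_lattice_mono[of x a b m' m] by (auto simp: mult.commute)
  then show ?case
    using m by (intro exI[of _ "m * m'"]) auto
qed

lemma group_closure_subset_den_lattice:
  assumes "B \<subseteq> den_lattice a b m"
  shows "group_closure B \<subseteq> den_lattice a b m"
proof
  fix v assume "v \<in> group_closure B"
  then show "v \<in> den_lattice a b m"
    by induction (use assms den_lattice_0 den_lattice_diff in auto)
qed

lemma nrm_quat_algebra: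
  assumes "a < 0" "b < 0"
  shows "nrm (Quat (of_rat x) (of_rat y * sqrt (of_rat (- a))) (of_rat z * sqrt (of_rat (- b)))
        (of_rat t * sqrt (of_rat (a * b)))) = of_rat (x\<^sup>2 - a * y\<^sup>2 - b * z\<^sup>2 + a * b * t\<^sup>2)"
proof -
  have "(0::real) \<le> of_rat (- a)" "(0::real) \<le> of_rat (- b)" "(0::real) \<le> of_rat (a * b)"
    using assms by (simp_all only: zero_le_of_rat_iff) (simp_all add: mult_nonpos_nonpos)
  then show ?thesis
    by (simp add: nrm_altdef power_mult_distrib of_rat_add of_rat_diff of_rat_minus of_rat_mult of_rat_power)
qed

lemma nrm_den_lattice:
  assumes "a < 0" "b < 0" "m > 0"
  shows "\<exists>M>0. \<forall>w\<in>den_lattice a b m. of_int M * nrm w \<in> \<int> \<and> nrm w \<in> \<rat>"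
proof -
  obtain p q where pq: "p > 0" "of_int p * a \<in> \<int>" "q > 0" "of_int q * b \<in> \<int>"
    using rat_denominator by metis
  show ?thesis
  proof (intro exI[of _ "m * m * p * q"] conjI ballI)
    fix w assume "w \<in> den_lattice a b m"
    then obtain x y z t where w: "w = Quat (of_rat x) (of_rat y * sqrt (of_rat (- a))) (of_rat z * sqrt (of_rat (- b)))
        (of_rat t * sqrt (of_rat (a * b)))"
      and i: "of_int m * x \<in> \<int>" "of_int m * y \<in> \<int>" "of_int m * z \<in> \<int>" "of_int m * t \<in> \<int>"
      unfolding den_lattice_def by blast
    let ?N = "x\<^sup>2 - a * y\<^sup>2 - b * z\<^sup>2 + a * b * t\<^sup>2"
    have n: "nrm w = of_rat ?N"
      unfolding w by (rule nrm_quat_algebra) fact+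
    then show "nrm w \<in> \<rat>"
      by simp
    obtain x' y' z' t' a' b' where e: "of_int m * x = of_int x'" "of_int m * y = of_int y'"
      "of_int m * z = of_int z'" "of_int m * t = of_int t'" "of_int p * a = of_int a'" "of_int q * b = of_int b'"
      using i pq by (elim Ints_cases)
    have "of_int (m * m * p * q) * ?N =
        of_int (p * q) * (of_int m * x) * (of_int m * x) -
        of_int q * (of_int p * a) * (of_int m * y) * (of_int m * y) -
        of_int p * (of_int q * b) * (of_int m * z) * (of_int m * z) +
        (of_int p * a) * (of_int q * b) * (of_int m * t) * (of_int m * t)"
      by (simp add: power2_eq_square algebra_simps)
    also have "\<dots> \<in> \<int>"
      unfolding e by simp
    finally obtain k where "of_int (m * m * p * q) * ?N = of_int k"
      by (auto elim: Ints_cases)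
    then have "of_int (m * m * p * q) * nrm w = of_int k"
      unfolding n by (metis of_rat_mult of_rat_of_int_eq)
    then show "of_int (m * m * p * q) * nrm w \<in> \<int>"
      by simp
  qed (use assms pq in simp)
qed

lemma nrm_power: "nrm (w ^ k) = nrm w ^ k"
  by (induction k) (simp_all add: nrm_mult)

lemma nrm_Ints_if_powers_den_lattice:
  assumes "a < 0" "b < 0" "m > 0" "\<And>k. w ^ k \<in> den_lattice a b m"
  shows "nrm w \<in> \<int>"
proof -
  obtain M where M: "M > 0" "\<And>w. w \<in> den_lattice a b m \<Longrightarrow> of_int M * nrm w \<in> \<int>"
    "\<And>w. w \<in> den_lattice a b m \<Longrightarrow> nrm w \<in> \<rat>"
    using nrm_den_lattice[OF assms(1-3)] by auto
  have "nrm w \<in> \<rat>"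
    using M(3)[OF assms(4)[of 1]] by simp
  moreover have "of_int M * nrm w ^ k \<in> \<int>" for k
    using M(2)[OF assms(4)[of k]] by (simp add: nrm_power)
  ultimately show ?thesis
    using M(1) Ints_if_bounded_denominator_powers by blast
qed

lemma trace_Ints_if_powers_den_lattice:
  assumes "a < 0" "b < 0" "m > 0" "\<And>k. w ^ k \<in> den_lattice a b m"
  shows "2 * qRe w \<in> \<int>"
proof -
  \<comment> \<open>The extra factor \<open>w ^ j\<close> lets the induction replace one factor
    \<open>w + 1\<close> at a time.\<close>
  have "(w + 1) ^ k * w ^ j \<in> den_lattice a b m" for k j
  proof (induction k arbitrary: j)
    case (Suc k)
    have "(w + 1) ^ Suc k * w ^ j = (w + 1) ^ k * w ^ Suc j + (w + 1) ^ k * w ^ j"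
      by (simp only: power_Suc2[of "w + 1"] power_Suc[of w] distrib_left distrib_right mult.assoc mult_1_left)
    then show ?case
      using Suc by (simp only: den_lattice_add)
  qed (use assms in simp)
  from this[of _ 0] have "nrm (w + 1) \<in> \<int>"
    using assms by (intro nrm_Ints_if_powers_den_lattice[of a b m]) auto
  moreover have "nrm w \<in> \<int>"
    using assms by (rule nrm_Ints_if_powers_den_lattice)
  moreover have "2 * qRe w = nrm (w + 1) - nrm w - 1"
    by (simp add: nrm_altdef power2_eq_square algebra_simps)
  ultimately show ?thesis
    by simp
qed

text \<open>
  The powers of an element \<open>w\<close> of an order have a common denominator, and so do those of its norm,
  which is therefore an integer; for the trace, apply this to \<open>w + 1\<close>.
\<close>
lemma order_nrm_trace:
  assumes "a < 0" "b < 0" "is_order a b R" "w \<in> R"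
  shows "nrm w \<in> \<int>" "2 * qRe w \<in> \<int>"
proof -
  obtain B where B: "finite B" "R = group_closure B" and R: "R \<subseteq> quat_algebra a b" "1 \<in> R"
    "\<And>x y. x \<in> R \<Longrightarrow> y \<in> R \<Longrightarrow> x * y \<in> R"
    using assms(3) unfolding is_order_def by auto
  have "B \<subseteq> R"
    unfolding B(2) by (auto intro: group_closure.base)
  then obtain m where m: "m > 0" "B \<subseteq> den_lattice a b m"
    using finite_den_lattice[OF B(1)] R by blast
  then have "R \<subseteq> den_lattice a b m"
    unfolding B(2) by (intro group_closure_subset_den_lattice)
  moreover have "w ^ k \<in> R" for k
    using R assms(4) by (induction k) auto
  ultimately have "\<And>k. w ^ k \<in> den_lattice a b m"
    by auto
  then show "nrm w \<in> \<int>" "2 * qRe w \<in> \<int>"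
    using nrm_Ints_if_powers_den_lattice trace_Ints_if_powers_den_lattice assms(1,2) m(1) by blast+
qed

section \<open>Rings of integers of imaginary quadratic fields\<close>

lemma quat_of_complex_sel [simp]:
  "qRe (quat_of_complex z) = Re z" "qI (quat_of_complex z) = Im z"
  "qJ (quat_of_complex z) = 0" "qK (quat_of_complex z) = 0"
  by (simp_all add: quat_of_complex_def)

lemma quat_of_complex_hom:
  "quat_of_complex 1 = 1" "quat_of_complex (z * w) = quat_of_complex z * quat_of_complex w"
  "quat_of_complex (z + w) = quat_of_complex z + quat_of_complex w"
  "quat_of_complex 0 = 0" "quat_of_complex (- z) = - quat_of_complex z"
  "quat_of_complex (of_int k) = of_int k"
  by (simp_all add: quat_eq_iff quat_sel_mult)

lemma quat_of_complex_sum: "quat_of_complex (sum f A) = (\<Sum>i\<in>A. quat_of_complex (f i))"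
  by (induction A rule: infinite_finite_induct) (simp_all add: quat_of_complex_hom)

text \<open>A monic integral equation of degree \<open>n\<close> writes every power as an integral
  combination of the first \<open>n\<close> powers, so a common denominator of these serves all of
  them.\<close>

lemma algebraic_int_powers_den_lattice:
  assumes "algebraic_int z" "\<And>k. quat_of_complex (z ^ k) \<in> quat_algebra a b"
  shows "\<exists>m>0. \<forall>k. quat_of_complex (z ^ k) \<in> den_lattice a b m"
proof -
  obtain p where p: "lead_coeff p = 1" "\<And>i. coeff p i \<in> \<int>" "poly p z = 0"
    using assms(1) by (auto elim: algebraic_int.cases)
  define n where "n = degree p"
  obtain m where m: "m > 0" "(\<lambda>k. quat_of_complex (z ^ k)) ` {..<n} \<subseteq> den_lattice a b m"
    using finite_den_lattice[of "(\<lambda>k. quat_of_complex (z ^ k)) ` {..<n}" a b] assms(2) by auto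
  have "\<forall>i. \<exists>m. coeff p i = of_int m"
    using p(2) by (auto elim!: Ints_cases)
  then obtain c where c: "\<And>i. coeff p i = of_int (c i)"
    by metis
  have "0 = (\<Sum>i\<le>n. coeff p i * z ^ i)"
    using p(3) by (simp add: poly_altdef n_def)
  also have "\<dots> = (\<Sum>i<n. of_int (c i) * z ^ i) + z ^ n"
    using p(1) by (simp add: c n_def lessThan_Suc_atMost[symmetric])
  finally have zn: "z ^ n = - (\<Sum>i<n. of_int (c i) * z ^ i)"
    by (simp add: eq_neg_iff_add_eq_0 add.commute)
  have "quat_of_complex (z ^ k) \<in> den_lattice a b m" for k
  proof (induction k rule: less_induct)
    case (less k)
    show ?case
    proof (cases "k < n")
      case False
      have "z ^ k = z ^ (k - n) * z ^ n"
        using False by (simp flip: power_add)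
      also have "\<dots> = - (\<Sum>i<n. of_int (c i) * z ^ (k - n + i))"
        unfolding zn by (simp add: sum_distrib_left power_add mult_ac)
      finally have "quat_of_complex (z ^ k) = 0 - (\<Sum>i<n. of_int (c i) * quat_of_complex (z ^ (k - n + i)))"
        by (simp add: quat_of_complex_hom quat_of_complex_sum)
      also have "\<dots> \<in> den_lattice a b m"
        using False by (intro den_lattice_diff den_lattice_0 den_lattice_sum den_lattice_of_int_mult less) auto
      finally show ?thesis .
    qed (use m in auto)
  qed
  then show ?thesis
    using m by auto
qed

text \<open>Integral trace and norm characterize the integers: in one direction by the bounded
  denominators of all powers, in the other by the polynomial with coefficients \<open>l\<close>,
  \<open>- k\<close>, 1, where \<open>k\<close> is the trace and \<open>l\<close> the norm.\<close>

lemma imag_quadratic_integers_altdef: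
  assumes "a < 0"
  shows "imag_quadratic_integers a =
    {Quat (of_rat x) (of_rat y * sqrt (of_rat (- a))) 0 0 | x y.
      2 * x \<in> \<int> \<and> x\<^sup>2 - a * y\<^sup>2 \<in> \<int>}" (is "_ = ?R")
proof (intro equalityI subsetI)
  have s: "sqrt (of_rat (- a)) * sqrt (of_rat (- a)) = (of_rat (- a) :: real)"
    using assms by simp
  fix w assume "w \<in> imag_quadratic_integers a"
  then obtain z x y where z: "algebraic_int z" "z = Complex (of_rat x) (of_rat y * sqrt (of_rat (- a)))"
    and w: "w = quat_of_complex z"
    unfolding imag_quadratic_integers_def by auto
  have "\<exists>x y. z ^ k = Complex (of_rat x) (of_rat y * sqrt (of_rat (- a)))" for k
  proof (induction k)
    case 0
    show ?case by (rule exI[of _ 1], rule exI[of _ 0]) (simp add: complex_eq_iff)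
  next
    case (Suc k)
    then obtain x' y' where "z ^ k = Complex (of_rat x') (of_rat y' * sqrt (of_rat (- a)))"
      by blast
    then show ?case
      by (intro exI[of _ "x * x' + y * y' * a"] exI[of _ "x * y' + y * x'"])
         (use s in \<open>simp add: z complex_eq_iff of_rat_mult of_rat_add of_rat_minus algebra_simps\<close>)
  qed
  \<comment> \<open>The parameter \<open>-1\<close> merely completes the field to some definite
    quaternion algebra, so that the lemmas on \<open>den_lattice\<close> apply.\<close>
  then have "quat_of_complex (z ^ k) \<in> quat_algebra a (-1)" for k
    unfolding quat_algebra_def mem_Collect_eq quat_of_complex_def
    by (metis complex.sel mult_zero_left of_rat_0)
  then obtain m where m: "m > 0" "\<And>k. quat_of_complex (z ^ k) \<in> den_lattice a (-1) m"
    using algebraic_int_powers_den_lattice[OF z(1)] by blast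
  have wk: "w ^ k = quat_of_complex (z ^ k)" for k
    by (induction k) (simp_all add: w quat_of_complex_hom)
  have "nrm w \<in> \<int>" "2 * qRe w \<in> \<int>"
    using nrm_Ints_if_powers_den_lattice[of a "-1" m w] trace_Ints_if_powers_den_lattice[of a "-1" m w]
      assms m wk by auto
  moreover have "nrm w = of_rat (x\<^sup>2 - a * y\<^sup>2)"
    using nrm_quat_algebra[OF assms, of "-1" x y 0 0] by (simp add: w z quat_of_complex_def)
  moreover have "2 * qRe w = of_rat (2 * x)"
    by (simp add: w z of_rat_mult)
  ultimately have "x\<^sup>2 - a * y\<^sup>2 \<in> \<int>" "2 * x \<in> \<int>"
    by (metis Ints_cases Ints_of_int of_rat_eq_iff of_rat_of_int_eq)+
  then show "w \<in> ?R"
    by (auto simp: w z quat_of_complex_def)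
next
  fix w assume "w \<in> ?R"
  then obtain x y where w: "w = Quat (of_rat x) (of_rat y * sqrt (of_rat (- a))) 0 0"
    and i: "2 * x \<in> \<int>" "x\<^sup>2 - a * y\<^sup>2 \<in> \<int>"
    by blast
  obtain k l where kl: "2 * x = of_int k" "x\<^sup>2 - a * y\<^sup>2 = of_int l"
    using i by (elim Ints_cases)
  define z where "z = Complex (of_rat x) (of_rat y * sqrt (of_rat (- a)))"
  have kl': "2 * of_rat x = real_of_int k" "(of_rat x)\<^sup>2 - of_rat a * (of_rat y)\<^sup>2 = real_of_int l"
    using kl[THEN arg_cong[of _ _ "of_rat :: rat \<Rightarrow> real"]]
    by (simp_all add: of_rat_mult of_rat_diff of_rat_power)
  have s: "(sqrt (of_rat (- a)))\<^sup>2 = (- of_rat a :: real)"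
    using assms by (simp add: of_rat_minus)
  let ?p = "[:of_int l, - of_int k, 1:] :: complex poly"
  have "poly ?p z = 0"
  proof -
    have "real_of_int l + (of_rat x)\<^sup>2 - (of_rat y)\<^sup>2 * (- of_rat a) - of_int k * of_rat x = 0"
      using kl' by (simp flip: kl' add: power2_eq_square algebra_simps)
    moreover have "2 * of_rat x * (of_rat y * sqrt (of_rat (- a))) = real_of_int k * (of_rat y * sqrt (of_rat (- a)))"
      by (simp only: kl')
    ultimately show ?thesis
      by (simp add: complex_eq_iff z_def algebra_simps power2_eq_square
          flip: s)
  qed
  then have "algebraic_int z"
    by (intro algebraic_int.intros[of ?p]) (auto simp: coeff_pCons split: nat.splits)
  moreover have "w = quat_of_complex z"
    by (simp add: w z_def quat_of_complex_def)
  ultimately show "w \<in> imag_quadratic_integers a"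
    unfolding imag_quadratic_integers_def z_def by blast
qed

text \<open>\<open>P\<close> is a rational root of the monic integral polynomial with roots
  \<open>P\<close> and \<open>Q\<close>.\<close>

lemma rat_Ints_if_sum_prod_Ints:
  fixes P Q :: rat
  assumes "P + Q \<in> \<int>" "P * Q \<in> \<int>"
  shows "P \<in> \<int>"
proof (rule rational_algebraic_int_is_int)
  let ?p = "[:P * Q, - (P + Q), 1:]"
  show "algebraic_int P"
    by (rule algebraic_int.intros[of ?p])
       (use assms Ints_minus[OF assms(1)] in \<open>auto simp: coeff_pCons algebra_simps split: nat.splits\<close>)
  show "P \<in> \<rat>"
    using Rats_of_rat[of P, where 'a = rat] by simp
qed

definition imag_quadratic_order :: "rat \<Rightarrow> quat set"
  where "imag_quadratic_order a =
    {Quat (of_rat x) (of_rat y * sqrt (of_rat (- a))) 0 0 | x y.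
      2 * x \<in> \<int> \<and> x\<^sup>2 - a * y\<^sup>2 \<in> \<int>}"

text \<open>For \<open>v\<close> and \<open>w\<close> with these coordinates, the number is the
  trace of \<open>v * w\<close> and \<open>?Q\<close> is the trace of \<open>v * qcnj w\<close>.
  Their sum is the product of the traces, and their product is a polynomial in traces and norms, so
  both are integers.\<close>

lemma imag_quadratic_mixed_trace:
  fixes a x y x' y' :: rat
  assumes "2 * x \<in> \<int>" "x\<^sup>2 - a * y\<^sup>2 \<in> \<int>" "2 * x' \<in> \<int>" "x'\<^sup>2 - a * y'\<^sup>2 \<in> \<int>"
  shows "2 * (x * x' + a * y * y') \<in> \<int>"
proof (rule rat_Ints_if_sum_prod_Ints)
  let ?Q = "2 * (x * x' - a * y * y')"
  have "2 * (x * x' + a * y * y') + ?Q = (2 * x) * (2 * x')"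
    by (simp add: algebra_simps)
  also have "\<dots> \<in> \<int>"
    by (rule Ints_mult[OF assms(1,3)])
  finally show "2 * (x * x' + a * y * y') + ?Q \<in> \<int>" .
  have "2 * (x * x' + a * y * y') * ?Q = (2 * x) * (2 * x) * (x'\<^sup>2 - a * y'\<^sup>2) +
      (2 * x') * (2 * x') * (x\<^sup>2 - a * y\<^sup>2) - 4 * (x\<^sup>2 - a * y\<^sup>2) * (x'\<^sup>2 - a * y'\<^sup>2)"
    by (simp add: power2_eq_square algebra_simps)
  also have "\<dots> \<in> \<int>"
    by (intro Ints_add Ints_diff Ints_mult[OF Ints_mult[OF assms(1) assms(1)] assms(4)]
        Ints_mult[OF Ints_mult[OF assms(3) assms(3)] assms(2)]
        Ints_mult[OF Ints_mult[OF _ assms(2)] assms(4)]) simp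
  finally show "2 * (x * x' + a * y * y') * ?Q \<in> \<int>" .
qed

lemma imag_quadratic_order_ring:
  assumes "a < 0" "v \<in> imag_quadratic_order a" "w \<in> imag_quadratic_order a"
  shows "v - w \<in> imag_quadratic_order a" "v * w \<in> imag_quadratic_order a"
    "nrm v \<in> \<int>" "2 * qRe v \<in> \<int>"
proof -
  obtain x y x' y' where v: "v = Quat (of_rat x) (of_rat y * sqrt (of_rat (- a))) 0 0"
    and w: "w = Quat (of_rat x') (of_rat y' * sqrt (of_rat (- a))) 0 0"
    and i: "2 * x \<in> \<int>" "x\<^sup>2 - a * y\<^sup>2 \<in> \<int>" "2 * x' \<in> \<int>" "x'\<^sup>2 - a * y'\<^sup>2 \<in> \<int>"
    using assms(2,3) unfolding imag_quadratic_order_def by blast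
  have s: "sqrt (of_rat (- a)) * sqrt (of_rat (- a)) = (- of_rat a :: real)"
    using assms(1) by (simp add: of_rat_minus)
  have tr: "2 * (x * x' + a * y * y') \<in> \<int>" "2 * (x * x' - a * y * y') \<in> \<int>"
    using imag_quadratic_mixed_trace[OF i] imag_quadratic_mixed_trace[of x a y x' "- y'"] i by simp_all
  have "2 * (x - x') \<in> \<int>"
    using Ints_diff[OF i(1,3)] by (simp add: algebra_simps)
  moreover have "(x - x')\<^sup>2 - a * (y - y')\<^sup>2 \<in> \<int>"
    using Ints_diff[OF Ints_add[OF i(2,4)] tr(2)] by (simp add: power2_eq_square algebra_simps)
  moreover have "v - w = Quat (of_rat (x - x')) (of_rat (y - y') * sqrt (of_rat (- a))) 0 0"
    by (simp add: v w quat_eq_iff of_rat_diff algebra_simps)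
  ultimately show "v - w \<in> imag_quadratic_order a"
    unfolding imag_quadratic_order_def by blast
  have "(x * x' + a * y * y')\<^sup>2 - a * (x * y' + y * x')\<^sup>2 = (x\<^sup>2 - a * y\<^sup>2) * (x'\<^sup>2 - a * y'\<^sup>2)"
    by (simp add: power2_eq_square algebra_simps)
  then have "(x * x' + a * y * y')\<^sup>2 - a * (x * y' + y * x')\<^sup>2 \<in> \<int>"
    using i by (simp only: Ints_mult)
  moreover have "v * w = Quat (of_rat (x * x' + a * y * y')) (of_rat (x * y' + y * x') * sqrt (of_rat (- a))) 0 0"
    using s by (simp add: v w quat_eq_iff quat_sel_mult of_rat_add of_rat_mult algebra_simps)
  ultimately show "v * w \<in> imag_quadratic_order a"
    using tr(1) unfolding imag_quadratic_order_def by blast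
  have "nrm v = of_rat (x\<^sup>2 - a * y\<^sup>2)"
    using nrm_quat_algebra[OF assms(1), of "-1" x y 0 0] by (simp add: v)
  then show "nrm v \<in> \<int>"
    using i(2) by (auto elim!: Ints_cases)
  have "2 * qRe v = of_rat (2 * x)"
    by (simp add: v of_rat_mult)
  then show "2 * qRe v \<in> \<int>"
    using i(1) by (auto elim!: Ints_cases)
qed

lemma countable_quat_algebra: "countable (quat_algebra a b)"
proof -
  have "quat_algebra a b = range (\<lambda>(x, y, z, t). Quat (of_rat x) (of_rat y * sqrt (of_rat (- a)))
      (of_rat z * sqrt (of_rat (- b))) (of_rat t * sqrt (of_rat (a * b))))"
    unfolding quat_algebra_def by (auto simp: image_iff)
  then show ?thesis
    by simp
qed

section \<open>The lattice and the modular group of an integer ring\<close>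

definition coordinate_space :: "nat \<Rightarrow> quat set"
  where "coordinate_space n = {x. (n \<le> 4 \<longrightarrow> qK x = 0) \<and> (n \<le> 3 \<longrightarrow> qJ x = 0)}"

locale integer_ring =
  fixes n :: nat and R :: "quat set"
  assumes integer_ring: "is_integer_ring n R"
begin

abbreviation "L \<equiv> plus_part n R"

lemma dimension_cases: "n = 3 \<or> n = 4 \<or> n = 5"
  using integer_ring by (auto simp: is_integer_ring_def)

lemma integer_ring_cases:
  obtains (quadratic) a where "n = 3" "a < 0" "R = imag_quadratic_order a"
  | (order4) a b where "n = 4" "a < 0" "b < 0" "is_order a b R" "dag ` R = R"
  | (order5) a b where "n = 5" "a < 0" "b < 0" "is_order a b R"
  using integer_ring imag_quadratic_integers_altdef
  unfolding is_integer_ring_def is_maximal_order_def is_maximal_dag_order_def is_dag_order_def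
    imag_quadratic_order_def[symmetric]
  by metis

lemma
  shows R_1: "1 \<in> R"
    and R_diff: "x \<in> R \<Longrightarrow> y \<in> R \<Longrightarrow> x - y \<in> R"
    and R_mult: "x \<in> R \<Longrightarrow> y \<in> R \<Longrightarrow> x * y \<in> R"
    and R_nrm: "x \<in> R \<Longrightarrow> nrm x \<in> \<int>"
    and R_trace: "x \<in> R \<Longrightarrow> 2 * qRe x \<in> \<int>"
    and countable_R: "countable R"
proof -
  have "1 \<in> R \<and> (\<forall>x\<in>R. \<forall>y\<in>R. x - y \<in> R) \<and> (\<forall>x\<in>R. \<forall>y\<in>R. x * y \<in> R) \<and>
      (\<forall>x\<in>R. nrm x \<in> \<int>) \<and> (\<forall>x\<in>R. 2 * qRe x \<in> \<int>) \<and> countable R"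
  proof (cases rule: integer_ring_cases)
    case (quadratic a)
    have "1 \<in> imag_quadratic_order a"
      unfolding imag_quadratic_order_def mem_Collect_eq
      by (rule exI[of _ 1], rule exI[of _ 0]) (simp add: quat_eq_iff)
    moreover have "imag_quadratic_order a \<subseteq> quat_algebra a (-1)"
    proof
      fix w assume "w \<in> imag_quadratic_order a"
      then obtain x y where "w = Quat (of_rat x) (of_rat y * sqrt (of_rat (- a)))
          (of_rat 0 * sqrt (of_rat (- (-1)))) (of_rat 0 * sqrt (of_rat (a * (-1))))"
        unfolding imag_quadratic_order_def by auto
      then show "w \<in> quat_algebra a (-1)"
        unfolding quat_algebra_def by blast
    qed
    then have "countable (imag_quadratic_order a)"
      using countable_quat_algebra by (rule countable_subset)
    moreover have "nrm x \<in> \<int>" "2 * qRe x \<in> \<int>" if "x \<in> imag_quadratic_order a" for x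
      using imag_quadratic_order_ring(3,4)[OF quadratic(2) that that] by auto
    ultimately show ?thesis
      using imag_quadratic_order_ring(1,2)[OF quadratic(2)] by (simp add: quadratic(3))
  next
    case (order4 a b)
    then show ?thesis
      using order_nrm_trace[OF order4(2,3,4)] countable_subset[OF _ countable_quat_algebra]
      unfolding is_order_def by (simp add: group_closure.diff) (metis group_closure.diff)
  next
    case (order5 a b)
    then show ?thesis
      using order_nrm_trace[OF order5(2,3,4)] countable_subset[OF _ countable_quat_algebra]
      unfolding is_order_def by (simp add: group_closure.diff) (metis group_closure.diff)
  qed
  then show "1 \<in> R" "x \<in> R \<Longrightarrow> y \<in> R \<Longrightarrow> x - y \<in> R" "x \<in> R \<Longrightarrow> y \<in> R \<Longrightarrow> x * y \<in> R"
    "x \<in> R \<Longrightarrow> nrm x \<in> \<int>" "x \<in> R \<Longrightarrow> 2 * qRe x \<in> \<int>" "countable R"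
    by auto
qed

lemma R_0: "0 \<in> R" and R_minus: "x \<in> R \<Longrightarrow> - x \<in> R"
  using R_diff[OF R_1 R_1] R_diff[of 0 x] by auto

lemma R_add: "x \<in> R \<Longrightarrow> y \<in> R \<Longrightarrow> x + y \<in> R"
  using R_diff[of x "- y"] R_minus by auto

lemma R_of_nat: "of_nat k \<in> R"
  by (induction k) (auto simp: R_0 R_1 intro: R_add)

lemma R_of_int: "of_int k \<in> R"
proof (cases "k \<ge> 0")
  case True
  then show ?thesis using R_of_nat[of "nat k"] by simp
next
  case False
  then show ?thesis using R_minus[OF R_of_nat[of "nat (- k)"]] by simp
qed

lemma R_qcnj: "x \<in> R \<Longrightarrow> qcnj x \<in> R"
proof -
  assume x: "x \<in> R"
  then obtain k where "2 * qRe x = of_int k"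
    using R_trace by (auto elim: Ints_cases)
  then have "qcnj x = of_int k - x"
    unfolding qcnj_conv_trace by (simp del: of_real_mult)
  then show ?thesis
    using x by (simp add: R_diff R_of_int)
qed

lemma R_inner: "x \<in> R \<Longrightarrow> y \<in> R \<Longrightarrow> 2 * inner x y \<in> \<int>"
proof -
  assume *: "x \<in> R" "y \<in> R"
  have "2 * inner x y = nrm (x + y) - nrm x - nrm y"
    by (simp add: nrm_add)
  also have "\<dots> \<in> \<int>"
    using * by (intro Ints_diff R_nrm R_add)
  finally show ?thesis .
qed

lemma R_dag: "n = 4 \<Longrightarrow> x \<in> R \<Longrightarrow> dag x \<in> R"
  by (cases rule: integer_ring_cases) auto

lemma L_subset: "L \<subseteq> R"
  by (auto simp: plus_part_def)

lemma L_iff: "x \<in> L \<longleftrightarrow> x \<in> R \<and> x \<in> coordinate_space n"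
proof (cases rule: integer_ring_cases)
  case (quadratic a)
  then show ?thesis
    by (auto simp: plus_part_def coordinate_space_def imag_quadratic_order_def)
next
  case order4
  then show ?thesis
    by (auto simp: plus_part_def coordinate_space_def quat_eq_iff)
next
  case order5
  then show ?thesis
    by (auto simp: plus_part_def coordinate_space_def)
qed

lemma subspace_coordinate_space: "subspace (coordinate_space n)"
  by (auto simp: subspace_def coordinate_space_def)

lemma order_multiple:
  assumes "is_order a b R" "w \<in> quat_algebra a b"
  shows "\<exists>m. m \<noteq> 0 \<and> m *\<^sub>R w \<in> R"
proof -
  obtain m :: int where "m \<noteq> 0" "of_int m * w \<in> R"
    using assms unfolding is_order_def by blast
  moreover have "of_int m * w = real_of_int m *\<^sub>R w"
    by (simp add: quat_eq_iff quat_sel_mult)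
  ultimately show ?thesis
    by (intro exI[of _ "real_of_int m"]) auto
qed

lemma L_multiple:
  assumes "m *\<^sub>R w \<in> R" "m \<noteq> 0" "w \<in> coordinate_space n"
  shows "w \<in> span L"
proof -
  have "m *\<^sub>R w \<in> coordinate_space n"
    using subspace_coordinate_space assms(3) by (rule subspace_scale)
  then have "m *\<^sub>R w \<in> span L"
    using assms(1) by (intro span_base) (simp add: L_iff)
  then have "inverse m *\<^sub>R (m *\<^sub>R w) \<in> span L"
    by (rule span_scale)
  then show ?thesis
    using assms(2) by simp
qed

lemma unit_scale_in_span:
  assumes "Quat 0 s 0 0 \<in> span L" "s \<noteq> 0"
  shows "Quat 0 1 0 0 \<in> span L"
proof -
  have "inverse s *\<^sub>R Quat 0 s 0 0 \<in> span L"
    using assms by (intro span_scale)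
  moreover have "inverse s *\<^sub>R Quat 0 s 0 0 = Quat 0 1 0 0"
    using assms(2) by (simp add: quat_eq_iff)
  ultimately show ?thesis by simp
qed

text \<open>An order contains nonzero multiples of all elements of the algebra, in particular of i,
  j and ij, and real scaling turns these into the standard units.\<close>

lemma span_L: "span L = coordinate_space n"
proof
  show "span L \<subseteq> coordinate_space n"
    using L_iff subspace_coordinate_space by (intro span_minimal) auto
  have one: "Quat 1 0 0 0 \<in> span L"
  proof -
    have "1 \<in> span L"
      by (intro span_base) (simp add: L_iff R_1 coordinate_space_def)
    moreover have "1 = Quat 1 0 0 0"
      by (simp add: quat_eq_iff)
    ultimately show ?thesis by simp
  qed
  have decomp: "w = qRe w *\<^sub>R Quat 1 0 0 0 + qI w *\<^sub>R Quat 0 1 0 0 +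
      qJ w *\<^sub>R Quat 0 0 1 0 + qK w *\<^sub>R Quat 0 0 0 1" for w
    by (simp add: quat_eq_iff)
  have units: "Quat 0 1 0 0 \<in> span L \<and> Quat 0 0 1 0 \<in> span L \<and> (n = 5 \<longrightarrow> Quat 0 0 0 1 \<in> span L)"
    if ord: "a < 0" "b < 0" "is_order a b R" and n: "n = 4 \<or> n = 5" for a b
  proof -
    have ab: "a * b > 0"
      using ord by (simp add: mult_neg_neg)
    have *: "w \<in> span L" if w: "w \<in> quat_algebra a b" "w \<in> coordinate_space n" for w
      using order_multiple[OF ord(3) w(1)] L_multiple w(2) by blast
    have q: "Quat 0 (sqrt (of_rat (- a))) 0 0 \<in> quat_algebra a b"
        "Quat 0 0 (sqrt (of_rat (- b))) 0 \<in> quat_algebra a b"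
        "Quat 0 0 0 (sqrt (of_rat (a * b))) \<in> quat_algebra a b"
      unfolding quat_algebra_def mem_Collect_eq
      by (rule exI[of _ 0], rule exI[of _ 1], rule exI[of _ 0], rule exI[of _ 0], simp,
          rule exI[of _ 0], rule exI[of _ 0], rule exI[of _ 1], rule exI[of _ 0], simp,
          rule exI[of _ 0], rule exI[of _ 0], rule exI[of _ 0], rule exI[of _ 1], simp)
    have s: "sqrt (of_rat (- a)) \<noteq> 0" "sqrt (of_rat (- b)) \<noteq> 0" "sqrt (of_rat (a * b)) \<noteq> 0"
      using ord ab by simp_all
    have "Quat 0 (sqrt (of_rat (- a))) 0 0 \<in> span L"
      using n by (intro * q) (auto simp: coordinate_space_def)
    moreover have "Quat 0 0 (sqrt (of_rat (- b))) 0 \<in> span L"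
      using n by (intro * q) (auto simp: coordinate_space_def)
    moreover have "Quat 0 0 0 (sqrt (of_rat (a * b))) \<in> span L" if "n = 5"
      using that by (intro * q) (auto simp: coordinate_space_def)
    moreover have "inverse (sqrt (of_rat (- a))) *\<^sub>R Quat 0 (sqrt (of_rat (- a))) 0 0 = Quat 0 1 0 0"
      "inverse (sqrt (of_rat (- b))) *\<^sub>R Quat 0 0 (sqrt (of_rat (- b))) 0 = Quat 0 0 1 0"
      "inverse (sqrt (of_rat (a * b))) *\<^sub>R Quat 0 0 0 (sqrt (of_rat (a * b))) = Quat 0 0 0 1"
      using s by (simp_all add: quat_eq_iff)
    ultimately show ?thesis
      using span_scale by metis
  qed
  show "coordinate_space n \<subseteq> span L"
  proof
    fix w assume w: "w \<in> coordinate_space n"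
    show "w \<in> span L"
    proof (cases rule: integer_ring_cases)
      case (quadratic a)
      obtain m where m: "m > 0" "of_int m * a \<in> \<int>"
        using rat_denominator by blast
      \<comment> \<open>The witness is \<open>m\<close> times the square root of \<open>a\<close>:
        its trace is 0, and its norm is integral because \<open>of_int m * a\<close> is.\<close>
      have "- (a * (of_int m)\<^sup>2) \<in> \<int>"
        using Ints_mult[OF Ints_of_int[of m] m(2)] by (simp add: power2_eq_square mult_ac)
      then have "Quat 0 (of_rat (of_int m) * sqrt (of_rat (- a))) 0 0 \<in> R"
        unfolding quadratic(3) imag_quadratic_order_def mem_Collect_eq
        by (intro exI[of _ 0] exI[of _ "of_int m"]) simp
      then have "Quat 0 (of_rat (of_int m) * sqrt (of_rat (- a))) 0 0 \<in> span L"
        by (intro span_base) (simp add: L_iff coordinate_space_def)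
      then have "Quat 0 1 0 0 \<in> span L"
        by (rule unit_scale_in_span) (use m quadratic(2) in simp)
      then show ?thesis
        using one w quadratic(1) by (subst decomp) (auto simp: coordinate_space_def intro!: span_add span_scale span_zero)
    next
      case (order4 a b)
      then show ?thesis
        using one w units[of a b] by (subst decomp) (auto simp: coordinate_space_def intro!: span_add span_scale span_zero)
    next
      case (order5 a b)
      then show ?thesis
        using one w units[of a b] by (subst decomp) (auto simp: coordinate_space_def intro!: span_add span_scale span_zero)
    qed
  qed
qed

lemma real_plus_part_eq: "real_plus_part n R = coordinate_space n"
  by (simp add: real_plus_part_def span_L)

lemma L_1: "1 \<in> L"
  by (simp add: L_iff R_1 coordinate_space_def)

lemma L_diff: "x \<in> L \<Longrightarrow> y \<in> L \<Longrightarrow> x - y \<in> L"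
  using subspace_diff[OF subspace_coordinate_space] by (simp add: L_iff R_diff)

lemma L_qcnj: "x \<in> L \<Longrightarrow> qcnj x \<in> L"
  by (simp add: L_iff R_qcnj coordinate_space_def)

lemma L_fixed: "n = 4 \<Longrightarrow> x \<in> L \<Longrightarrow> dag x = x"
  by (simp add: plus_part_def)

lemma L_eq: "n \<noteq> 4 \<Longrightarrow> L = R"
  by (simp add: plus_part_def)

text \<open>The parabolic elements that separate the cosets are products of matrices with rational
  entries, so the group conditions are separated from the integrality of the entries. For
  \<open>n = 3\<close> the entries are kept complex, since the determinant is multiplicative only
  for commuting entries.\<close>

definition G_real :: "(quat^2^2) set"
  where "G_real = {M. (n = 3 \<longrightarrow> (\<forall>i j. M $ i $ j \<in> coordinate_space 3)) \<and>
    (if n = 3 then M $ 1 $ 1 * M $ 2 $ 2 - M $ 1 $ 2 * M $ 2 $ 1 = 1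
     else if n = 4 then dag_hat M ** M = mat 1 \<and> M ** dag_hat M = mat 1
     else det (block_mat M) = 1)}"

lemma R_3_subset: "n = 3 \<Longrightarrow> R \<subseteq> coordinate_space 3"
  using L_eq L_iff by auto

lemma G_carrier_eq: "G_carrier n R = {M \<in> G_real. \<forall>i j. M $ i $ j \<in> R}"
  using R_3_subset by (auto simp: G_carrier_def G_real_def)

lemma dag_hat_eq: "dag_hat M = mat2 (dag (M $ 2 $ 2)) (- dag (M $ 1 $ 2)) (- dag (M $ 2 $ 1)) (dag (M $ 1 $ 1))"
  by (simp add: dag_hat_def mat2_def)

lemma dag_hat_mult: "dag_hat (M ** N) = dag_hat N ** dag_hat M"
  by (simp add: dag_hat_eq mat2_eq_iff mat2_mult_nth dag_mult algebra_simps)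

lemma dag_hat_dag_hat: "dag_hat (dag_hat M) = M"
  by (simp add: dag_hat_eq mat2_eq_iff)

lemma coordinate_space_3_mult:
  "x \<in> coordinate_space 3 \<Longrightarrow> y \<in> coordinate_space 3 \<Longrightarrow> x * y \<in> coordinate_space 3"
  by (simp add: coordinate_space_def quat_sel_mult)

lemma coordinate_space_3_commute:
  "x \<in> coordinate_space 3 \<Longrightarrow> y \<in> coordinate_space 3 \<Longrightarrow> x * y = y * x"
  by (simp add: coordinate_space_def quat_sel_mult quat_eq_iff)

lemma det2_mult:
  fixes M N :: "quat^2^2"
  assumes "\<And>i j. M $ i $ j \<in> coordinate_space 3" "\<And>i j. N $ i $ j \<in> coordinate_space 3"
  shows "(M ** N) $ 1 $ 1 * (M ** N) $ 2 $ 2 - (M ** N) $ 1 $ 2 * (M ** N) $ 2 $ 1 =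
    (M $ 1 $ 1 * M $ 2 $ 2 - M $ 1 $ 2 * M $ 2 $ 1) * (N $ 1 $ 1 * N $ 2 $ 2 - N $ 1 $ 2 * N $ 2 $ 1)"
proof -
  have "qJ (M $ i $ j) = 0" "qK (M $ i $ j) = 0" "qJ (N $ i $ j) = 0" "qK (N $ i $ j) = 0" for i j :: 2
    using assms[of i j] by (auto simp: coordinate_space_def)
  then show ?thesis
    by (simp add: mat2_mult_nth quat_eq_iff quat_sel_mult algebra_simps)
qed

lemma complex_mat_add: "complex_mat (x + y) = complex_mat x + complex_mat y"
  by (simp add: complex_mat_def vec_eq_iff forall_2 complex_eq_iff)

lemma block_mat_mult: "block_mat (M ** N) = block_mat M ** block_mat N"
proof -
  have "block_mat (M ** N) $ p $ q = (block_mat M ** block_mat N) $ p $ q" for p q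
  proof -
    have "(block_mat M ** block_mat N) $ p $ q = (\<Sum>r\<in>UNIV. block_mat M $ p $ r * block_mat N $ r $ q)"
      by (simp add: matrix_matrix_mult_def)
    also have "\<dots> = block_mat (M ** N) $ p $ q"
      unfolding UNIV_2x2
      by (simp add: block_mat_def mat2_mult_nth complex_mat_add complex_mat_mult)
    finally show ?thesis ..
  qed
  then show ?thesis
    by (simp add: vec_eq_iff)
qed

lemma G_real_mult:
  assumes "M \<in> G_real" "N \<in> G_real"
  shows "M ** N \<in> G_real"
proof -
  have C: "M $ i $ j \<in> coordinate_space 3" "N $ i $ j \<in> coordinate_space 3" if "n = 3" for i j
    using assms that unfolding G_real_def by blast+
  have "(M ** N) $ i $ j \<in> coordinate_space 3" if "n = 3" for i j
    using C[OF that] subspace_coordinate_space that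
    by (auto simp: mat2_mult_nth intro!: subspace_add[of "coordinate_space 3"] coordinate_space_3_mult)
  moreover consider "n = 3" | "n = 4" | "n = 5"
    using dimension_cases by blast
  then have "if n = 3 then (M ** N) $ 1 $ 1 * (M ** N) $ 2 $ 2 - (M ** N) $ 1 $ 2 * (M ** N) $ 2 $ 1 = 1
     else if n = 4 then dag_hat (M ** N) ** (M ** N) = mat 1 \<and> (M ** N) ** dag_hat (M ** N) = mat 1
     else det (block_mat (M ** N)) = 1"
  proof cases
    case 1
    then show ?thesis
      using assms det2_mult[of M N] C[OF 1] unfolding G_real_def by simp
  next
    case 2
    then have MN: "dag_hat M ** M = mat 1" "M ** dag_hat M = mat 1"
      "dag_hat N ** N = mat 1" "N ** dag_hat N = mat 1"
      using assms unfolding G_real_def by auto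
    have "dag_hat N ** (dag_hat M ** (M ** N)) = mat 1" "M ** (N ** (dag_hat N ** dag_hat M)) = mat 1"
      using MN by (metis matrix_mul_assoc matrix_mul_lid)+
    then show ?thesis
      using 2 by (simp add: dag_hat_mult matrix_mul_assoc)
  next
    case 3
    then show ?thesis
      using assms unfolding G_real_def by (simp add: block_mat_mult det_mul)
  qed
  ultimately show ?thesis
    by (auto simp: G_real_def)
qed

lemma G_real_upper:
  assumes "x \<in> coordinate_space n"
  shows "mat2 1 x 0 1 \<in> G_real"
  using assms dimension_cases
  by (auto simp: G_real_def coordinate_space_def dag_hat_eq mat2_eq_iff mat2_mult_nth forall_2
      det_block_mat quat_eq_iff)

lemma G_real_lower:
  assumes "x \<in> coordinate_space n"
  shows "mat2 1 0 x 1 \<in> G_real"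
  using assms dimension_cases
  by (auto simp: G_real_def coordinate_space_def dag_hat_eq mat2_eq_iff mat2_mult_nth forall_2
      det_block_mat quat_eq_iff)

lemma G_real_inversion: "mat2 0 (-1) 1 0 \<in> G_real"
  using dimension_cases
  by (auto simp: G_real_def coordinate_space_def dag_hat_eq mat2_eq_iff mat2_mult_nth forall_2
      det_block_mat)

text \<open>The inverse is the classical adjugate for \<open>n = 3\<close>, \<open>dag_hat M\<close>
  for \<open>n = 4\<close>, and a quaternionic adjugate for \<open>n = 5\<close>; in each case its
  entries visibly stay in \<open>R\<close>.\<close>

lemma G_carrier_inverse:
  assumes M: "M \<in> G_carrier n R"
  shows "\<exists>N\<in>G_carrier n R. M ** N = mat 1 \<and> N ** M = mat 1"
proof -
  define a b c d where "a = M $ 1 $ 1" and "b = M $ 1 $ 2" and "c = M $ 2 $ 1" and "d = M $ 2 $ 2"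
  have Meq: "M = mat2 a b c d"
    by (simp add: mat2_eq_iff a_def b_def c_def d_def)
  have R: "a \<in> R" "b \<in> R" "c \<in> R" "d \<in> R"
    using M by (auto simp: G_carrier_eq a_def b_def c_def d_def)
  consider "n = 3" | "n = 4" | "n = 5"
    using dimension_cases by blast
  then show ?thesis
  proof cases
    case 1
    let ?N = "mat2 d (- b) (- c) a"
    have det: "a * d - b * c = 1"
      using M 1 by (simp add: G_carrier_def Meq)
    have C: "a \<in> coordinate_space 3" "b \<in> coordinate_space 3" "c \<in> coordinate_space 3" "d \<in> coordinate_space 3"
      using R R_3_subset[OF 1] by auto
    have comm: "d * a = a * d" "c * b = b * c" "b * a = a * b" "c * d = d * c" "b * d = d * b" "c * a = a * c"
      using C coordinate_space_3_commute by auto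
    have "?N \<in> G_carrier n R"
      using 1 R det comm by (simp add: G_carrier_def forall_2 R_minus)
    moreover have "M ** ?N = mat 1" "?N ** M = mat 1"
      using det comm by (simp_all add: Meq mat2_eq_iff mat2_mult_nth algebra_simps)
    ultimately show ?thesis by blast
  next
    case 2
    have "dag_hat M \<in> G_carrier n R"
    proof -
      have "\<forall>i j. dag_hat M $ i $ j \<in> R"
        using R R_dag[OF 2] R_minus by (simp add: dag_hat_eq forall_2 Meq)
      then show ?thesis
        using M 2 by (simp add: G_carrier_def dag_hat_dag_hat)
    qed
    then show ?thesis
      using M 2 by (auto simp: G_carrier_def)
  next
    case 3
    let ?\<Delta> = "nrm a * nrm d + nrm b * nrm c - 2 * qRe (a * (qcnj c * (d * qcnj b)))"
    \<comment> \<open>A two-sided adjugate over the quaternions: both products with \<open>M\<close>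
      are the scalar matrix of the Study determinant.\<close>
    let ?N = "mat2 (of_real (nrm d) * qcnj a - qcnj c * (d * qcnj b))
      (of_real (nrm b) * qcnj c - qcnj a * (b * qcnj d))
      (of_real (nrm c) * qcnj b - qcnj d * (c * qcnj a))
      (of_real (nrm a) * qcnj d - qcnj b * (a * qcnj c))"
    have det: "det (block_mat M) = 1"
      using M 3 by (simp add: G_carrier_def)
    then have "complex_of_real ?\<Delta> = 1"
      using det_block_mat[of M] unfolding Meq mat2_nth by metis
    then have \<Delta>: "?\<Delta> = 1"
      by (simp only: of_real_eq_1_iff)
    have "M ** ?N = mat2 (of_real ?\<Delta>) 0 0 (of_real ?\<Delta>)" "?N ** M = mat2 (of_real ?\<Delta>) 0 0 (of_real ?\<Delta>)"
      by (simp_all add: Meq mat2_eq_iff mat2_mult_nth del: of_real_mult of_real_add of_real_diff)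
         (simp_all add: quat_eq_iff quat_sel_mult nrm_altdef power2_eq_square algebra_simps
           del: of_real_mult of_real_add of_real_diff)
    then have inv: "M ** ?N = mat 1" "?N ** M = mat 1"
      unfolding \<Delta> by (simp_all add: mat2_eq_iff)
    have "of_real (nrm x) \<in> R" if "x \<in> R" for x
      using R_nrm[OF that] R_of_int by (auto elim!: Ints_cases)
    then have "\<forall>i j. ?N $ i $ j \<in> R"
      using R by (auto simp: forall_2 intro!: R_diff R_mult R_qcnj)
    moreover have "det (block_mat M) * det (block_mat ?N) = det (block_mat (mat 1))"
      using inv(1) by (simp flip: det_mul block_mat_mult)
    then have "det (block_mat ?N) = 1"
      using det by (simp add: det_block_mat[of "mat 1"])
    ultimately have "?N \<in> G_carrier n R"
      using 3 by (simp add: G_carrier_def)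
    then show ?thesis
      using inv by blast
  qed
qed

lemma nat_Ints_mult_eq_1:
  fixes x y :: real
  assumes "x \<in> \<int>" "y \<in> \<int>" "0 \<le> x" "x * y = 1"
  shows "x = 1 \<and> y = 1"
proof -
  obtain k l where kl: "x = of_int k" "y = of_int l"
    using assms(1,2) by (elim Ints_cases)
  then have "k * l = 1" "k \<ge> 0"
    using assms(3,4) by (auto simp flip: of_int_mult)
  then show ?thesis
    using kl by (auto simp: zmult_eq_1_iff)
qed

lemma G_upper_nrm:
  assumes M: "mat2 a b 0 d \<in> G_carrier n R"
  shows "nrm a = 1 \<and> nrm d = 1"
proof -
  have R: "a \<in> R" "d \<in> R"
    using M by (auto simp: G_carrier_def forall_2)
  consider "n = 3" | "n = 4" | "n = 5"
    using dimension_cases by blast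
  then have "nrm a * nrm d = 1"
  proof cases
    case 1
    then have "a * d = 1"
      using M by (simp add: G_carrier_def)
    then show ?thesis
      by (simp flip: nrm_mult)
  next
    case 2
    then have "a * dag d = 1"
      using M by (simp add: G_carrier_def dag_hat_eq mat2_eq_iff mat2_mult_nth)
    then have "nrm (a * dag d) = 1"
      by simp
    then show ?thesis
      by (simp add: nrm_mult)
  next
    case 3
    then have "det (block_mat (mat2 a b 0 d)) = 1"
      using M by (simp add: G_carrier_def)
    then have "complex_of_real (nrm a * nrm d) = of_real 1"
      by (simp add: det_block_mat)
    then show ?thesis
      by (simp only: of_real_eq_iff)
  qed
  then show ?thesis
    using R R_nrm by (intro nat_Ints_mult_eq_1) auto
qed

sublocale modular_group R L "G_carrier n R"
proof
  show "1 \<in> R" by (rule R_1)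
  show "x - y \<in> R" if "x \<in> R" "y \<in> R" for x y using that by (rule R_diff)
  show "x * y \<in> R" if "x \<in> R" "y \<in> R" for x y using that by (rule R_mult)
  show "nrm x \<in> \<int>" if "x \<in> R" for x using that by (rule R_nrm)
  show "L \<subseteq> R" by (rule L_subset)
  show "1 \<in> L" by (rule L_1)
  show "x - y \<in> L" if "x \<in> L" "y \<in> L" for x y using that by (rule L_diff)
  show "qcnj x \<in> L" if "x \<in> L" for x using that by (rule L_qcnj)
  show "M $ i $ j \<in> R" if "M \<in> G_carrier n R" for M i j
    using that by (simp add: G_carrier_def)
  show "M ** N \<in> G_carrier n R" if "M \<in> G_carrier n R" "N \<in> G_carrier n R" for M N
    using that G_real_mult by (simp add: G_carrier_eq mat2_mult_nth R_add R_mult)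
  show "\<exists>N\<in>G_carrier n R. M ** N = mat 1 \<and> N ** M = mat 1" if "M \<in> G_carrier n R" for M
    using that by (rule G_carrier_inverse)
  show "mat2 1 q 0 1 \<in> G_carrier n R" if "q \<in> L" for q
    using that by (simp add: G_carrier_eq G_real_upper L_iff forall_2 R_1 R_0)
  show "mat2 0 (-1) 1 0 \<in> G_carrier n R"
    by (simp add: G_carrier_eq G_real_inversion forall_2 R_1 R_0 R_minus)
  show "nrm a = 1 \<and> nrm d = 1" if "mat2 a b 0 d \<in> G_carrier n R" for a b d
    using that by (rule G_upper_nrm)
  show "(a * q + b) * qcnj d \<in> L" if M: "mat2 a b 0 d \<in> G_carrier n R" and q: "q \<in> L" for a b d q
  proof -
    have R: "(a * q + b) * qcnj d \<in> R"
      using M q L_subset by (auto simp: G_carrier_def forall_2 intro!: R_mult R_add R_qcnj)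
    show ?thesis
    proof (cases "n = 4")
      case True
      \<comment> \<open>The relations make \<open>dag a\<close> the inverse of \<open>d\<close>,
        which turns the element into \<open>a * q * dag a + b * dag a\<close>; both summands are
        fixed by \<open>dag\<close>.\<close>
      have e: "a * dag d = 1" "b * dag a = a * dag b" "d * dag a = 1"
        using M True by (auto simp: G_carrier_def dag_hat_eq mat2_eq_iff mat2_mult_nth)
      have "dag a = qcnj d"
        using arg_cong[OF e(3), of "\<lambda>x. qcnj d * x"] G_upper_nrm[OF M] by (simp add: unit_qcnj_mult_assoc)
      then have "(a * q + b) * qcnj d = a * q * dag a + b * dag a"
        by (simp add: algebra_simps)
      moreover have "dag (a * q * dag a + b * dag a) = a * q * dag a + b * dag a"
        using L_fixed[OF True q] e(2) by (simp add: dag_mult mult.assoc)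
      ultimately show ?thesis
        using R True by (simp add: plus_part_def)
    qed (use R L_eq in simp)
  qed
  show "mat2 d 0 0 a \<in> G_carrier n R" if M: "mat2 a b 0 d \<in> G_carrier n R" for a b d
  proof -
    have R: "a \<in> R" "d \<in> R"
      using M by (auto simp: G_carrier_def forall_2)
    consider "n = 3" | "n = 4" | "n = 5"
      using dimension_cases by blast
    then show ?thesis
    proof cases
      case 1
      then have "a * d = 1"
        using M by (simp add: G_carrier_def)
      then have "d * a = 1"
        using coordinate_space_3_commute R R_3_subset[OF 1] by (metis subsetD)
      then show ?thesis
        using 1 R by (simp add: G_carrier_def forall_2 R_0)
    next
      case 2
      then show ?thesis
        using M R by (auto simp: G_carrier_def forall_2 R_0 dag_hat_eq mat2_eq_iff mat2_mult_nth)
    next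
      case 3
      then show ?thesis
        using R G_upper_nrm[OF M] by (simp add: G_carrier_def forall_2 R_0 det_block_mat)
    qed
  qed
qed

lemma E_group_eq: "E_group n R = elem_group"
  unfolding E_group_def elem_group_def G_group_def ..

lemma infinite_index_if_gap:
  assumes "N > 0" "of_nat N * x \<in> L" "\<And>c. c \<in> L \<Longrightarrow> nrm (x - c) > 1"
  shows "infinite (rcosets\<^bsub>G_group n R\<^esub> E_group n R)"
  unfolding E_group_eq G_group_def
proof (rule infinite_rcosets_E[OF assms(1) _ assms(3)])
  show Nx: "of_nat N * x \<in> R"
    using assms(2) L_subset by auto
  have "of_nat N * x = real N *\<^sub>R x"
    by (simp add: quat_eq_iff quat_sel_mult)
  then have "inverse (real N) *\<^sub>R (real N *\<^sub>R x) \<in> coordinate_space n"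
    using assms(2) L_iff subspace_scale[OF subspace_coordinate_space] by metis
  then have x: "x \<in> coordinate_space n"
    using assms(1) by simp
  fix m :: int
  \<comment> \<open>The two factors \<open>N\<close> clear the denominators of the entry in which
    \<open>x\<close> stands on both sides of \<open>?k\<close>.\<close>
  let ?k = "of_int m * of_nat N * of_nat N :: quat"
  let ?P = "mat2 1 x 0 1 ** (mat2 1 0 ?k 1 ** mat2 1 (- x) 0 1)"
  have "?k \<in> coordinate_space n"
    by (simp add: coordinate_space_def quat_sel_mult)
  then have "?P \<in> G_real"
    using x subspace_neg[OF subspace_coordinate_space] by (intro G_real_mult G_real_upper G_real_lower)
  moreover have "?P = mat2 (1 + of_int m * of_nat N * (of_nat N * x)) (- (of_int m * (of_nat N * x) * (of_nat N * x)))
      ?k (1 - of_int m * of_nat N * (of_nat N * x))"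
    by (simp add: mat2_eq_iff mat2_mult_nth) (simp add: quat_eq_iff quat_sel_mult algebra_simps)
  moreover have "\<forall>i j. mat2 (1 + of_int m * of_nat N * (of_nat N * x)) (- (of_int m * (of_nat N * x) * (of_nat N * x)))
      ?k (1 - of_int m * of_nat N * (of_nat N * x)) $ i $ j \<in> R"
    using Nx by (simp add: forall_2 R_add R_diff R_minus R_mult R_1 R_of_int R_of_nat)
  ultimately show "?P \<in> G_carrier n R"
    by (simp add: G_carrier_eq)
qed

end

section \<open>The Lorentz model\<close>

instantiation quat :: euclidean_space
begin

definition Basis_quat :: "quat set"
  where "Basis_quat = {Quat 1 0 0 0, Quat 0 1 0 0, Quat 0 0 1 0, Quat 0 0 0 1}"

instance
proof
  fix x :: quat
  show "(\<forall>u\<in>Basis. inner x u = 0) \<longleftrightarrow> x = 0"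
    unfolding Basis_quat_def ball_simps by (simp add: inner_quat_def quat_eq_iff)
qed (auto simp: Basis_quat_def inner_quat_def)

end

type_synonym lorentz = "real \<times> quat \<times> real"

text \<open>
  A triple \<open>(A, b, C)\<close> stands for the function \<open>x \<mapsto> inner b x - (A * nrm x + C) / 2\<close>, which is
  its Lorentz product with \<open>point_vec x\<close>; the unit sphere around \<open>c\<close> is the zero set of
  \<open>ball_vec c\<close>, and inversion in it is the reflection in that vector.
\<close>

definition lprod :: "lorentz \<Rightarrow> lorentz \<Rightarrow> real"
  where "lprod v w = inner (fst (snd v)) (fst (snd w)) - (fst v * snd (snd w) + fst w * snd (snd v)) / 2"

definition point_vec :: "quat \<Rightarrow> lorentz"
  where "point_vec z = (1, z, nrm z)"

definition inf_vec :: lorentz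
  where "inf_vec = (0, 0, 1)"

definition ball_vec :: "quat \<Rightarrow> lorentz"
  where "ball_vec c = (1, c, nrm c - 1)"

definition lrefl :: "lorentz \<Rightarrow> lorentz \<Rightarrow> lorentz"
  where "lrefl v x = x - (2 * lprod x v) *\<^sub>R v"

definition lshift :: "quat \<Rightarrow> lorentz \<Rightarrow> lorentz"
  where "lshift w v = (fst v, fst (snd v) + fst v *\<^sub>R w, snd (snd v) + 2 * inner (fst (snd v)) w + fst v * nrm w)"

definition ext_vec :: "quat option \<Rightarrow> lorentz"
  where "ext_vec p = (case p of None \<Rightarrow> inf_vec | Some z \<Rightarrow> point_vec z)"

lemma lprod_commute: "lprod v w = lprod w v"
  by (simp add: lprod_def inner_commute algebra_simps)

lemma lprod_simps [simp]:
  "lprod (v + w) x = lprod v x + lprod w x" "lprod x (v + w) = lprod x v + lprod x w"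
  "lprod (v - w) x = lprod v x - lprod w x" "lprod x (v - w) = lprod x v - lprod x w"
  "lprod (r *\<^sub>R v) x = r * lprod v x" "lprod x (r *\<^sub>R v) = r * lprod x v"
  "lprod (- v) x = - lprod v x" "lprod x (- v) = - lprod x v"
  by (simp_all add: lprod_def inner_simps field_simps)

lemma lprod_point_point: "lprod (point_vec z) (point_vec w) = - nrm (z - w) / 2"
  by (simp add: lprod_def point_vec_def nrm_diff field_simps)

lemma lprod_point_ball: "lprod (point_vec z) (ball_vec c) = (1 - nrm (z - c)) / 2"
  by (simp add: lprod_def point_vec_def ball_vec_def nrm_diff field_simps)

lemma lprod_ball_ball: "lprod (ball_vec c) (ball_vec d) = 1 - nrm (c - d) / 2"
  by (simp add: lprod_def ball_vec_def nrm_diff field_simps)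

lemma lprod_inf: "lprod inf_vec v = - fst v / 2" "lprod v inf_vec = - fst v / 2"
  by (simp_all add: lprod_def inf_vec_def)

lemma fst_vecs [simp]: "fst (point_vec z) = 1" "fst (ball_vec c) = 1" "fst inf_vec = 0"
  by (simp_all add: point_vec_def ball_vec_def inf_vec_def)

lemma fst_lrefl_ball: "fst (lrefl (ball_vec c) v) = fst v - 2 * lprod v (ball_vec c)"
  by (simp add: lrefl_def)

lemma linear_lrefl: "lrefl v (x + y) = lrefl v x + lrefl v y" "lrefl v (r *\<^sub>R x) = r *\<^sub>R lrefl v x"
  by (simp_all add: lrefl_def algebra_simps)

lemma lprod_lrefl:
  assumes "lprod v v = 1"
  shows "lprod (lrefl v x) (lrefl v y) = lprod x y"
proof -
  have "lprod v y = lprod y v"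
    by (rule lprod_commute)
  then show ?thesis
    using assms by (simp add: lrefl_def algebra_simps)
qed

lemma lrefl_lrefl:
  assumes "lprod v v = 1"
  shows "lrefl v (lrefl v x) = x"
  using assms by (simp add: lrefl_def algebra_simps)

lemma linear_lshift: "lshift w (x + y) = lshift w x + lshift w y" "lshift w (r *\<^sub>R x) = r *\<^sub>R lshift w x"
  by (simp_all add: lshift_def algebra_simps inner_simps)

lemma lprod_lshift: "lprod (lshift w x) (lshift w y) = lprod x y"
  by (simp add: lprod_def lshift_def inner_simps nrm_eq_inner inner_commute field_simps)

lemma lshift_vecs:
  "lshift w inf_vec = inf_vec" "lshift w (ball_vec c) = ball_vec (c + w)"
  "lshift w (point_vec z) = point_vec (z + w)"
  by (simp_all add: lshift_def inf_vec_def ball_vec_def point_vec_def nrm_add inner_commute)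

lemma lshift_lrefl: "lshift w (lrefl v x) = lrefl (lshift w v) (lshift w x)"
proof -
  have "lshift w (x - y) = lshift w x - lshift w y" for x y
    using linear_lshift(1)[of w x "(-1) *\<^sub>R y"] linear_lshift(2)[of w "-1" y] by simp
  then show ?thesis
    by (simp add: lrefl_def linear_lshift lprod_lshift)
qed

lemma lprod_ball_self [simp]: "lprod (ball_vec c) (ball_vec c) = 1"
  by (simp add: lprod_ball_ball)

lemma nrm_scaleR: "nrm (r *\<^sub>R x) = r\<^sup>2 * nrm x"
  by (simp add: nrm_eq_norm power_mult_distrib)

lemma inversion_inversion [simp]: "inversion c (inversion c p) = p"
proof (cases p)
  case (Some z)
  define d where "d = z - c"
  have z: "z = c + d"
    by (simp add: d_def)
  have "(d /\<^sub>R (norm d)\<^sup>2) /\<^sub>R (norm (d /\<^sub>R (norm d)\<^sup>2))\<^sup>2 = d" if "d \<noteq> 0"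
    using that by (simp add: power2_eq_square field_simps)
  then show ?thesis
    by (auto simp: Some inversion_def z)
qed (simp add: inversion_def)

lemma transl_transl: "transl w (transl v p) = transl (v + w) p"
  by (cases p) (auto simp: transl_def)

lemma transl_0 [simp]: "transl 0 p = p"
  by (cases p) (auto simp: transl_def)

text \<open>A reflection acts on null vectors as the inversion does on points, up to a conformal
  factor, which for \<open>z \<noteq> c\<close> is \<open>nrm (z - c)\<close>. Positivity of the
  factor matters: the signs of Lorentz products distinguish the two sides of a sphere.\<close>

lemma inversion_ext_vec: "\<exists>l>0. lrefl (ball_vec c) (ext_vec p) = l *\<^sub>R ext_vec (inversion c p)"
proof (cases p)
  case None
  have "lrefl (ball_vec c) inf_vec = point_vec c"
    by (simp add: lrefl_def lprod_inf) (simp add: inf_vec_def ball_vec_def point_vec_def)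
  then show ?thesis
    by (intro exI[of _ 1]) (simp add: None ext_vec_def inversion_def)
next
  case (Some z)
  show ?thesis
  proof (cases "z = c")
    case True
    have "lrefl (ball_vec c) (point_vec c) = inf_vec"
      by (simp add: lrefl_def lprod_point_ball) (simp add: inf_vec_def ball_vec_def point_vec_def)
    then show ?thesis
      by (intro exI[of _ 1]) (simp add: Some True ext_vec_def inversion_def)
  next
    case False
    define d where "d = z - c"
    have z: "z = c + d"
      by (simp add: d_def)
    have d: "nrm d > 0"
      using False nrm_nonneg[of d] by (simp add: d_def less_le del: nrm_nonneg)
    have "d \<noteq> 0"
      using False by (simp add: d_def)
    have "lrefl (ball_vec c) (point_vec z) = point_vec z - (1 - nrm d) *\<^sub>R ball_vec c"
      by (simp add: lrefl_def lprod_point_ball d_def)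
    also have "\<dots> = nrm d *\<^sub>R point_vec (c + d /\<^sub>R nrm d)"
      using d \<open>d \<noteq> 0\<close> by (simp add: z point_vec_def ball_vec_def nrm_add nrm_scaleR power2_eq_square field_simps)
    finally have "lrefl (ball_vec c) (point_vec z) = nrm d *\<^sub>R point_vec (c + d /\<^sub>R nrm d)" .
    moreover have "inversion c p = Some (c + d /\<^sub>R nrm d)"
      using False by (simp add: Some inversion_def d_def nrm_eq_norm)
    ultimately show ?thesis
      using d by (intro exI[of _ "nrm d"] conjI) (simp_all add: Some ext_vec_def)
  qed
qed

lemma transl_ext_vec: "lshift w (ext_vec p) = ext_vec (transl w p)"
  by (cases p) (simp_all add: ext_vec_def transl_def lshift_vecs)

section \<open>The strip between the base planes, its lattice and its group\<close>

locale strip = integer_ring +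
  fixes u \<tau> :: quat
  assumes covering: "normalized_covering_vector n R u"
    and nrm_u: "nrm u > 3"
    and shift: "admissible_shift n R u \<tau>"
begin

definition uh :: quat
  where "uh = u /\<^sub>R norm u"

definition h :: real
  where "h = inner \<tau> uh"

abbreviation V :: "quat set"
  where "V \<equiv> coordinate_space n"

definition \<Lambda> :: "quat set"
  where "\<Lambda> = {x \<in> L. inner x uh = 0}"

definition centres :: "quat set"
  where "centres = \<Lambda> \<union> (+) \<tau> ` \<Lambda>"

lemma u_nz: "u \<noteq> 0"
  using nrm_u by auto

lemma norm_uh [simp]: "norm uh = 1"
  using u_nz by (simp add: uh_def)

lemma inner_uh_uh [simp]: "inner uh uh = 1"
  using norm_uh by (simp flip: power2_norm_eq_inner del: norm_uh)

lemma inner_uh: "inner x uh = inner x u / norm u"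
  by (simp add: uh_def field_simps)

lemma inner_uh_sign: "inner x uh = 0 \<longleftrightarrow> inner x u = 0" "0 < inner x uh \<longleftrightarrow> 0 < inner x u"
  using u_nz by (simp_all add: inner_uh zero_less_divide_iff)

lemma L_V: "x \<in> L \<Longrightarrow> x \<in> V"
  by (simp add: L_iff)

lemma u_L: "u \<in> L"
  using covering by (simp add: normalized_covering_vector_def)

lemma uh_V: "uh \<in> V"
  unfolding uh_def using u_L L_V subspace_coordinate_space by (intro subspace_scale) auto

lemma tau_L: "\<tau> \<in> L" and h_pos: "h > 0"
  using shift by (auto simp: admissible_shift_def h_def inner_uh_sign)

lemma hyperplane_eq: "hyperplane n R u = {x \<in> V. inner x uh = 0}"
  by (auto simp: hyperplane_def real_plus_part_eq inner_uh_sign)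

lemma \<Lambda>_eq: "\<Lambda> = plus_part n R \<inter> hyperplane n R u"
  by (auto simp: \<Lambda>_def hyperplane_eq L_V)

lemma centres_eq: "centres = plus_part n R \<inter> (hyperplane n R u \<union> (+) \<tau> ` hyperplane n R u)"
proof -
  have "x \<in> L" if "\<tau> + x \<in> L" for x
    using L_diff[OF that tau_L] by simp
  then show ?thesis
    unfolding centres_def \<Lambda>_eq using tau_L by (auto intro: L_add)
qed

lemma \<Lambda>_L: "x \<in> \<Lambda> \<Longrightarrow> x \<in> L" and \<Lambda>_inner: "x \<in> \<Lambda> \<Longrightarrow> inner x uh = 0"
  by (simp_all add: \<Lambda>_def)

lemma \<Lambda>_0: "0 \<in> \<Lambda>"
  by (simp add: \<Lambda>_def L_0)

lemma \<Lambda>_add: "x \<in> \<Lambda> \<Longrightarrow> y \<in> \<Lambda> \<Longrightarrow> x + y \<in> \<Lambda>"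
  and \<Lambda>_diff: "x \<in> \<Lambda> \<Longrightarrow> y \<in> \<Lambda> \<Longrightarrow> x - y \<in> \<Lambda>"
  and \<Lambda>_minus: "x \<in> \<Lambda> \<Longrightarrow> - x \<in> \<Lambda>"
  by (simp_all add: \<Lambda>_def L_add L_diff L_minus inner_simps)

lemma centres_L: "c \<in> centres \<Longrightarrow> c \<in> L"
  by (auto simp: centres_def \<Lambda>_def intro: L_add tau_L)

lemma centres_inner: "c \<in> centres \<Longrightarrow> inner c uh = 0 \<or> inner c uh = h"
  by (auto simp: centres_def \<Lambda>_def inner_simps h_def)

lemma centres_add: "c \<in> centres \<Longrightarrow> w \<in> \<Lambda> \<Longrightarrow> c + w \<in> centres"
  by (auto simp: centres_def intro: \<Lambda>_add simp: add.assoc)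

lemma centres_diff: 
  assumes "c \<in> centres" "d \<in> centres" "inner c uh = inner d uh"
  shows "c - d \<in> \<Lambda>"
  using assms by (simp add: \<Lambda>_def inner_simps L_diff centres_L)

lemma L_of_int: "x \<in> L \<Longrightarrow> of_int k *\<^sub>R x \<in> L"
proof -
  assume x: "x \<in> L"
  have "of_int k *\<^sub>R x = of_int k * x"
    by (simp add: quat_eq_iff quat_sel_mult)
  then have "of_int k *\<^sub>R x \<in> R"
    using x L_subset by (auto intro!: R_mult R_of_int)
  then show ?thesis
    using x subspace_scale[OF subspace_coordinate_space] by (simp add: L_iff)
qed

lemma L_layer: "x \<in> L \<Longrightarrow> \<exists>k::int. inner x uh = of_int k * h \<and> x - of_int k *\<^sub>R \<tau> \<in> \<Lambda>"
proof -
  have *: "\<exists>k::int. inner x uh = of_int k * h" if "x \<in> group_closure (insert \<tau> (hyperplane n R u \<inter> plus_part n R))" for x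
    using that
  proof induction
    case (base s)
    then consider "s = 0" | "s = \<tau>" | "inner s uh = 0"
      by (auto simp: hyperplane_eq)
    then show ?case
      by cases (auto simp: h_def intro: exI[of _ 0] exI[of _ 1])
  next
    case (diff s t)
    then obtain k l where "inner s uh = of_int k * h" "inner t uh = of_int l * h"
      by blast
    then show ?case
      by (intro exI[of _ "k - l"]) (simp add: inner_simps algebra_simps)
  qed
  assume x: "x \<in> L"
  then obtain k :: int where k: "inner x uh = of_int k * h"
    using * shift unfolding admissible_shift_def by blast
  have "x - of_int k *\<^sub>R \<tau> \<in> \<Lambda>"
    using x k L_of_int[OF tau_L, of k] by (simp add: \<Lambda>_def L_diff inner_simps h_def)
  then show ?thesis
    using k by blast
qed

lemma L_inner: "x \<in> L \<Longrightarrow> y \<in> L \<Longrightarrow> 2 * inner x y \<in> \<int>"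
  using L_subset R_inner by blast

lemma L_nrm: "x \<in> L \<Longrightarrow> nrm x \<in> \<int>"
  using L_subset R_nrm by blast

text \<open>
  \<open>\<Phi>\<close> is a linear isometry that lifts \<open>g\<close>: it maps the null vector of a point \<open>p\<close> to a positive
  multiple of the null vector of \<open>g p\<close>.
\<close>
inductive_set GP :: "((quat option \<Rightarrow> quat option) \<times> (lorentz \<Rightarrow> lorentz)) set"
  where
    one: "(id, id) \<in> GP"
  | translation: "(g, \<Phi>) \<in> GP \<Longrightarrow> w \<in> \<Lambda> \<Longrightarrow> (transl w \<circ> g, lshift w \<circ> \<Phi>) \<in> GP"
  | inversion: "(g, \<Phi>) \<in> GP \<Longrightarrow> c \<in> centres \<Longrightarrow> (inversion c \<circ> g, lrefl (ball_vec c) \<circ> \<Phi>) \<in> GP"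

lemma Gamma_u_iff: "g \<in> Gamma_u n R u \<tau> \<longleftrightarrow> (\<exists>\<Phi>. (g, \<Phi>) \<in> GP)"
proof
  assume "g \<in> Gamma_u n R u \<tau>"
  then show "\<exists>\<Phi>. (g, \<Phi>) \<in> GP"
  proof induction
    case one
    then show ?case using GP.one by blast
  next
    case (translation g w)
    then show ?case using GP.translation unfolding \<Lambda>_eq by blast
  next
    case (inversion g c)
    then show ?case using GP.inversion unfolding centres_eq by blast
  qed
next
  assume "\<exists>\<Phi>. (g, \<Phi>) \<in> GP"
  then obtain \<Phi> where "(g, \<Phi>) \<in> GP" by blast
  then show "g \<in> Gamma_u n R u \<tau>"
    by induction (simp_all only: \<Lambda>_eq centres_eq Gamma_u.intros)
qed

lemma GP_comp:
  assumes "(g, \<Phi>) \<in> GP" "(g', \<Phi>') \<in> GP"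
  shows "(g \<circ> g', \<Phi> \<circ> \<Phi>') \<in> GP"
  using assms
proof (induction g \<Phi> rule: GP.induct)
  case (translation g \<Phi> w)
  then show ?case
    using GP.translation[of "g \<circ> g'" "\<Phi> \<circ> \<Phi>'"] by (simp only: comp_assoc)
next
  case (inversion g \<Phi> c)
  then show ?case
    using GP.inversion[of "g \<circ> g'" "\<Phi> \<circ> \<Phi>'"] by (simp only: comp_assoc)
qed simp

lemma GP_inverse:
  assumes "(g, \<Phi>) \<in> GP"
  shows "\<exists>g' \<Phi>'. (g', \<Phi>') \<in> GP \<and> (\<forall>p. g' (g p) = p \<and> g (g' p) = p) \<and> (\<forall>x. \<Phi>' (\<Phi> x) = x \<and> \<Phi> (\<Phi>' x) = x)"
  using assms
proof (induction g \<Phi> rule: GP.induct)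
  case one
  then show ?case using GP.one by force
next
  case (translation g \<Phi> w)
  then obtain g' \<Phi>' where *: "(g', \<Phi>') \<in> GP" "\<forall>p. g' (g p) = p \<and> g (g' p) = p" "\<forall>x. \<Phi>' (\<Phi> x) = x \<and> \<Phi> (\<Phi>' x) = x"
    by blast
  have "lshift (- w) (lshift w x) = x" "lshift w (lshift (- w) x) = x" for x
    by (simp_all add: lshift_def inner_simps nrm_eq_inner prod_eq_iff)
  moreover have "(g' \<circ> (transl (- w) \<circ> id), \<Phi>' \<circ> (lshift (- w) \<circ> id)) \<in> GP"
    using translation * by (intro GP_comp GP.translation GP.one \<Lambda>_minus)
  ultimately show ?case
    using * by (intro exI[of _ "g' \<circ> (transl (- w) \<circ> id)"] exI[of _ "\<Phi>' \<circ> (lshift (- w) \<circ> id)"] conjI)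
       (assumption, simp_all add: transl_transl del: split_paired_All)
next
  case (inversion g \<Phi> c)
  then obtain g' \<Phi>' where *: "(g', \<Phi>') \<in> GP" "\<forall>p. g' (g p) = p \<and> g (g' p) = p" "\<forall>x. \<Phi>' (\<Phi> x) = x \<and> \<Phi> (\<Phi>' x) = x"
    by blast
  moreover have "(g' \<circ> (inversion c \<circ> id), \<Phi>' \<circ> (lrefl (ball_vec c) \<circ> id)) \<in> GP"
    using inversion * by (intro GP_comp GP.inversion GP.one)
  ultimately show ?case
    using * by (intro exI[of _ "g' \<circ> (inversion c \<circ> id)"] exI[of _ "\<Phi>' \<circ> (lrefl (ball_vec c) \<circ> id)"] conjI)
       (assumption, simp_all add: lrefl_lrefl del: split_paired_All)
qed

lemma GP_linear:
  assumes "(g, \<Phi>) \<in> GP"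
  shows "\<Phi> (x + y) = \<Phi> x + \<Phi> y" "\<Phi> (r *\<^sub>R x) = r *\<^sub>R \<Phi> x" "lprod (\<Phi> x) (\<Phi> y) = lprod x y"
  using assms
  by (induction g \<Phi> arbitrary: x y r rule: GP.induct)
     (simp_all add: linear_lshift linear_lrefl lprod_lshift lprod_lrefl)

lemma GP_ext_vec:
  assumes "(g, \<Phi>) \<in> GP"
  shows "\<exists>l>0. \<Phi> (ext_vec p) = l *\<^sub>R ext_vec (g p)"
  using assms
proof (induction g \<Phi> rule: GP.induct)
  case one
  then show ?case by (intro exI[of _ 1]) simp
next
  case (translation g \<Phi> w)
  then show ?case by (auto simp: linear_lshift transl_ext_vec)
next
  case (inversion g \<Phi> c)
  then obtain l where l: "l > 0" "\<Phi> (ext_vec p) = l *\<^sub>R ext_vec (g p)"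
    by blast
  obtain m where "m > 0" "lrefl (ball_vec c) (ext_vec (g p)) = m *\<^sub>R ext_vec (inversion c (g p))"
    using inversion_ext_vec by blast
  then show ?case
    using l by (intro exI[of _ "l * m"]) (simp add: linear_lrefl)
qed

definition ext_V :: "quat option set"
  where "ext_V = insert None (Some ` V)"

lemma inversion_ext_V:
  assumes "c \<in> V" "p \<in> ext_V"
  shows "inversion c p \<in> ext_V"
proof (cases p)
  case None
  then show ?thesis
    using assms by (simp add: ext_V_def inversion_def)
next
  case (Some z)
  then have "z \<in> V"
    using assms(2) by (auto simp: ext_V_def)
  then have "c + (z - c) /\<^sub>R (norm (z - c))\<^sup>2 \<in> V"
    using assms(1) subspace_coordinate_space
    by (intro subspace_add[OF subspace_coordinate_space] subspace_scale[OF subspace_coordinate_space]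
        subspace_diff[OF subspace_coordinate_space])
  then show ?thesis
    by (simp add: Some ext_V_def inversion_def)
qed

lemma transl_ext_V: "w \<in> V \<Longrightarrow> p \<in> ext_V \<Longrightarrow> transl w p \<in> ext_V"
  using subspace_coordinate_space[THEN subspace_add] by (auto simp: ext_V_def transl_def)

lemma GP_ext_V:
  assumes "(g, \<Phi>) \<in> GP" "p \<in> ext_V"
  shows "g p \<in> ext_V"
  using assms
  by (induction g \<Phi> rule: GP.induct) (auto intro: inversion_ext_V transl_ext_V L_V centres_L \<Lambda>_L)

text \<open>The two walls are unit normals of the base planes, both oriented towards the strip: the
  points between the planes are those whose null vectors have nonnegative product with both.\<close>

definition wall_0 :: lorentz
  where "wall_0 = (0, uh, 0)"

definition wall_1 :: lorentz
  where "wall_1 = (0, - uh, - 2 * h)"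

lemma lprod_wall_point: "lprod (point_vec z) wall_0 = inner z uh" "lprod (point_vec z) wall_1 = h - inner z uh"
  by (simp_all add: lprod_def point_vec_def wall_0_def wall_1_def)

lemma lprod_wall_ball: "lprod (ball_vec z) wall_0 = inner z uh" "lprod (ball_vec z) wall_1 = h - inner z uh"
  by (simp_all add: lprod_def ball_vec_def wall_0_def wall_1_def)

lemma lprod_wall_inf [simp]: "lprod inf_vec wall_0 = 0" "lprod inf_vec wall_1 = 0"
  by (simp_all add: lprod_def inf_vec_def wall_0_def wall_1_def)

lemma lprod_wall_self [simp]: "lprod wall_0 wall_0 = 1" "lprod wall_1 wall_1 = 1"
  by (simp_all add: lprod_def wall_0_def wall_1_def)

text \<open>
  The null vectors over the orbit of \<open>\<infinity>\<close>, generated by inversions that raise the level only.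
\<close>
inductive_set cusps :: "lorentz set"
  where
    inf: "inf_vec \<in> cusps"
  | step: "x \<in> cusps \<Longrightarrow> c \<in> centres \<Longrightarrow> lprod x (ball_vec c) < 0 \<Longrightarrow> lrefl (ball_vec c) x \<in> cusps"

lemma cusps_integral:
  assumes "x \<in> cusps"
  shows "fst x \<in> \<int> \<and> fst x \<ge> 0 \<and> fst (snd x) \<in> L \<and> snd (snd x) \<in> \<int> \<and> lprod x x = 0"
  using assms
proof induction
  case inf
  then show ?case by (simp add: inf_vec_def lprod_def L_0)
next
  case (step x c)
  define A b C where "A = fst x" and "b = fst (snd x)" and "C = snd (snd x)"
  have x: "x = (A, b, C)"
    by (simp add: A_def b_def C_def)
  define m where "m = 2 * lprod x (ball_vec c)"
  have I: "A \<in> \<int>" "A \<ge> 0" "b \<in> L" "C \<in> \<int>" "lprod x x = 0" "c \<in> L"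
    using step centres_L by (auto simp: x)
  have "m = 2 * inner b c - A * (nrm c - 1) - C"
    by (simp add: m_def lprod_def ball_vec_def x field_simps)
  then have "m \<in> \<int>"
    using I L_inner L_nrm by simp
  then obtain k where k: "m = of_int k"
    by (elim Ints_cases)
  have "lrefl (ball_vec c) x = (A - m, b - of_int k *\<^sub>R c, C - m * (nrm c - 1))"
    by (simp add: lrefl_def m_def[symmetric]) (simp add: x ball_vec_def k)
  moreover have "m < 0"
    using step by (simp add: m_def)
  moreover have "lprod (lrefl (ball_vec c) x) (lrefl (ball_vec c) x) = 0"
    using I by (simp add: lprod_lrefl)
  ultimately show ?case
    using I \<open>m \<in> \<int>\<close> by (simp add: L_diff L_of_int L_nrm)
qed

text \<open>A level-raising inversion adds a positive multiple of \<open>ball_vec c\<close>, and a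
  centre on either base plane has nonnegative product with both walls. Hence the orbit of infinity
  cannot leave the strip, once \<open>cusps\<close> is known to contain it.\<close>

lemma cusps_walls:
  assumes "x \<in> cusps"
  shows "lprod x wall_0 \<ge> 0" "lprod x wall_1 \<ge> 0"
proof -
  have "lprod x wall_0 \<ge> 0 \<and> lprod x wall_1 \<ge> 0"
    using assms
  proof induction
    case (step x c)
    have "lprod (lrefl (ball_vec c) x) w = lprod x w - 2 * lprod x (ball_vec c) * lprod (ball_vec c) w" for w
      by (simp add: lrefl_def)
    moreover have "lprod (ball_vec c) wall_0 \<ge> 0" "lprod (ball_vec c) wall_1 \<ge> 0"
      using centres_inner[OF step.hyps(2)] h_pos by (auto simp: lprod_wall_ball)
    moreover have "2 * lprod x (ball_vec c) * lprod (ball_vec c) wall_0 \<le> 0"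
      "2 * lprod x (ball_vec c) * lprod (ball_vec c) wall_1 \<le> 0"
      using step.hyps(3) calculation(2,3) mult_nonpos_nonneg[of "lprod x (ball_vec c)"] by simp_all
    ultimately show ?case
      using step.IH by simp
  qed simp
  then show "lprod x wall_0 \<ge> 0" "lprod x wall_1 \<ge> 0"
    by auto
qed

lemma cusps_lshift:
  assumes "x \<in> cusps" "w \<in> \<Lambda>"
  shows "lshift w x \<in> cusps"
  using assms(1)
proof induction
  case inf
  then show ?case by (simp add: lshift_vecs cusps.inf)
next
  case (step x c)
  have "lprod (lshift w x) (ball_vec (c + w)) < 0"
    using step by (simp add: lprod_lshift flip: lshift_vecs)
  then show ?case
    using step assms(2) by (auto simp: lshift_lrefl lshift_vecs intro!: cusps.step centres_add)
qed

end

lemma lrefl_conj: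
  assumes "lprod v v = 1" "\<And>x. \<rho> (\<rho> x) = x" "\<And>x y. lprod (\<rho> x) (\<rho> y) = lprod x y"
    "\<And>x y. \<rho> (x + y) = \<rho> x + \<rho> y" "\<And>r x. \<rho> (r *\<^sub>R x) = r *\<^sub>R \<rho> x"
  shows "\<rho> (lrefl v x) = lrefl (\<rho> v) (\<rho> x)"
proof -
  have "\<rho> (x - y) = \<rho> x - \<rho> y" for x y
    using assms(4)[of x "(-1) *\<^sub>R y"] assms(5)[of "-1" y] by simp
  then show ?thesis
    by (simp add: lrefl_def assms(3,5))
qed

text \<open>The difference of the two vectors has first component 0, so the reflection is Euclidean:
  it is the one in the perpendicular bisector of \<open>c\<close> and \<open>q\<close>. On lattice
  points the coefficient of \<open>q - c\<close> is an integer.\<close>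

lemma ball_vec_reflect_unit:
  assumes "nrm (q - c) = 1"
  shows "lrefl (ball_vec q - ball_vec c) (ball_vec d) = ball_vec (d - (2 * inner (d - c) (q - c) - 1) *\<^sub>R (q - c))"
proof -
  define r e where "r = q - c" and "e = d - c"
  have q: "q = c + r" and d: "d = c + e"
    by (simp_all add: r_def e_def)
  have r: "inner r r = 1"
    using assms by (simp add: r_def nrm_eq_inner)
  have "2 * lprod (ball_vec d) (ball_vec q - ball_vec c) = 2 * inner e r - 1"
    by (simp add: lprod_ball_ball q d) (simp add: nrm_eq_inner inner_simps inner_commute r field_simps)
  then show ?thesis
    by (simp add: lrefl_def) (simp add: ball_vec_def q d nrm_eq_inner inner_simps inner_commute r algebra_simps)
qed

context strip
begin

lemma centres_distinct_layers:
  assumes "h > 1" "c \<in> centres" "d \<in> centres" "nrm (c - d) = 1"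
  shows "inner c uh = inner d uh"
proof -
  have "\<bar>inner (c - d) uh\<bar> \<le> norm (c - d) * norm uh"
    by (rule Cauchy_Schwarz_ineq2)
  also have "norm (c - d) = 1"
    using assms(4) by (simp add: norm_quat_eq_sqrt_nrm)
  finally have "\<bar>inner (c - d) uh\<bar> \<le> 1"
    by simp
  then show ?thesis
    using centres_inner[OF assms(2)] centres_inner[OF assms(3)] assms(1) by (auto simp: inner_simps)
qed

text \<open>The bisector reflection fixes infinity. Since \<open>h > 1\<close> forces
  \<open>c\<close> and \<open>q\<close> into the same base plane, it also permutes the centres, so
  it carries each construction of a cusp to another one.\<close>

lemma cusps_reflect_unit:
  assumes "h > 1" "c \<in> centres" "q \<in> centres" "nrm (q - c) = 1" "x \<in> cusps"
  shows "lrefl (ball_vec q - ball_vec c) x \<in> cusps"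
proof -
  let ?\<rho> = "lrefl (ball_vec q - ball_vec c)"
  have one: "lprod (ball_vec q - ball_vec c) (ball_vec q - ball_vec c) = 1"
    using assms(4) by (simp add: lprod_ball_ball nrm_diff inner_commute field_simps)
  have "q - c \<in> \<Lambda>"
    using assms centres_distinct_layers by (intro centres_diff) auto
  have centre: "\<exists>e\<in>centres. ?\<rho> (ball_vec d) = ball_vec e" if "d \<in> centres" for d
  proof -
    have "2 * inner (d - c) (q - c) - 1 \<in> \<int>"
      using that assms centres_L by (intro Ints_diff L_inner L_diff) auto
    then obtain k where k: "2 * inner (d - c) (q - c) - 1 = of_int k"
      by (elim Ints_cases)
    have "of_int (- k) *\<^sub>R (q - c) \<in> \<Lambda>"
      using \<open>q - c \<in> \<Lambda>\<close> L_of_int[of "q - c" "- k"] by (simp add: \<Lambda>_def del: of_int_minus)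
    then have "d + of_int (- k) *\<^sub>R (q - c) \<in> centres"
      using that by (rule centres_add[rotated])
    then show ?thesis
      using ball_vec_reflect_unit[OF assms(4), of d] k by (intro bexI[of _ "d + of_int (- k) *\<^sub>R (q - c)"]) auto
  qed
  show ?thesis
    using assms(5)
  proof induction
    case inf
    have "?\<rho> inf_vec = inf_vec"
      by (simp add: lrefl_def lprod_inf)
    then show ?case
      by (simp add: cusps.inf)
  next
    case (step x d)
    obtain e where e: "e \<in> centres" "?\<rho> (ball_vec d) = ball_vec e"
      using centre step.hyps by blast
    have "?\<rho> (lrefl (ball_vec d) x) = lrefl (ball_vec e) (?\<rho> x)"
      unfolding e(2)[symmetric]
      by (rule lrefl_conj) (simp_all add: lrefl_lrefl[OF one] lprod_lrefl[OF one] linear_lrefl)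
    moreover have "lprod (?\<rho> x) (ball_vec e) < 0"
      using step.hyps unfolding e(2)[symmetric] by (simp add: lprod_lrefl[OF one])
    ultimately show ?case
      using step.IH e(1) by (simp add: cusps.step)
  qed
qed

text \<open>A null vector \<open>(A, b, C)\<close> with \<open>A > 0\<close> lies over the point
  \<open>b /\<^sub>R A\<close>, and a positive product with \<open>ball_vec c\<close> says that this
  point is in the open unit ball around \<open>c\<close>. Two such balls overlap.\<close>

lemma cusps_close_centres:
  assumes "x \<in> cusps" "lprod x (ball_vec c) > 0" "lprod x (ball_vec q) > 0"
  shows "nrm (q - c) < 4"
proof -
  define A b C where "A = fst x" and "b = fst (snd x)" and "C = snd (snd x)"
  have x: "x = (A, b, C)"
    by (simp add: A_def b_def C_def)
  have A: "A \<ge> 0" and null: "nrm b = A * C"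
    using cusps_integral[OF assms(1)] by (auto simp: x lprod_def nrm_eq_inner field_simps)
  have pos: "2 * inner b d - A * (nrm d - 1) - C > 0" if "lprod x (ball_vec d) > 0" for d
    using that by (simp add: x lprod_def ball_vec_def field_simps)
  have close: "norm (b - A *\<^sub>R d) < A" if "lprod x (ball_vec d) > 0" for d
  proof -
    \<comment> \<open>A cusp with \<open>A = 0\<close> has \<open>b = 0\<close> and
      \<open>C \<ge> 0\<close>, so its product with a ball vector is not positive.\<close>
    have "A \<noteq> 0"
    proof
      assume "A = 0"
      then have "b = 0"
        using null by simp
      moreover have "C \<ge> 0"
        using assms(1)
      proof (cases rule: cusps.cases)
        case (step y e)
        have "A = fst y - 2 * lprod y (ball_vec e)"
          using step(1) fst_lrefl_ball[of e y] by (simp add: A_def)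
        then show ?thesis
          using cusps_integral[OF step(2)] step(4) \<open>A = 0\<close> by simp
      qed (simp add: x inf_vec_def)
      ultimately show False
        using pos[OF that] \<open>A = 0\<close> by simp
    qed
    then have "A > 0"
      using A by simp
    have "nrm (b - A *\<^sub>R d) = A * (C - 2 * inner b d + A * nrm d)"
      by (simp add: nrm_diff null nrm_scaleR power2_eq_square algebra_simps)
    also have "\<dots> < A * A"
      using pos[OF that] \<open>A > 0\<close> by (intro mult_strict_left_mono) (simp_all add: algebra_simps)
    finally have "(norm (b - A *\<^sub>R d))\<^sup>2 < A\<^sup>2"
      by (simp add: nrm_eq_norm power2_eq_square)
    then show ?thesis
      using \<open>A > 0\<close> by (auto intro: power_less_imp_less_base[of _ 2])
  qed
  have "A *\<^sub>R (q - c) = (b - A *\<^sub>R c) - (b - A *\<^sub>R q)"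
    by (simp add: algebra_simps)
  then have "norm (A *\<^sub>R (q - c)) \<le> norm (b - A *\<^sub>R c) + norm (b - A *\<^sub>R q)"
    by (simp only: norm_triangle_ineq4)
  also have "\<dots> < A + A"
    using close assms(2,3) by (intro add_strict_mono)
  finally have *: "A * norm (q - c) < A * 2"
    using A by simp
  have "A > 0"
    using le_less_trans[OF norm_ge_zero close[OF assms(2)]] .
  then have "norm (q - c) < 2"
    using * by simp
  then show ?thesis
    using power_strict_mono[of "norm (q - c)" 2 2] by (simp add: nrm_eq_norm)
qed

text \<open>The confluence argument again, with \<open>fst x\<close> as the level. An inversion at
  \<open>q\<close> that lowers the level is rewritten by the dihedral relation between
  \<open>q\<close> and the centre \<open>c\<close> of the last step that produced \<open>x\<close>.
  So \<open>cusps\<close>, although built by raising steps only, is closed under all inversions at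
  centres.\<close>

lemma cusps_lrefl:
  assumes "h > 1" "x \<in> cusps" "q \<in> centres"
  shows "lrefl (ball_vec q) x \<in> cusps"
  using assms(2,3)
proof (induction "nat \<lfloor>fst x\<rfloor>" arbitrary: x q rule: less_induct)
  case less
  show ?case
  proof (cases "lprod x (ball_vec q)" "0::real" rule: linorder_cases)
    case less
    then show ?thesis
      using less.prems by (intro cusps.step)
  next
    case equal
    then show ?thesis
      using less.prems by (simp add: lrefl_def)
  next
    case greater
    from less.prems(1) show ?thesis
    proof cases
      case inf
      then show ?thesis
        using greater by (simp add: lprod_inf)
    next
      case (step y c)
      have xy: "lrefl (ball_vec c) x = y"
        by (simp add: step lrefl_lrefl)
      have "lprod x (ball_vec c) = - lprod y (ball_vec c)"
        by (simp add: step lrefl_def)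
      then have kc: "lprod x (ball_vec c) > 0"
        using step by simp
      define kx ky where "kx = 2 * lprod x (ball_vec c)" and "ky = 2 * lprod x (ball_vec q)"
      have k: "kx > 0" "ky > 0"
        using kc greater by (auto simp: kx_def ky_def)
      have rk: "nat \<lfloor>fst z\<rfloor> < nat \<lfloor>fst x\<rfloor>" if z: "z \<in> cusps" "fst z < fst x" for z
      proof -
        obtain k l where kl: "fst z = of_int k" "fst x = of_int l"
          using cusps_integral[OF z(1)] cusps_integral[OF less.prems(1)] by (metis Ints_cases)
        then show ?thesis
          using z cusps_integral[OF z(1)] by simp
      qed
      have fy: "fst y = fst x - kx"
        by (simp add: fst_lrefl_ball kx_def flip: xy)
      have IH: "lrefl (ball_vec d) z \<in> cusps" if "z \<in> cusps" "fst z < fst x" "d \<in> centres" for z d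
        using less.hyps[OF rk[OF that(1,2)] that(1,3)] .
      have yq: "lrefl (ball_vec q) y \<in> cusps"
        using step less.prems k by (intro IH) (auto simp: fy)
      have sq: "lrefl (ball_vec q) z = z - (2 * lprod z (ball_vec q)) *\<^sub>R ball_vec q"
        "lrefl (ball_vec c) z = z - (2 * lprod z (ball_vec c)) *\<^sub>R ball_vec c" for z
        by (simp_all add: lrefl_def)
      have y: "y = x - kx *\<^sub>R ball_vec c"
        by (simp add: kx_def flip: xy lrefl_def)
      have kx': "2 * lprod x (ball_vec c) = kx" and ky': "2 * lprod x (ball_vec q) = ky"
        by (simp_all add: kx_def ky_def)
      show ?thesis
      proof (cases "q = c")
        case True
        then show ?thesis
          using step xy by simp
      next
        case False
        have "nrm (q - c) < 4"
          using cusps_close_centres less.prems(1) kc greater by blast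
        moreover have "nrm (q - c) \<in> \<int>"
          using less.prems step centres_L by (intro L_nrm L_diff) auto
        moreover have "nrm (q - c) > 0"
          using False nrm_nonneg[of "q - c"] by (simp add: less_le del: nrm_nonneg)
        ultimately consider "nrm (q - c) = 1" | "nrm (q - c) = 2" | "nrm (q - c) = 3"
          using Ints_nonneg_less_4_cases by metis
        then show ?thesis
        proof cases
          case 1
          \<comment> \<open>The word of length five that is used for norm 3 would return to the
            level of \<open>x\<close> on its way. Instead the bisector reflection, a conjugate of
            one inversion by the other, is applied after the inversions at \<open>c\<close> and
            \<open>q\<close>.\<close>
          then have b: "lprod (ball_vec c) (ball_vec q) = 1/2" "lprod (ball_vec q) (ball_vec c) = 1/2"
            by (simp_all add: lprod_ball_ball nrm_diff inner_commute)
          have "lrefl (ball_vec q - ball_vec c) (lrefl (ball_vec q) y) \<in> cusps"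
            using step less.prems yq 1 assms(1) by (intro cusps_reflect_unit)
          moreover have "lrefl (ball_vec q - ball_vec c) (lrefl (ball_vec q) y) = lrefl (ball_vec q) x"
            unfolding lrefl_def y by (simp add: b kx' ky' algebra_simps)
          ultimately show ?thesis by simp
        next
          case 2
          then have b: "lprod (ball_vec c) (ball_vec q) = 0" "lprod (ball_vec q) (ball_vec c) = 0"
            by (simp_all add: lprod_ball_ball nrm_diff inner_commute)
          have "fst (lrefl (ball_vec q) y) < fst x"
            using k by (simp add: sq y b ky')
          then have "lrefl (ball_vec c) (lrefl (ball_vec q) y) \<in> cusps"
            by (intro IH[OF yq _ step(3)])
          moreover have "lrefl (ball_vec c) (lrefl (ball_vec q) y) = lrefl (ball_vec q) x"
            unfolding lrefl_def y by (simp add: b kx' ky' algebra_simps)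
          ultimately show ?thesis by simp
        next
          case 3
          \<comment> \<open>The product of the two reflections has order 3, so the word
            \<open>c q c q c\<close> equals the inversion at \<open>q\<close>; the levels after its
            first four letters are all below that of \<open>x\<close>.\<close>
          then have b: "lprod (ball_vec c) (ball_vec q) = - 1/2" "lprod (ball_vec q) (ball_vec c) = - 1/2"
            by (simp_all add: lprod_ball_ball nrm_diff inner_commute field_simps)
          have y2: "lrefl (ball_vec q) y = x - kx *\<^sub>R ball_vec c - (kx + ky) *\<^sub>R ball_vec q"
            unfolding lrefl_def y by (simp add: b ky' algebra_simps)
          have y3: "lrefl (ball_vec c) (lrefl (ball_vec q) y) = x - (kx + ky) *\<^sub>R ball_vec c - (kx + ky) *\<^sub>R ball_vec q"
            unfolding y2 by (simp add: lrefl_def b kx' algebra_simps)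
          have y4: "lrefl (ball_vec q) (lrefl (ball_vec c) (lrefl (ball_vec q) y)) = x - (kx + ky) *\<^sub>R ball_vec c - ky *\<^sub>R ball_vec q"
            unfolding y3 by (simp add: lrefl_def b ky' algebra_simps)
          have y5: "lrefl (ball_vec c) (lrefl (ball_vec q) (lrefl (ball_vec c) (lrefl (ball_vec q) y))) = lrefl (ball_vec q) x"
            unfolding y4 by (simp add: lrefl_def b kx' ky' algebra_simps)
          have 3: "lrefl (ball_vec c) (lrefl (ball_vec q) y) \<in> cusps"
            using k by (intro IH[OF yq _ step(3)]) (simp add: y2)
          then have 4: "lrefl (ball_vec q) (lrefl (ball_vec c) (lrefl (ball_vec q) y)) \<in> cusps"
            using k by (intro IH[OF _ _ less.prems(2)]) (simp_all add: y3)
          have "lrefl (ball_vec c) (lrefl (ball_vec q) (lrefl (ball_vec c) (lrefl (ball_vec q) y))) \<in> cusps"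
            using k by (intro IH[OF 4 _ step(3)]) (simp add: y4)
          then show ?thesis
            by (simp add: y5)
        qed
      qed
    qed
  qed
qed

lemma GP_cusps:
  assumes "h > 1" "(g, \<Phi>) \<in> GP"
  shows "\<Phi> inf_vec \<in> cusps"
  using assms(2)
  by (induction g \<Phi> rule: GP.induct) (auto intro: cusps.inf cusps_lshift cusps_lrefl assms(1))

lemma GP_inf_in_strip:
  assumes "h > 1" "(g, \<Phi>) \<in> GP" "g None = Some w"
  shows "0 \<le> inner w uh" "inner w uh \<le> h"
proof -
  obtain l where l: "l > 0" "\<Phi> (ext_vec None) = l *\<^sub>R ext_vec (Some w)"
    using GP_ext_vec[OF assms(2)] assms(3) by metis
  then have "l *\<^sub>R point_vec w \<in> cusps"
    using GP_cusps[OF assms(1,2)] by (simp add: ext_vec_def)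
  from cusps_walls[OF this] show "0 \<le> inner w uh" "inner w uh \<le> h"
    using l(1) by (simp_all add: lprod_wall_point zero_le_mult_iff)
qed

text \<open>An element of the group that fixes \<open>\<infinity>\<close> scales the corresponding null vector by 1, by integrality.\<close>
lemma GP_fix_inf:
  assumes "h > 1" "(g, \<Phi>) \<in> GP" "g None = None"
  shows "\<Phi> inf_vec = inf_vec"
proof -
  have int: "\<exists>l>0. l \<in> \<int> \<and> \<Psi> inf_vec = l *\<^sub>R inf_vec" if f: "(f, \<Psi>) \<in> GP" "f None = None" for f \<Psi>
  proof -
    obtain l where l: "l > 0" "\<Psi> inf_vec = l *\<^sub>R inf_vec"
      using GP_ext_vec[OF f(1), of None] f(2) by (auto simp: ext_vec_def)
    moreover have "snd (snd (\<Psi> inf_vec)) \<in> \<int>"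
      using cusps_integral GP_cusps[OF assms(1) f(1)] by blast
    ultimately show ?thesis
      by (intro exI[of _ l]) (simp add: inf_vec_def)
  qed
  obtain g' \<Phi>' where g': "(g', \<Phi>') \<in> GP" "\<And>p. g' (g p) = p" "\<And>x. \<Phi>' (\<Phi> x) = x"
    using GP_inverse[OF assms(2)] by blast
  obtain l where l: "l > 0" "l \<in> \<int>" "\<Phi> inf_vec = l *\<^sub>R inf_vec"
    using int[OF assms(2,3)] by blast
  obtain m where m: "m > 0" "m \<in> \<int>" "\<Phi>' inf_vec = m *\<^sub>R inf_vec"
    using int[OF g'(1)] g'(2)[of None] assms(3) by auto
  have "inf_vec = l *\<^sub>R (m *\<^sub>R inf_vec)"
    using g'(3)[of inf_vec] l(3) m(3) GP_linear(2)[OF g'(1)] by simp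
  then have "l * m = 1"
    by (simp add: inf_vec_def)
  then have "l = 1"
    using nat_Ints_mult_eq_1[OF l(2) m(2)] l(1) by simp
  then show ?thesis
    using l(3) by simp
qed

end

section \<open>Tangency points\<close>

lemma finite_uniform_radius:
  assumes "finite F" "\<And>x. x \<in> F \<Longrightarrow> \<exists>e>0. P x e" "\<And>x e e'. P x e \<Longrightarrow> e' \<le> e \<Longrightarrow> P x e'"
  shows "\<exists>e>(0::real). \<forall>x\<in>F. P x e"
  using assms(1,2)
proof (induction F)
  case empty
  then show ?case by (intro exI[of _ 1]) auto
next
  case (insert x F)
  then obtain e e' where e: "e > 0" "\<forall>x\<in>F. P x e" "e' > 0" "P x e'"
    by (metis insert_iff)
  then show ?case
    using assms(3) by (intro exI[of _ "min e e'"]) (auto intro: min.cobounded1 min.cobounded2)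
qed

lemma bounded_discrete_imp_finite:
  fixes S :: "'a::heine_borel set"
  assumes "bounded S" "e > 0" "\<And>x y. x \<in> S \<Longrightarrow> y \<in> S \<Longrightarrow> x \<noteq> y \<Longrightarrow> e \<le> dist x y"
  shows "finite S"
proof (rule ccontr)
  assume "infinite S"
  then obtain x where x: "x islimpt S"
    using assms(1) bounded_infinite_imp_islimpt[of S S] by blast
  obtain y where y: "y \<in> S" "y \<noteq> x" "dist y x < e / 2"
    using x assms(2) unfolding islimpt_approachable by (meson half_gt_zero)
  obtain z where z: "z \<in> S" "z \<noteq> x" "dist z x < dist y x"
    using x y(2) unfolding islimpt_approachable by (metis zero_less_dist_iff)
  have "dist y z < e"
    using dist_triangle2[of y z x] y z by simp
  then show False
    using assms(3)[OF y(1) z(1)] z(3) by auto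
qed

context strip
begin

lemma subspace_V: "subspace V"
  by (rule subspace_coordinate_space)

lemma closed_V: "closed V"
  using subspace_V by (rule closed_subspace)

lemma L_norm_ge_1: "x \<in> L \<Longrightarrow> x \<noteq> 0 \<Longrightarrow> 1 \<le> norm x"
proof -
  assume x: "x \<in> L" "x \<noteq> 0"
  then obtain k where k: "nrm x = of_int k"
    using L_nrm by (auto elim: Ints_cases)
  moreover have "nrm x > 0"
    using x(2) nrm_nonneg[of x] by (simp add: less_le del: nrm_nonneg)
  ultimately have "nrm x \<ge> 1"
    by simp
  then show ?thesis
    by (simp add: norm_quat_eq_sqrt_nrm)
qed

lemma finite_L_cball: "finite (L \<inter> cball x r)"
proof (rule bounded_discrete_imp_finite[of _ 1])
  show "bounded (L \<inter> cball x r)"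
    by (meson bounded_cball bounded_subset inf_le2)
  show "1 \<le> dist y z" if "y \<in> L \<inter> cball x r" "z \<in> L \<inter> cball x r" "y \<noteq> z" for y z
    using that L_norm_ge_1[of "y - z"] by (simp add: dist_norm L_diff)
qed simp

lemma hyperplane_covered:
  assumes "x \<in> V" "inner x uh = 0"
  shows "\<exists>c\<in>\<Lambda>. norm (x - c) < 1"
proof -
  have "hyperplane n R u \<subseteq> (\<Union>c \<in> hyperplane n R u \<inter> R. ball c 1)"
    using covering by (simp add: normalized_covering_vector_def covering_vector_def)
  then obtain c where "c \<in> hyperplane n R u \<inter> R" "x \<in> ball c 1"
    using assms by (auto simp: hyperplane_eq)
  then show ?thesis
    by (intro bexI[of _ c]) (auto simp: \<Lambda>_eq hyperplane_eq L_iff dist_norm norm_minus_commute)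
qed

lemma strip_representative:
  assumes "x \<in> V"
  shows "\<exists>k::int. 0 \<le> inner (x - of_int k *\<^sub>R \<tau>) uh \<and> inner (x - of_int k *\<^sub>R \<tau>) uh < h"
proof (intro exI[of _ "\<lfloor>inner x uh / h\<rfloor>"])
  have "of_int \<lfloor>inner x uh / h\<rfloor> * h \<le> inner x uh" "inner x uh < (of_int \<lfloor>inner x uh / h\<rfloor> + 1) * h"
    using h_pos by (rule floor_divide_lower, intro floor_divide_upper)
  then show "0 \<le> inner (x - of_int \<lfloor>inner x uh / h\<rfloor> *\<^sub>R \<tau>) uh \<and>
      inner (x - of_int \<lfloor>inner x uh / h\<rfloor> *\<^sub>R \<tau>) uh < h"
    by (simp add: inner_simps algebra_simps flip: h_def)
qed

text \<open>Multiples of \<open>\<tau>\<close> bring the point into the strip, and the covering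
  property of \<open>u\<close> handles its projection to the base plane. This replaces any explicit
  fundamental domain in the compactness arguments.\<close>

lemma L_cobounded:
  assumes "x \<in> V"
  shows "\<exists>l\<in>L. norm (x - l) \<le> h + 1"
proof -
  obtain k :: int where k: "0 \<le> inner (x - of_int k *\<^sub>R \<tau>) uh" "inner (x - of_int k *\<^sub>R \<tau>) uh < h"
    using strip_representative[OF assms] by blast
  define z where "z = x - of_int k *\<^sub>R \<tau>"
  have zV: "z \<in> V"
    using assms L_V[OF L_of_int[OF tau_L, of k]] by (simp add: z_def subspace_diff[OF subspace_V])
  have "z - inner z uh *\<^sub>R uh \<in> V"
    using zV uh_V by (intro subspace_diff[OF subspace_V] subspace_scale[OF subspace_V])
  then obtain c where c: "c \<in> \<Lambda>" "norm (z - inner z uh *\<^sub>R uh - c) < 1"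
    using hyperplane_covered[of "z - inner z uh *\<^sub>R uh"] by (auto simp: inner_simps)
  have "norm (z - c) = norm ((z - inner z uh *\<^sub>R uh - c) + inner z uh *\<^sub>R uh)"
    by (simp add: algebra_simps)
  also have "\<dots> \<le> norm (z - inner z uh *\<^sub>R uh - c) + norm (inner z uh *\<^sub>R uh)"
    by (rule norm_triangle_ineq)
  also have "\<dots> \<le> 1 + h"
    using c k by (intro add_mono) (auto simp: z_def)
  finally have "norm (x - (c + of_int k *\<^sub>R \<tau>)) \<le> h + 1"
    by (simp add: z_def algebra_simps)
  moreover have "c + of_int k *\<^sub>R \<tau> \<in> L"
    using c \<Lambda>_L L_of_int[OF tau_L] by (intro L_add)
  ultimately show ?thesis by blast
qed

text \<open>The points outside all open unit balls. When the closed balls cover, these are the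
  places where no inversion at a lattice point expands.\<close>

definition tangency :: "quat set"
  where "tangency = {x \<in> V. \<forall>c\<in>L. 1 \<le> norm (x - c)}"

lemma tangency_add: "x \<in> tangency \<Longrightarrow> l \<in> L \<Longrightarrow> x + l \<in> tangency"
proof -
  assume x: "x \<in> tangency" "l \<in> L"
  have "1 \<le> norm (x + l - c)" if "c \<in> L" for c
    using x that L_diff[of c l] by (auto simp: tangency_def algebra_simps)
  then show ?thesis
    using x L_V subspace_add[OF subspace_V] by (simp add: tangency_def)
qed

lemma closed_tangency: "closed tangency"
proof -
  have "tangency = V \<inter> (\<Inter>c\<in>L. {x. 1 \<le> norm (x - c)})"
    by (auto simp: tangency_def)
  moreover have "closed {x. 1 \<le> norm (x - c)}" for c :: quat
    by (intro closed_Collect_le continuous_intros)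
  ultimately show ?thesis
    by (simp add: closed_V closed_Int closed_INT)
qed

end

locale covered_strip = strip +
  assumes h_gt_1: "h > 1"
    and no_gap: "x \<in> V \<Longrightarrow> \<exists>c\<in>L. norm (x - c) \<le> 1"
begin

lemma tangency_gap: "\<exists>e>0. \<forall>c\<in>L. norm (x - c) < 1 + e \<longrightarrow> norm (x - c) \<le> 1"
proof -
  let ?F = "{c \<in> L \<inter> cball x 2. norm (x - c) > 1}"
  have "finite ?F"
    using finite_L_cball[of x 2] by (rule finite_subset[rotated]) auto
  then have "\<exists>e>0. \<forall>c\<in>?F. 1 + e \<le> norm (x - c)"
  proof (rule finite_uniform_radius)
    fix c assume "c \<in> ?F"
    then show "\<exists>e>0. 1 + e \<le> norm (x - c)"
      by (intro exI[of _ "norm (x - c) - 1"]) auto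
  qed auto
  then obtain e where e: "e > 0" "\<forall>c\<in>?F. 1 + e \<le> norm (x - c)"
    by blast
  then show ?thesis
    by (intro exI[of _ "min e 1"]) (force simp: dist_norm)
qed

text \<open>
  Beyond \<open>y\<close> on the ray from \<open>x\<close> the distance to every lattice point near \<open>y\<close> exceeds 1,
  since it equals 1 at both \<open>x\<close> and \<open>y\<close>; hence tangency points are isolated.
\<close>
lemma tangency_isolated:
  assumes x: "x \<in> tangency"
  shows "\<exists>e>0. \<forall>y\<in>tangency. y \<noteq> x \<longrightarrow> e \<le> norm (y - x)"
proof -
  obtain e where e: "e > 0" "\<And>c. c \<in> L \<Longrightarrow> norm (x - c) < 1 + e \<Longrightarrow> norm (x - c) \<le> 1"
    using tangency_gap by blast
  have False if y: "y \<in> tangency" "y \<noteq> x" "norm (y - x) < e" for y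
  proof -
    obtain e' where e': "e' > 0" "\<And>c. c \<in> L \<Longrightarrow> norm (y - c) < 1 + e' \<Longrightarrow> norm (y - c) \<le> 1"
      using tangency_gap by blast
    \<comment> \<open>The point \<open>z\<close> is at distance \<open>e' / 2\<close> from
      \<open>y\<close>, so a lattice point within 1 of \<open>z\<close> is within
      \<open>1 + e'\<close> of \<open>y\<close>, and therefore at distance exactly 1 from
      it.\<close>
    define s where "s = e' / (2 * norm (y - x))"
    have s: "s > 0" "s * norm (y - x) < e'"
      using e' y by (simp_all add: s_def)
    define z where "z = y + s *\<^sub>R (y - x)"
    have "z \<in> V"
      using x y subspace_V unfolding z_def tangency_def
      by (auto intro: subspace_add subspace_scale subspace_diff)
    then obtain c where c: "c \<in> L" "norm (z - c) \<le> 1"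
      using no_gap by blast
    have "norm (y - c) \<le> norm (z - c) + norm (s *\<^sub>R (y - x))"
      using norm_triangle_ineq4[of "z - c" "s *\<^sub>R (y - x)"] by (simp add: z_def algebra_simps)
    then have "norm (y - c) < 1 + e'"
      using c s by simp
    then have yc: "norm (y - c) = 1"
      using e'(2)[OF c(1)] y(1) c(1) by (force simp: tangency_def)
    have "norm (x - c) \<le> norm (y - c) + norm (y - x)"
      using norm_triangle_ineq4[of "y - c" "y - x"] by (simp add: algebra_simps)
    then have xc: "norm (x - c) = 1"
      using e(2)[OF c(1)] x c(1) yc y(3) by (force simp: tangency_def)
    define a b where "a = y - c" and "b = y - x"
    have "nrm a = 1" "nrm (a - b) = 1" "nrm (a + s *\<^sub>R b) \<le> 1"
      using yc xc c(2) by (simp_all add: a_def b_def nrm_eq_norm z_def algebra_simps power_le_one)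
    then have "2 * inner a b = nrm b" "2 * s * inner a b + s\<^sup>2 * nrm b \<le> 0"
      by (simp_all add: nrm_diff nrm_add nrm_scaleR)
    moreover have "nrm b > 0"
      using y(2) nrm_nonneg[of b] by (simp add: less_le b_def del: nrm_nonneg)
    ultimately show False
      using s(1) by (smt (verit) mult_pos_pos zero_less_power mult.assoc mult.commute)
  qed
  then show ?thesis
    using e(1) by (intro exI[of _ e]) force
qed

lemma finite_tangency_cball: "finite (tangency \<inter> cball x r)"
proof (rule ccontr)
  assume "infinite (tangency \<inter> cball x r)"
  moreover have "compact (tangency \<inter> cball x r)"
    using closed_tangency by (simp add: closed_Int_compact)
  ultimately obtain y where y: "y \<in> tangency" "y islimpt (tangency \<inter> cball x r)"
    by (metis IntD1 compact_eq_Bolzano_Weierstrass subset_refl)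
  obtain e where "e > 0" "\<forall>z\<in>tangency. z \<noteq> y \<longrightarrow> e \<le> norm (z - y)"
    using tangency_isolated[OF y(1)] by blast
  then show False
    using y(2) unfolding islimpt_approachable dist_norm by (metis IntD1 not_le)
qed

lemma countable_tangency: "countable tangency"
proof -
  have "tangency = (\<Union>k::nat. tangency \<inter> cball 0 (real k))"
    using real_arch_simple by (auto simp: dist_norm)
  moreover have "countable \<dots>"
    using finite_tangency_cball by (intro countable_UN) (auto intro: countable_finite)
  ultimately show ?thesis by simp
qed

text \<open>Tangency points are invariant under lattice translations and finite in number in a ball
  that meets all translates, so the local constants have a common lower bound.\<close>

lemma tangency_uniform:
  "\<exists>e>0. (\<forall>x\<in>tangency. \<forall>c\<in>L. norm (x - c) < 1 + e \<longrightarrow> norm (x - c) = 1) \<and>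
    (\<forall>x\<in>tangency. \<forall>y\<in>tangency. y \<noteq> x \<longrightarrow> 2 * e \<le> norm (y - x))"
proof -
  define P where "P x e \<longleftrightarrow> (\<forall>c\<in>L. norm (x - c) < 1 + e \<longrightarrow> norm (x - c) = 1) \<and>
    (\<forall>y\<in>tangency. y \<noteq> x \<longrightarrow> 2 * e \<le> norm (y - x))" for x and e :: real
  have "\<exists>e>0. \<forall>x\<in>tangency \<inter> cball 0 (h + 1). P x e"
  proof (rule finite_uniform_radius[OF finite_tangency_cball])
    fix x assume x: "x \<in> tangency \<inter> cball 0 (h + 1)"
    obtain e e' where e: "e > 0" "\<forall>c\<in>L. norm (x - c) < 1 + e \<longrightarrow> norm (x - c) \<le> 1"
      "e' > 0" "\<forall>y\<in>tangency. y \<noteq> x \<longrightarrow> e' \<le> norm (y - x)"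
      using tangency_gap[of x] tangency_isolated[of x] x by (metis IntD1)
    have "P x (min e (e' / 2))"
      unfolding P_def
    proof (intro conjI ballI impI)
      fix c assume "c \<in> L" "norm (x - c) < 1 + min e (e' / 2)"
      then have "norm (x - c) \<le> 1"
        using e(2) by auto
      moreover have "1 \<le> norm (x - c)"
        using x \<open>c \<in> L\<close> by (simp add: tangency_def)
      ultimately show "norm (x - c) = 1"
        by simp
    next
      fix y assume "y \<in> tangency" "y \<noteq> x"
      then have "e' \<le> norm (y - x)"
        using e(4) by blast
      then show "2 * min e (e' / 2) \<le> norm (y - x)"
        by linarith
    qed
    then show "\<exists>e>0. P x e"
      using e by (intro exI[of _ "min e (e' / 2)"]) simp
  next
    fix x e e' assume "P x e" "e' \<le> e"
    then show "P x e'"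
      unfolding P_def by (meson add_left_mono less_le_trans mult_left_mono order_trans zero_le_numeral)
  qed
  then obtain e where e: "e > 0" "\<And>x. x \<in> tangency \<Longrightarrow> norm x \<le> h + 1 \<Longrightarrow> P x e"
    by auto
  have "P x e" if x: "x \<in> tangency" for x
  proof -
    obtain l where l: "l \<in> L" "norm (x - l) \<le> h + 1"
      using x L_cobounded by (auto simp: tangency_def)
    have "x - l \<in> tangency"
      using tangency_add[OF x L_minus[OF l(1)]] by simp
    then have P: "P (x - l) e"
      using e(2) l(2) by blast
    have "norm (x - c) = 1" if "c \<in> L" "norm (x - c) < 1 + e" for c
    proof -
      have "norm ((x - l) - (c - l)) < 1 + e \<longrightarrow> norm ((x - l) - (c - l)) = 1"
        using P L_diff[OF that(1) l(1)] unfolding P_def by blast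
      then show ?thesis
        using that(2) by simp
    qed
    moreover have "2 * e \<le> norm (y - x)" if "y \<in> tangency" "y \<noteq> x" for y
    proof -
      have "y - l \<in> tangency"
        using tangency_add[OF that(1) L_minus[OF l(1)]] by simp
      then have "y - l \<noteq> x - l \<longrightarrow> 2 * e \<le> norm ((y - l) - (x - l))"
        using P unfolding P_def by blast
      then show ?thesis
        using that(2) by simp
    qed
    ultimately show ?thesis
      by (simp add: P_def)
  qed
  then show ?thesis
    using e(1) unfolding P_def by blast
qed

text \<open>Off a neighbourhood of the tangency points the distance to the lattice is less than 1,
  and modulo the lattice it attains its maximum on a compact set.\<close>

lemma away_from_tangency:
  assumes "e > 0"
  shows "\<exists>\<rho>. 0 < \<rho> \<and> \<rho> < 1 \<and> (\<forall>z\<in>V. (\<forall>x\<in>tangency. e \<le> norm (z - x)) \<longrightarrow> (\<exists>c\<in>L. norm (z - c) \<le> \<rho>))"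
proof -
  let ?K = "V \<inter> cball 0 (h + 1) \<inter> (\<Inter>x\<in>tangency. {z. e \<le> norm (z - x)})"
  have "closed {z. e \<le> norm (z - x)}" for x :: quat
    by (intro closed_Collect_le continuous_intros)
  moreover have "compact (V \<inter> cball 0 (h + 1))"
    using closed_V by (simp add: closed_Int_compact)
  ultimately have K: "compact ?K"
    by (intro compact_Int_closed[of "V \<inter> _"] closed_INT) auto
  have "L \<noteq> {}"
    using L_0 by auto
  have "\<exists>m<1. \<forall>z\<in>?K. infdist z L \<le> m"
  proof (cases "?K = {}")
    case True
    then show ?thesis by (intro exI[of _ 0]) auto
  next
    case False
    obtain z where z: "z \<in> ?K" "\<forall>y\<in>?K. infdist y L \<le> infdist z L"
      using continuous_attains_sup[OF K False continuous_on_infdist[OF continuous_on_id]] by blast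
    have "z \<notin> tangency"
      using z(1) assms by auto
    then obtain c where "c \<in> L" "norm (z - c) < 1"
      using z(1) by (auto simp: tangency_def not_le)
    then have "infdist z L < 1"
      using infdist_le[of c L z] by (simp add: dist_norm)
    then show ?thesis
      using z(2) by blast
  qed
  then obtain m where m: "m < 1" "\<And>z. z \<in> ?K \<Longrightarrow> infdist z L \<le> m"
    by blast
  define \<rho> where "\<rho> = (max m 0 + 1) / 2"
  have \<rho>: "0 < \<rho>" "\<rho> < 1" "m < \<rho>"
    using m(1) by (auto simp: \<rho>_def max_def)
  have "\<exists>c\<in>L. norm (z - c) \<le> \<rho>" if z: "z \<in> V" "\<And>x. x \<in> tangency \<Longrightarrow> e \<le> norm (z - x)" for z
  proof -
    obtain l where l: "l \<in> L" "norm (z - l) \<le> h + 1"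
      using L_cobounded z(1) by blast
    have "e \<le> norm (z - l - x)" if "x \<in> tangency" for x
      using z(2)[OF tangency_add[OF that l(1)]] by (simp add: algebra_simps)
    moreover have "z - l \<in> V"
      using z(1) L_V[OF l(1)] by (rule subspace_diff[OF subspace_V])
    ultimately have "infdist (z - l) L < \<rho>"
      using m(2)[of "z - l"] l(2) \<rho>(3) by force
    then have "Inf ((\<lambda>a. dist (z - l) a) ` L) < \<rho>"
      using \<open>L \<noteq> {}\<close> by (simp add: infdist_def)
    then obtain c where "c \<in> L" "dist (z - l) c < \<rho>"
      using cInf_lessD[of "(\<lambda>a. dist (z - l) a) ` L" \<rho>] \<open>L \<noteq> {}\<close> by auto
    then show ?thesis
      using l(1) by (intro bexI[of _ "c + l"]) (auto simp: dist_norm L_add algebra_simps)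
  qed
  then show ?thesis
    using \<rho> by blast
qed

section \<open>Expansion along orbits in the strip\<close>

definition T :: "quat set"
  where "T = {x \<in> V. 0 \<le> inner x uh \<and> inner x uh \<le> h}"

text \<open>The lattice lies in layers at heights \<open>k * h\<close>. As \<open>h > 1\<close>,
  every layer other than the two base planes is more than 1 away from the strip.\<close>

lemma T_centre:
  assumes "z \<in> T" "c \<in> L" "norm (z - c) \<le> 1"
  shows "c \<in> centres"
proof -
  obtain k :: int where k: "inner c uh = of_int k * h" "c - of_int k *\<^sub>R \<tau> \<in> \<Lambda>"
    using L_layer[OF assms(2)] by blast
  have "\<bar>inner (z - c) uh\<bar> \<le> norm (z - c) * norm uh"
    by (rule Cauchy_Schwarz_ineq2)
  then have *: "\<bar>inner z uh - of_int k * h\<bar> \<le> 1"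
    using assms(3) k by (simp add: inner_simps)
  have z: "0 \<le> inner z uh" "inner z uh \<le> h"
    using assms(1) by (simp_all add: T_def)
  have "k = 0 \<or> k = 1"
  proof (rule ccontr)
    assume "\<not> (k = 0 \<or> k = 1)"
    then consider "of_int k \<le> (-1 :: real)" | "of_int k \<ge> (2 :: real)"
      by linarith
    then show False
    proof cases
      case 1
      then have "of_int k * h \<le> - 1 * h"
        using h_pos by (intro mult_right_mono) auto
      then show False
        using * z h_gt_1 unfolding abs_le_iff by linarith
    next
      case 2
      then have "2 * h \<le> of_int k * h"
        using h_pos by (intro mult_right_mono) auto
      then show False
        using * z h_gt_1 unfolding abs_le_iff by linarith
    qed
  qed
  then show ?thesis
  proof
    assume "k = 1"
    then have "c = \<tau> + (c - \<tau>)" "c - \<tau> \<in> \<Lambda>"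
      using k by auto
    then show ?thesis
      unfolding centres_def by blast
  qed (use k in \<open>simp add: centres_def\<close>)
qed

text \<open>
  The scalars are conformal factors: \<open>g\<close> multiplies the square of the distance of \<open>z\<close> and \<open>w\<close> by
  \<open>1 / (l * m)\<close>, where \<open>l\<close> and \<open>m\<close> are the factors at \<open>z\<close> and \<open>w\<close>.
\<close>
definition moves :: "(quat option \<Rightarrow> quat option) \<Rightarrow> (lorentz \<Rightarrow> lorentz) \<Rightarrow> quat \<Rightarrow> quat \<Rightarrow> real \<Rightarrow> bool"
  where "moves g \<Phi> z z' l \<longleftrightarrow> (g, \<Phi>) \<in> GP \<and> g (Some z) = Some z' \<and> \<Phi> (point_vec z) = l *\<^sub>R point_vec z' \<and> l > 0"

definition moves_inf :: "(quat option \<Rightarrow> quat option) \<Rightarrow> (lorentz \<Rightarrow> lorentz) \<Rightarrow> quat \<Rightarrow> real \<Rightarrow> bool"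
  where "moves_inf g \<Phi> w m \<longleftrightarrow> (g, \<Phi>) \<in> GP \<and> g None = Some w \<and> \<Phi> inf_vec = m *\<^sub>R point_vec w \<and> m > 0"

lemma moves_GP: "moves g \<Phi> z z' l \<Longrightarrow> (g, \<Phi>) \<in> GP"
  by (simp add: moves_def)

lemma movesI:
  assumes "(g, \<Phi>) \<in> GP" "g (Some z) = Some z'"
  shows "\<exists>l. moves g \<Phi> z z' l"
  using GP_ext_vec[OF assms(1), of "Some z"] assms by (auto simp: ext_vec_def moves_def)

lemma moves_infI:
  assumes "(g, \<Phi>) \<in> GP" "g None = Some w"
  shows "\<exists>l. moves_inf g \<Phi> w l"
  using GP_ext_vec[OF assms(1), of None] assms by (auto simp: ext_vec_def moves_inf_def)

lemma moves_comp:
  assumes "moves g \<Phi> z z' l" "moves f \<Psi> z' z'' m"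
  shows "moves (f \<circ> g) (\<Psi> \<circ> \<Phi>) z z'' (l * m)"
  using assms GP_comp[of f \<Psi> g \<Phi>] GP_linear(2)[of f \<Psi>] by (simp add: moves_def)

lemma moves_inf_comp:
  assumes "moves_inf g \<Phi> w l" "moves f \<Psi> w w' m"
  shows "moves_inf (f \<circ> g) (\<Psi> \<circ> \<Phi>) w' (l * m)"
  using assms GP_comp[of f \<Psi> g \<Phi>] GP_linear(2)[of f \<Psi>] by (simp add: moves_def moves_inf_def)

lemma moves_id: "moves id id z z 1"
  by (simp add: moves_def GP.one)

lemma moves_pair:
  assumes "moves g \<Phi> z z' l" "moves g \<Phi> w w' m"
  shows "l * m * nrm (z' - w') = nrm (z - w)"
proof -
  have "lprod (l *\<^sub>R point_vec z') (m *\<^sub>R point_vec w') = lprod (point_vec z) (point_vec w)"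
    using assms GP_linear(3)[of g \<Phi> "point_vec z" "point_vec w"] by (simp add: moves_def)
  then show ?thesis
    by (simp add: lprod_point_point mult_ac)
qed

lemma moves_inf_pair:
  assumes "moves g \<Phi> z z' l" "moves_inf g \<Phi> w m"
  shows "l * m * nrm (z' - w) = 1"
proof -
  have "lprod (l *\<^sub>R point_vec z') (m *\<^sub>R point_vec w) = lprod (point_vec z) inf_vec"
    using assms GP_linear(3)[of g \<Phi> "point_vec z" "inf_vec"] by (simp add: moves_def moves_inf_def)
  then show ?thesis
    by (simp add: lprod_point_point lprod_inf mult_ac)
qed

text \<open>If \<open>g\<close> fixed infinity, \<open>\<Phi>\<close> would fix
  \<open>inf_vec\<close> by \<open>GP_fix_inf\<close> and hence preserve the product with it, which
  forces \<open>l = 1\<close>.\<close>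

lemma moves_contracting_inf:
  assumes "moves g \<Phi> z z' l" "l < 1"
  shows "\<exists>w m. moves_inf g \<Phi> w m"
proof (cases "g None")
  case None
  then have "\<Phi> inf_vec = inf_vec"
    using GP_fix_inf[OF h_gt_1] assms(1) by (auto simp: moves_def)
  then have "lprod (l *\<^sub>R point_vec z') inf_vec = lprod (point_vec z) inf_vec"
    using assms GP_linear(3)[of g \<Phi> "point_vec z" "inf_vec"] by (simp add: moves_def)
  then show ?thesis
    using assms(2) by (simp add: lprod_inf)
next
  case (Some w)
  then show ?thesis
    using moves_infI assms(1) moves_GP by blast
qed

definition invpt :: "quat \<Rightarrow> quat \<Rightarrow> quat"
  where "invpt c z = c + (z - c) /\<^sub>R (norm (z - c))\<^sup>2"

lemma moves_inversion:
  assumes "c \<in> centres" "z \<noteq> c"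
  shows "moves (inversion c) (lrefl (ball_vec c)) z (invpt c z) (nrm (z - c))"
proof -
  have GP: "(inversion c, lrefl (ball_vec c)) \<in> GP"
    using GP.inversion[OF GP.one assms(1)] by (simp only: comp_id)
  have i: "inversion c (Some z) = Some (invpt c z)"
    using assms(2) by (simp add: inversion_def invpt_def)
  obtain l where l: "moves (inversion c) (lrefl (ball_vec c)) z (invpt c z) l"
    using movesI[OF GP i] by blast
  have "fst (lrefl (ball_vec c) (point_vec z)) = nrm (z - c)"
    by (simp add: fst_lrefl_ball lprod_point_ball field_simps)
  moreover have "fst (lrefl (ball_vec c) (point_vec z)) = l"
    using l by (simp add: moves_def)
  ultimately show ?thesis
    using l by simp
qed

text \<open>Regularity of the whole orbit, rather than of one point, ensures that the expansion step
  can be repeated indefinitely.\<close>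

definition regular :: "quat \<Rightarrow> bool"
  where "regular z \<longleftrightarrow> (\<forall>g \<Phi>. (g, \<Phi>) \<in> GP \<longrightarrow> (\<exists>z'. g (Some z) = Some z' \<and> z' \<in> T \<and> z' \<notin> tangency))"

lemma regular_self: "regular z \<Longrightarrow> z \<in> T \<and> z \<notin> tangency"
  unfolding regular_def using GP.one by fastforce

lemma regular_moves:
  assumes "regular z" "moves g \<Phi> z z' l"
  shows "regular z'"
  unfolding regular_def
proof (intro allI impI)
  fix f \<Psi> assume "(f, \<Psi>) \<in> GP"
  then have "(f \<circ> g, \<Psi> \<circ> \<Phi>) \<in> GP"
    by (rule GP_comp[OF _ moves_GP[OF assms(2)]])
  then show "\<exists>z''. f (Some z') = Some z'' \<and> z'' \<in> T \<and> z'' \<notin> tangency"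
    using assms unfolding regular_def moves_def by fastforce
qed

lemma regular_not_centre: "regular z \<Longrightarrow> c \<in> centres \<Longrightarrow> z \<noteq> c"
  unfolding regular_def using GP.inversion[OF GP.one] by (fastforce simp: inversion_def)

text \<open>Near \<open>x\<close> any centre \<open>c\<close> of a useful inversion satisfies
  \<open>norm (x - c) = 1\<close>, so \<open>x\<close> is fixed with conformal factor 1, and the
  distance to \<open>x\<close> is divided by \<open>norm (y - c) \<le> \<rho>\<close>.\<close>

lemma excursion_step:
  assumes e: "e > 0" "\<And>x c. x \<in> tangency \<Longrightarrow> c \<in> L \<Longrightarrow> norm (x - c) < 1 + e \<Longrightarrow> norm (x - c) = 1"
    and y: "regular y" and x: "x \<in> tangency" "norm (y - x) < e"
    and \<rho>: "0 < \<rho>" "\<rho> < 1" and c: "c \<in> L" "norm (y - c) \<le> \<rho>"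
  shows "\<exists>f \<Psi> y' l. moves f \<Psi> y y' l \<and> moves f \<Psi> x x 1 \<and> norm (y - x) / \<rho> \<le> norm (y' - x)"
proof -
  have cc: "c \<in> centres"
    using T_centre[OF _ c(1)] regular_self[OF y] c(2) \<rho> by force
  have yc: "y \<noteq> c"
    using regular_not_centre[OF y cc] .
  have "norm (x - c) \<le> norm (y - c) + norm (y - x)"
    using norm_triangle_ineq4[of "y - c" "y - x"] by (simp add: algebra_simps)
  then have xc: "norm (x - c) = 1"
    using e(2)[OF x(1) c(1)] x(2) c(2) \<rho> by linarith
  then have "x \<noteq> c" "nrm (x - c) = 1" "invpt c x = x"
    by (auto simp: nrm_eq_norm invpt_def)
  then have mx: "moves (inversion c) (lrefl (ball_vec c)) x x 1"
    using moves_inversion[OF cc] by metis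
  have my: "moves (inversion c) (lrefl (ball_vec c)) y (invpt c y) (nrm (y - c))"
    using moves_inversion[OF cc yc] .
  have "(norm (y - c) * norm (invpt c y - x))\<^sup>2 = (norm (y - x))\<^sup>2"
    using moves_pair[OF my mx] by (simp add: nrm_eq_norm power_mult_distrib)
  then have "norm (y - x) = norm (y - c) * norm (invpt c y - x)"
    by simp
  also have "\<dots> \<le> \<rho> * norm (invpt c y - x)"
    using c(2) by (intro mult_right_mono) auto
  finally have "norm (y - x) / \<rho> \<le> norm (invpt c y - x)"
    using \<rho>(1) by (simp add: field_simps)
  then show ?thesis
    using mx my by blast
qed

text \<open>
  Near a tangency point \<open>x\<close> all useful inversions fix \<open>x\<close> and do not decrease the distance
  to \<open>x\<close>, and away from \<open>x\<close> they increase it by a definite factor.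
\<close>
lemma excursion:
  assumes e: "e > 0" "\<And>x c. x \<in> tangency \<Longrightarrow> c \<in> L \<Longrightarrow> norm (x - c) < 1 + e \<Longrightarrow> norm (x - c) = 1"
      "\<And>x y. x \<in> tangency \<Longrightarrow> y \<in> tangency \<Longrightarrow> y \<noteq> x \<Longrightarrow> 2 * e \<le> norm (y - x)"
    and z: "regular z" and x: "x \<in> tangency" "norm (z - x) < e"
  shows "\<exists>f \<Psi> y l. moves f \<Psi> z y l \<and> moves f \<Psi> x x 1 \<and> e \<le> norm (y - x)"
proof -
  define r where "r = norm (z - x)"
  have r: "0 < r" "r < e"
    using regular_self[OF z] x by (auto simp: r_def)
  \<comment> \<open>This \<open>\<rho>\<close> depends on \<open>z\<close> through \<open>r\<close>;
    only the final distance \<open>e\<close> has to be uniform.\<close>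
  obtain \<rho> where \<rho>: "0 < \<rho>" "\<rho> < 1"
    "\<And>y. y \<in> V \<Longrightarrow> (\<And>x. x \<in> tangency \<Longrightarrow> r \<le> norm (y - x)) \<Longrightarrow> \<exists>c\<in>L. norm (y - c) \<le> \<rho>"
    using away_from_tangency[OF r(1)] by blast
  have step: "\<exists>f \<Psi> y l. moves f \<Psi> z y l \<and> moves f \<Psi> x x 1 \<and> (e \<le> norm (y - x) \<or> r / \<rho> ^ k \<le> norm (y - x))" for k
  proof (induction k)
    case 0
    show ?case
      using moves_id[of z] moves_id[of x] by (auto simp only: r_def power_0 div_by_1)
  next
    case (Suc k)
    then obtain f \<Psi> y l where IH: "moves f \<Psi> z y l" "moves f \<Psi> x x 1"
      "e \<le> norm (y - x) \<or> r / \<rho> ^ k \<le> norm (y - x)"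
      by blast
    show ?case
    proof (cases "e \<le> norm (y - x)")
      case False
      then have ge: "r / \<rho> ^ k \<le> norm (y - x)"
        using IH(3) by simp
      have y: "regular y"
        using regular_moves[OF z IH(1)] .
      have "\<rho> ^ k \<le> 1"
        using \<rho> by (intro power_le_one) auto
      then have "r \<le> r / \<rho> ^ k"
        using r \<rho> by (simp add: field_simps)
      then have r_le: "r \<le> norm (y - x)"
        using ge by simp
      \<comment> \<open>As tangency points are \<open>2 * e\<close> apart, those other than
        \<open>x\<close> are farther than \<open>e\<close> from \<open>y\<close>, so the bound
        \<open>\<rho>\<close> remains valid until the excursion ends.\<close>
      have "r \<le> norm (y - x')" if "x' \<in> tangency" for x'
      proof (cases "x' = x")
        case False
        have "2 * e \<le> norm (x' - x)"
          using e(3)[OF x(1) that False] .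
        also have "\<dots> \<le> norm (y - x') + norm (y - x)"
          using norm_triangle_ineq4[of "y - x" "y - x'"] by (simp add: algebra_simps norm_minus_commute)
        finally show ?thesis
          using \<open>\<not> e \<le> norm (y - x)\<close> r by linarith
      qed (use r_le in simp)
      moreover have "y \<in> V"
        using regular_self[OF y] by (simp add: T_def)
      ultimately obtain c where c: "c \<in> L" "norm (y - c) \<le> \<rho>"
        using \<rho>(3) by blast
      obtain f' \<Psi>' y' l' where f': "moves f' \<Psi>' y y' l'" "moves f' \<Psi>' x x 1" "norm (y - x) / \<rho> \<le> norm (y' - x)"
        using excursion_step[OF e(1,2) y x(1) _ \<rho>(1,2) c] False by (meson not_le)
      have "r / \<rho> ^ Suc k \<le> norm (y - x) / \<rho>"
        using ge \<rho> by (simp add: field_simps)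
      then have "r / \<rho> ^ Suc k \<le> norm (y' - x)"
        using f'(3) by linarith
      moreover have "moves (f' \<circ> f) (\<Psi>' \<circ> \<Psi>) x x 1"
        using moves_comp[OF IH(2) f'(2)] by simp
      ultimately show ?thesis
        using moves_comp[OF IH(1) f'(1)] by blast
    qed (use IH in blast)
  qed
  obtain k where k: "\<rho> ^ k < r / e"
    using real_arch_pow_inv[of "r / e" \<rho>] r \<rho> by (metis divide_pos_pos less_trans)
  then have "e < r / \<rho> ^ k"
    using r \<rho> by (simp add: field_simps)
  then show ?thesis
    using step[of k] by (meson less_imp_le order_trans)
qed

text \<open>Far from tangency points a single inversion contracts the conformal factor; near one, a
  whole excursion counts as one step. The clause on \<open>w\<close> will be applied to the image of
  infinity: as long as it is closer than \<open>\<delta>\<close> to the moving point, its distance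
  grows by the factor \<open>K\<close> or jumps beyond \<open>\<delta>\<close>.\<close>

lemma expansion:
  "\<exists>\<delta>>0. \<exists>\<kappa>. 0 < \<kappa> \<and> \<kappa> < 1 \<and> (\<exists>K>1. \<forall>z. regular z \<longrightarrow>
    (\<exists>f \<Psi> y l. moves f \<Psi> z y l \<and> l \<le> \<kappa> \<and>
      (\<forall>w. 0 < norm (z - w) \<longrightarrow> norm (z - w) < \<delta> \<longrightarrow> f (Some w) \<noteq> None \<longrightarrow>
        (\<exists>w' m. moves f \<Psi> w w' m \<and> (\<delta> \<le> norm (y - w') \<or> K * norm (z - w) \<le> norm (y - w'))))))"
proof -
  obtain e where e: "e > 0" "\<And>x c. x \<in> tangency \<Longrightarrow> c \<in> L \<Longrightarrow> norm (x - c) < 1 + e \<Longrightarrow> norm (x - c) = 1"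
      "\<And>x y. x \<in> tangency \<Longrightarrow> y \<in> tangency \<Longrightarrow> y \<noteq> x \<Longrightarrow> 2 * e \<le> norm (y - x)"
    using tangency_uniform by blast
  obtain \<rho> where \<rho>: "0 < \<rho>" "\<rho> < 1"
    "\<And>y. y \<in> V \<Longrightarrow> (\<And>x. x \<in> tangency \<Longrightarrow> e / 3 \<le> norm (y - x)) \<Longrightarrow> \<exists>c\<in>L. norm (y - c) \<le> \<rho>"
    using away_from_tangency[of "e / 3"] e(1) by (metis divide_pos_pos zero_less_numeral)
  have \<rho>2: "\<rho>\<^sup>2 < 1"
    using \<rho> by (simp add: power_less_one_iff)
  \<comment> \<open>The second bound gives \<open>\<rho> * (\<rho> + \<delta>) \<le> q\<close>, so a
    single inversion also expands distances from \<open>z\<close> to points within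
    \<open>\<delta>\<close>. The first keeps the image of such a point at least \<open>e / 2\<close>
    away from \<open>x\<close> after an excursion, unless it is already \<open>\<delta>\<close> away
    from \<open>y\<close>.\<close>
  define \<delta> where "\<delta> = min (e / 2) ((1 - \<rho>\<^sup>2) / 2)"
  have \<delta>: "\<delta> > 0" "\<delta> \<le> e / 2" "\<delta> \<le> (1 - \<rho>\<^sup>2) / 2"
  proof -
    show "\<delta> > 0"
      using e(1) \<rho>2 by (simp add: \<delta>_def)
    show "\<delta> \<le> e / 2" "\<delta> \<le> (1 - \<rho>\<^sup>2) / 2"
      unfolding \<delta>_def by (rule min.cobounded1, rule min.cobounded2)
  qed
  define q where "q = (1 + \<rho>\<^sup>2) / 2"
  have q: "0 < q" "q < 1"
    using \<rho>2 \<rho>(1) by (auto simp: q_def add_pos_pos)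
  define K where "K = min 2 (1 / q)"
  have K: "K > 1" "K \<le> 2" "K \<le> 1 / q"
    using q by (auto simp: K_def)
  \<comment> \<open>The constant \<open>1/9\<close> stems from excursions: the distance to
    \<open>x\<close> grows from less than \<open>e / 3\<close> to at least \<open>e\<close>, and the
    conformal factor is the inverse square of this growth.\<close>
  define \<kappa> where "\<kappa> = max (\<rho>\<^sup>2) (1/9)"
  have \<kappa>: "0 < \<kappa>" "\<kappa> < 1" "\<rho>\<^sup>2 \<le> \<kappa>" "1/9 \<le> \<kappa>"
    using \<rho>2 by (auto simp: \<kappa>_def)
  have "\<exists>f \<Psi> y l. moves f \<Psi> z y l \<and> l \<le> \<kappa> \<and>
      (\<forall>w. 0 < norm (z - w) \<longrightarrow> norm (z - w) < \<delta> \<longrightarrow> f (Some w) \<noteq> None \<longrightarrow>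
        (\<exists>w' m. moves f \<Psi> w w' m \<and> (\<delta> \<le> norm (y - w') \<or> K * norm (z - w) \<le> norm (y - w'))))"
    if z: "regular z" for z
  proof (cases "\<forall>x\<in>tangency. e / 3 \<le> norm (z - x)")
    case True
    have "z \<in> V"
      using regular_self[OF z] by (simp add: T_def)
    then obtain c where c: "c \<in> L" "norm (z - c) \<le> \<rho>"
      using \<rho>(3) True by blast
    have cc: "c \<in> centres"
      using T_centre[OF _ c(1)] regular_self[OF z] c(2) \<rho> by force
    have mz: "moves (inversion c) (lrefl (ball_vec c)) z (invpt c z) (nrm (z - c))"
      using moves_inversion[OF cc regular_not_centre[OF z cc]] .
    have zc: "norm (z - c) > 0"
      using regular_not_centre[OF z cc] by simp
    have "nrm (z - c) \<le> \<kappa>"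
      using power_mono[OF c(2), of 2] \<kappa>(3) by (simp add: nrm_eq_norm)
    moreover have "\<exists>w' m. moves (inversion c) (lrefl (ball_vec c)) w w' m \<and>
        (\<delta> \<le> norm (invpt c z - w') \<or> K * norm (z - w) \<le> norm (invpt c z - w'))"
      if w: "0 < norm (z - w)" "norm (z - w) < \<delta>" "inversion c (Some w) \<noteq> None" for w
    proof -
      have "w \<noteq> c"
        using w(3) by (auto simp: inversion_def)
      then have mw: "moves (inversion c) (lrefl (ball_vec c)) w (invpt c w) (nrm (w - c))"
        using moves_inversion[OF cc] by blast
      have wc: "norm (w - c) > 0"
        using \<open>w \<noteq> c\<close> by simp
      have "norm (w - c) \<le> norm (z - c) + norm (z - w)"
        using norm_triangle_ineq4[of "z - c" "z - w"] by (simp add: algebra_simps)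
      then have "norm (w - c) \<le> \<rho> + \<delta>"
        using c(2) w(2) by linarith
      then have "norm (z - c) * norm (w - c) \<le> \<rho> * (\<rho> + \<delta>)"
        using c(2) \<rho>(1) by (intro mult_mono) auto
      also have "\<dots> \<le> \<rho>\<^sup>2 + \<delta>"
        using \<rho> \<delta>(1) by (simp add: power2_eq_square algebra_simps mult_left_le)
      also have "\<dots> \<le> q"
        using \<delta>(3) by (simp add: q_def field_simps)
      finally have le_q: "norm (z - c) * norm (w - c) \<le> q" .
      have "(norm (z - c) * norm (w - c) * norm (invpt c z - invpt c w))\<^sup>2 = (norm (z - w))\<^sup>2"
        using moves_pair[OF mz mw] by (simp add: nrm_eq_norm power_mult_distrib)
      then have "norm (z - w) = norm (z - c) * norm (w - c) * norm (invpt c z - invpt c w)"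
        by simp
      also have "\<dots> \<le> q * norm (invpt c z - invpt c w)"
        using le_q by (intro mult_right_mono) auto
      finally have "1 / q * norm (z - w) \<le> norm (invpt c z - invpt c w)"
        using q by (simp add: field_simps)
      moreover have "K * norm (z - w) \<le> 1 / q * norm (z - w)"
        using K by (intro mult_right_mono) auto
      ultimately show ?thesis
        using mw by (meson order_trans)
    qed
    ultimately show ?thesis
      using mz by blast
  next
    case False
    then obtain x where x: "x \<in> tangency" "norm (z - x) < e / 3"
      by (auto simp: not_le)
    then have "norm (z - x) < e"
      using e(1) by simp
    then obtain f \<Psi> y l where f: "moves f \<Psi> z y l" "moves f \<Psi> x x 1" "e \<le> norm (y - x)"
      using excursion[OF e z x(1)] by blast
    have zx: "norm (z - x) > 0"
      using regular_self[OF z] x by auto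
    have yx: "norm (y - x) > 0"
      using f(3) e(1) by linarith
    have l: "l * nrm (y - x) = nrm (z - x)" "l > 0"
      using moves_pair[OF f(1,2)] f(1) by (simp_all add: moves_def)
    have "l \<le> \<kappa>"
    proof -
      have "l * e\<^sup>2 \<le> l * (norm (y - x))\<^sup>2"
        using f(3) e(1) l(2) by (intro mult_left_mono power_mono) auto
      also have "\<dots> = (norm (z - x))\<^sup>2"
        using l(1) by (simp add: nrm_eq_norm)
      also have "\<dots> \<le> (e / 3)\<^sup>2"
        using x(2) by (intro power_mono) auto
      finally have "l * e\<^sup>2 \<le> 1/9 * e\<^sup>2"
        by (simp add: power2_eq_square)
      then show ?thesis
        using e(1) \<kappa>(4) by simp
    qed
    moreover have "\<exists>w' m. moves f \<Psi> w w' m \<and> (\<delta> \<le> norm (y - w') \<or> K * norm (z - w) \<le> norm (y - w'))"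
      if w: "0 < norm (z - w)" "norm (z - w) < \<delta>" "f (Some w) \<noteq> None" for w
    proof -
      obtain w' m where m: "moves f \<Psi> w w' m"
        using movesI[OF moves_GP[OF f(1)]] w(3) by blast
      show ?thesis
      proof (cases "\<delta> \<le> norm (y - w')")
        case False
        define D D' where "D = norm (z - w)" and "D' = norm (y - w')"
        have D': "D' < \<delta>"
          using False by (simp add: D'_def)
        have "norm (y - x) \<le> norm (w' - x) + D'"
          using norm_triangle_ineq[of "w' - x" "y - w'"] by (simp add: D'_def)
        then have w'x: "e / 2 \<le> norm (w' - x)"
          using f(3) D' \<delta>(2) by linarith
        have mw: "m * nrm (w' - x) = nrm (w - x)" "m > 0"
          using moves_pair[OF m f(2)] m by (simp_all add: moves_def)
        have "l * m * nrm (y - w') = nrm (z - w)"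
          using moves_pair[OF f(1) m] .
        \<comment> \<open>Comparison with the fixed point \<open>x\<close> in
          \<open>moves_pair\<close> eliminates both conformal factors.\<close>
        then have "nrm (z - x) * nrm (w - x) * nrm (y - w') = nrm (z - w) * nrm (y - x) * nrm (w' - x)"
          by (simp flip: l(1) mw(1) add: mult_ac) 
        then have "(norm (z - x) * norm (w - x) * D')\<^sup>2 = (D * norm (y - x) * norm (w' - x))\<^sup>2"
          by (simp add: nrm_eq_norm power_mult_distrib D_def D'_def)
        then have eq: "norm (z - x) * norm (w - x) * D' = D * norm (y - x) * norm (w' - x)"
          by (simp add: D_def D'_def)
        have "D * e * (e / 2) \<le> D * norm (y - x) * norm (w' - x)"
          using f(3) w'x e(1) by (intro mult_mono) (auto simp: D_def)
        then have ge: "D * e\<^sup>2 / 2 \<le> norm (z - x) * norm (w - x) * D'"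
          using eq by (simp add: power2_eq_square)
        have wx: "norm (w - x) \<le> norm (z - x) + D"
          using norm_triangle_ineq4[of "z - x" "z - w"] by (simp add: D_def)
        have D'0: "D' \<ge> 0" and D0: "D > 0"
          using w(1) by (simp_all add: D'_def D_def)
        have "2 * D \<le> D'"
        proof (cases "D \<le> norm (z - x)")
          case True
          have "norm (z - x) * norm (w - x) \<le> (e / 3) * (2 * e / 3)"
            using wx True x(2) e(1) by (intro mult_mono) auto
          then have "norm (z - x) * norm (w - x) * D' \<le> (e / 3) * (2 * e / 3) * D'"
            using D'0 by (intro mult_right_mono)
          then have "D * e\<^sup>2 / 2 \<le> 2 * e\<^sup>2 / 9 * D'"
            using ge by (simp add: power2_eq_square)
          then have "e\<^sup>2 * (9 * D) \<le> e\<^sup>2 * (4 * D')"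
            by (simp add: algebra_simps)
          then have "9 * D \<le> 4 * D'"
            using e(1) by simp
          then show ?thesis
            using D0 by linarith
        next
          \<comment> \<open>The estimate forces \<open>D' \<ge> 3 * e / 4\<close>, contrary to
            \<open>D' < \<delta> \<le> e / 2\<close>, so this case is void.\<close>
          case False
          have "norm (z - x) * norm (w - x) \<le> (e / 3) * (2 * D)"
            using wx False x(2) e(1) by (intro mult_mono) auto
          then have "norm (z - x) * norm (w - x) * D' \<le> (e / 3) * (2 * D) * D'"
            using D'0 by (intro mult_right_mono)
          then have "(e * D) * (e / 2) \<le> (e * D) * (2 / 3 * D')"
            using ge by (simp add: power2_eq_square algebra_simps)
          then have "e / 2 \<le> 2 / 3 * D'"
            using e(1) D0 by (simp add: mult_le_cancel_left)
          then show ?thesis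
            using D' \<delta>(2) D'0 by linarith
        qed
        then have "K * D \<le> D'"
          using mult_right_mono[OF K(2), of D] D0 by linarith
        then show ?thesis
          using m by (auto simp: D_def D'_def)
      qed (use m in blast)
    qed
    ultimately show ?thesis
      using f(1) by blast
  qed
  then show ?thesis
    using \<delta>(1) \<kappa>(1,2) K(1) by blast
qed

text \<open>Repeated expansion first makes the conformal factor small. Continuing, it drives the
  images of \<open>z\<close> and of infinity apart at least geometrically until they are
  \<open>\<delta>\<close> apart, while the factor never grows again.\<close>

lemma deep_separated_orbit:
  "\<exists>\<delta>>0. \<forall>z \<epsilon>. regular z \<longrightarrow> 0 < \<epsilon> \<longrightarrow>
    (\<exists>g \<Phi> z' w l m. moves g \<Phi> z z' l \<and> moves_inf g \<Phi> w m \<and> l \<le> \<epsilon> \<and> \<delta> \<le> norm (z' - w))"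
proof -
  obtain \<delta> \<kappa> K where c: "\<delta> > 0" "0 < \<kappa>" "\<kappa> < 1" "K > (1::real)" and
    expand: "\<And>z. regular z \<Longrightarrow> \<exists>f \<Psi> y l. moves f \<Psi> z y l \<and> l \<le> \<kappa> \<and>
      (\<forall>w. 0 < norm (z - w) \<longrightarrow> norm (z - w) < \<delta> \<longrightarrow> f (Some w) \<noteq> None \<longrightarrow>
        (\<exists>w' m. moves f \<Psi> w w' m \<and> (\<delta> \<le> norm (y - w') \<or> K * norm (z - w) \<le> norm (y - w'))))"
    using expansion by blast
  have "\<exists>g \<Phi> z' w l m. moves g \<Phi> z z' l \<and> moves_inf g \<Phi> w m \<and> l \<le> \<epsilon> \<and> \<delta> \<le> norm (z' - w)"
    if z: "regular z" and \<epsilon>: "0 < \<epsilon>" for z \<epsilon>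
  proof -
    have deep: "\<exists>g \<Phi> z' l. moves g \<Phi> z z' l \<and> l \<le> \<kappa> ^ k" for k
    proof (induction k)
      case 0
      then show ?case using moves_id[of z] by (auto intro: exI[of _ 1])
    next
      case (Suc k)
      then obtain g \<Phi> z' l where g: "moves g \<Phi> z z' l" "l \<le> \<kappa> ^ k"
        by blast
      obtain f \<Psi> y l' where f: "moves f \<Psi> z' y l'" "l' \<le> \<kappa>"
        using expand[OF regular_moves[OF z g(1)]] by blast
      have "l * l' \<le> \<kappa> ^ k * \<kappa>"
        using f g c by (intro mult_mono) (auto simp: moves_def)
      then show ?case
        using moves_comp[OF g(1) f(1)] by (auto simp: mult.commute)
    qed
    \<comment> \<open>The bound \<open>1/2\<close> keeps the factor below 1, so that infinity is
      sent to a finite point by \<open>moves_contracting_inf\<close>.\<close>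
    obtain k where k: "\<kappa> ^ k < min \<epsilon> (1/2)"
      using real_arch_pow_inv[of "min \<epsilon> (1/2)" \<kappa>] \<epsilon> c(3) by auto
    obtain g0 \<Phi>0 z0 l0 where g0: "moves g0 \<Phi>0 z z0 l0" "l0 \<le> \<kappa> ^ k"
      using deep by blast
    then have l0: "l0 \<le> min \<epsilon> (1/2)"
      using k by linarith
    obtain w0 m0 where w0: "moves_inf g0 \<Phi>0 w0 m0"
      using moves_contracting_inf[OF g0(1)] l0 by fastforce
    have "z0 \<noteq> w0"
      using moves_inf_pair[OF g0(1) w0] by auto
    then have D0: "norm (z0 - w0) > 0"
      by simp
    have "\<exists>g \<Phi> z' w l m. moves g \<Phi> z z' l \<and> moves_inf g \<Phi> w m \<and> l \<le> min \<epsilon> (1/2) \<and>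
        (\<delta> \<le> norm (z' - w) \<or> K ^ j * norm (z0 - w0) \<le> norm (z' - w))" for j
    proof (induction j)
      case 0
      have "K ^ 0 * norm (z0 - w0) \<le> norm (z0 - w0)"
        by simp
      then show ?case
        using g0(1) w0 l0 by blast
    next
      case (Suc j)
      then obtain g \<Phi> z' w l m where g: "moves g \<Phi> z z' l" "moves_inf g \<Phi> w m" "l \<le> min \<epsilon> (1/2)"
        "\<delta> \<le> norm (z' - w) \<or> K ^ j * norm (z0 - w0) \<le> norm (z' - w)"
        by blast
      show ?case
      proof (cases "\<delta> \<le> norm (z' - w)")
        case False
        then have ge: "K ^ j * norm (z0 - w0) \<le> norm (z' - w)"
          using g(4) by simp
        obtain f \<Psi> y l' where f: "moves f \<Psi> z' y l'" "l' \<le> \<kappa>"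
          "\<And>w. 0 < norm (z' - w) \<Longrightarrow> norm (z' - w) < \<delta> \<Longrightarrow> f (Some w) \<noteq> None \<Longrightarrow>
            \<exists>w' m. moves f \<Psi> w w' m \<and> (\<delta> \<le> norm (y - w') \<or> K * norm (z' - w) \<le> norm (y - w'))"
          using expand[OF regular_moves[OF z g(1)]] by blast
        have m: "moves (f \<circ> g) (\<Psi> \<circ> \<Phi>) z y (l * l')"
          using moves_comp[OF g(1) f(1)] .
        have l: "l > 0" "l' > 0" "l' \<le> 1"
          using g(1) f c by (auto simp: moves_def)
        have "l * l' \<le> l"
          using l by (simp add: mult_left_le)
        then have ll: "l * l' \<le> min \<epsilon> (1/2)"
          using g(3) by linarith
        \<comment> \<open>The composite still contracts at \<open>z\<close>, hence it cannot fix
          infinity.\<close>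
        have "f (Some w) \<noteq> None"
        proof
          assume "f (Some w) = None"
          then have "(f \<circ> g) None = None"
            using g(2) by (simp add: moves_inf_def)
          moreover obtain v n where "moves_inf (f \<circ> g) (\<Psi> \<circ> \<Phi>) v n"
            using moves_contracting_inf[OF m] ll by auto
          ultimately show False
            by (simp add: moves_inf_def)
        qed
        moreover have "z' \<noteq> w"
          using moves_inf_pair[OF g(1,2)] by auto
        ultimately obtain w' m' where w': "moves f \<Psi> w w' m'"
          "\<delta> \<le> norm (y - w') \<or> K * norm (z' - w) \<le> norm (y - w')"
          using f(3)[of w] False by auto
        have "K ^ Suc j * norm (z0 - w0) \<le> K * norm (z' - w)"
          using ge c(4) by (simp add: mult.assoc)
        then have "\<delta> \<le> norm (y - w') \<or> K ^ Suc j * norm (z0 - w0) \<le> norm (y - w')"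
          using w'(2) by linarith
        then show ?thesis
          using m ll moves_inf_comp[OF g(2) w'(1)] by blast
      qed (use g in blast)
    qed
    moreover obtain j where "\<delta> / norm (z0 - w0) < K ^ j"
      using real_arch_pow[OF c(4)] by blast
    then have "\<delta> < K ^ j * norm (z0 - w0)"
      using D0 by (simp add: field_simps)
    ultimately show ?thesis
      by (meson less_imp_le min.boundedE order_trans)
  qed
  then show ?thesis
    using c(1) by blast
qed

end

section \<open>The sphere arrangement\<close>

context strip
begin

text \<open>The vector \<open>E\<close> acts as an oriented sphere or plane: the sign of the product
  with null vectors separates the surface, its interior and its exterior, including the point at
  infinity.\<close>

definition osph :: "lorentz \<Rightarrow> osphere"
  where "osph E = ({p \<in> ext_V. lprod (ext_vec p) E = 0}, {p \<in> ext_V. lprod (ext_vec p) E > 0})"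

lemma None_ext_V [simp]: "None \<in> ext_V"
  by (simp add: ext_V_def)

lemma ext_vec_simps [simp]: "ext_vec None = inf_vec" "ext_vec (Some z) = point_vec z"
  by (simp_all add: ext_vec_def)

lemma Some_ext_V [simp]: "Some x \<in> ext_V \<longleftrightarrow> x \<in> V"
  by (auto simp: ext_V_def)

lemma extended_space_eq: "extended_space n R = ext_V"
  by (simp add: extended_space_def ext_V_def real_plus_part_eq)

lemma osph_wall_0: "oriented_hyperplane n R u = osph wall_0"
proof -
  have "p \<in> insert None (Some ` hyperplane n R u) \<longleftrightarrow> p \<in> ext_V \<and> lprod (ext_vec p) wall_0 = 0" for p
    by (cases p) (auto simp: hyperplane_eq lprod_wall_point)
  moreover have "p \<in> Some ` {x \<in> real_plus_part n R. inner x u > 0} \<longleftrightarrow> p \<in> ext_V \<and> lprod (ext_vec p) wall_0 > 0" for p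
    by (cases p) (auto simp: real_plus_part_eq lprod_wall_point inner_uh_sign)
  ultimately show ?thesis
    unfolding oriented_hyperplane_def osph_def by auto
qed

lemma transl_image: "p \<in> transl w ` A \<longleftrightarrow> transl (- w) p \<in> A"
proof
  assume "p \<in> transl w ` A"
  then show "transl (- w) p \<in> A"
    by (auto simp: transl_transl)
next
  assume "transl (- w) p \<in> A"
  then have "transl w (transl (- w) p) \<in> transl w ` A"
    by (rule imageI)
  then show "p \<in> transl w ` A"
    by (simp add: transl_transl)
qed

lemma osph_wall_1: "act (transl \<tau>) (reverse n R (oriented_hyperplane n R u)) = osph wall_1"
proof -
  have V: "x - \<tau> \<in> V \<longleftrightarrow> x \<in> V" for x
    using subspace_add[OF subspace_V, of "x - \<tau>" \<tau>] subspace_diff[OF subspace_V, of x \<tau>] L_V[OF tau_L] by auto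
  have "transl (- \<tau>) p \<in> fst (osph wall_0) \<longleftrightarrow> p \<in> fst (osph wall_1)" for p
    by (cases p) (auto simp: osph_def transl_def lprod_wall_point V inner_simps h_def)
  moreover have "transl (- \<tau>) p \<in> ext_V - (fst (osph wall_0) \<union> snd (osph wall_0)) \<longleftrightarrow> p \<in> snd (osph wall_1)" for p
    by (cases p) (auto simp: osph_def transl_def lprod_wall_point V inner_simps h_def)
  ultimately show ?thesis
    unfolding act_def reverse_def extended_space_eq osph_wall_0 prod_eq_iff fst_conv snd_conv set_eq_iff
      transl_image by simp
qed

text \<open>The lift preserves Lorentz products and matches null vectors up to positive factors, so
  it preserves all signs.\<close>

lemma act_osph:
  assumes "(g, \<Phi>) \<in> GP"
  shows "act g (osph E) = osph (\<Phi> E)"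
proof -
  obtain g' \<Phi>' where g': "(g', \<Phi>') \<in> GP" "\<And>p. g' (g p) = p" "\<And>p. g (g' p) = p"
    using GP_inverse[OF assms] by blast
  have sgn: "lprod (ext_vec (g p)) (\<Phi> E) = 0 \<longleftrightarrow> lprod (ext_vec p) E = 0"
    "lprod (ext_vec (g p)) (\<Phi> E) > 0 \<longleftrightarrow> lprod (ext_vec p) E > 0" for p
  proof -
    obtain l where l: "l > 0" "\<Phi> (ext_vec p) = l *\<^sub>R ext_vec (g p)"
      using GP_ext_vec[OF assms] by blast
    have "l * lprod (ext_vec (g p)) (\<Phi> E) = lprod (ext_vec p) E"
      using GP_linear(3)[OF assms, of "ext_vec p" E] l(2) by simp
    then show "lprod (ext_vec (g p)) (\<Phi> E) = 0 \<longleftrightarrow> lprod (ext_vec p) E = 0"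
      "lprod (ext_vec (g p)) (\<Phi> E) > 0 \<longleftrightarrow> lprod (ext_vec p) E > 0"
      using l(1) by (metis mult_eq_0_iff less_irrefl) (metis l(1) zero_less_mult_pos mult_pos_pos \<open>l * lprod (ext_vec (g p)) (\<Phi> E) = lprod (ext_vec p) E\<close>)
  qed
  have V: "g p \<in> ext_V \<longleftrightarrow> p \<in> ext_V" for p
    using GP_ext_V[OF assms] GP_ext_V[OF g'(1)] g'(2) by metis
  have im: "p \<in> g ` A \<longleftrightarrow> g' p \<in> A" for p A
    using g' by (metis image_iff)
  show ?thesis
    unfolding act_def prod_eq_iff set_eq_iff im fst_conv snd_conv osph_def mem_Collect_eq
    using sgn[of "g' _"] V[of "g' _"] by (simp add: g'(3))
qed

lemma base_spheres_eq: "base_spheres n R u \<tau> = {osph wall_0, osph wall_1}"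
  by (simp add: base_spheres_def osph_wall_1) (simp add: osph_wall_0)

lemma arrangement_iff:
  "S \<in> arrangement n R u \<tau> \<longleftrightarrow> (\<exists>g \<Phi> E. (g, \<Phi>) \<in> GP \<and> E \<in> {wall_0, wall_1} \<and> S = osph (\<Phi> E))"
proof
  assume "S \<in> arrangement n R u \<tau>"
  then obtain g B where S: "S = act g B" "g \<in> Gamma_u n R u \<tau>" "B \<in> base_spheres n R u \<tau>"
    unfolding arrangement_def by blast
  obtain \<Phi> where \<Phi>: "(g, \<Phi>) \<in> GP"
    using S(2) unfolding Gamma_u_iff by blast
  obtain E where "E \<in> {wall_0, wall_1}" "B = osph E"
    using S(3) unfolding base_spheres_eq by blast
  then show "\<exists>g \<Phi> E. (g, \<Phi>) \<in> GP \<and> E \<in> {wall_0, wall_1} \<and> S = osph (\<Phi> E)"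
    using \<Phi> S(1) act_osph[OF \<Phi>] by blast
next
  assume "\<exists>g \<Phi> E. (g, \<Phi>) \<in> GP \<and> E \<in> {wall_0, wall_1} \<and> S = osph (\<Phi> E)"
  then obtain g \<Phi> E where E: "(g, \<Phi>) \<in> GP" "E \<in> {wall_0, wall_1}" "S = osph (\<Phi> E)"
    by blast
  have "g \<in> Gamma_u n R u \<tau>"
    using E(1) unfolding Gamma_u_iff by blast
  moreover have "osph E \<in> base_spheres n R u \<tau>"
    using E(2) unfolding base_spheres_eq by blast
  moreover have "S = act g (osph E)"
    using E(3) act_osph[OF E(1)] by simp
  ultimately show "S \<in> arrangement n R u \<tau>"
    unfolding arrangement_def by blast
qed

lemma arrangementI: "(g, \<Phi>) \<in> GP \<Longrightarrow> E = wall_0 \<or> E = wall_1 \<Longrightarrow> osph (\<Phi> E) \<in> arrangement n R u \<tau>"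
  unfolding arrangement_iff insert_iff by blast

lemma None_fst_osph: "None \<in> fst (osph E) \<longleftrightarrow> lprod inf_vec E = 0"
  by (simp add: osph_def)

lemma base_planes: "S \<in> base_spheres n R u \<tau> \<Longrightarrow> None \<in> fst S"
  by (auto simp: base_spheres_eq None_fst_osph)

lemma Int_region_osph:
  "Int_region n R (osph E) =
    (if lprod inf_vec E > 0 then {x \<in> V. lprod (point_vec x) E < 0} else {x \<in> V. lprod (point_vec x) E > 0})"
  by (auto simp: Int_region_def reverse_def extended_space_eq real_plus_part_eq osph_def)

lemma lrefl_ball_V: "c \<in> V \<Longrightarrow> fst (snd x) \<in> V \<Longrightarrow> fst (snd (lrefl (ball_vec c) x)) \<in> V"
  using subspace_V by (simp add: lrefl_def ball_vec_def subspace_diff subspace_scale)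

lemma GP_V:
  assumes "(g, \<Phi>) \<in> GP" "fst (snd x) \<in> V"
  shows "fst (snd (\<Phi> x)) \<in> V"
  using assms
proof (induction g \<Phi> rule: GP.induct)
  case (translation g \<Phi> w)
  then show ?case
    using subspace_V L_V[OF \<Lambda>_L] by (simp add: lshift_def subspace_add subspace_scale)
next
  case (inversion g \<Phi> c)
  then show ?case
    using lrefl_ball_V[OF L_V[OF centres_L]] by simp
qed simp

lemma wall_V: "E = wall_0 \<or> E = wall_1 \<Longrightarrow> fst (snd E) \<in> V"
  using uh_V subspace_neg[OF subspace_V] by (auto simp: wall_0_def wall_1_def)

lemma plane_Int_region:
  assumes "S \<in> arrangement n R u \<tau>" "None \<in> fst S"
  shows "\<exists>b\<in>V. \<exists>C. b \<noteq> 0 \<and> Int_region n R S = {x \<in> V. inner x b > C}"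
proof -
  obtain g \<Phi> E where E: "(g, \<Phi>) \<in> GP" "E = wall_0 \<or> E = wall_1" "S = osph (\<Phi> E)"
    using assms(1) unfolding arrangement_iff insert_iff empty_iff by blast
  obtain A b C where F: "\<Phi> E = (A, b, C)"
    by (metis prod_cases3)
  have "A = 0"
    using assms(2) unfolding E(3) None_fst_osph F by (simp add: lprod_inf)
  moreover have "lprod (\<Phi> E) (\<Phi> E) = 1"
    using GP_linear(3)[OF E(1), of E E] E(2) by auto
  ultimately have "b \<noteq> 0"
    unfolding F by (auto simp: lprod_def)
  moreover have "b \<in> V"
    using GP_V[OF E(1) wall_V[OF E(2)]] by (simp add: F)
  moreover have "Int_region n R S = {x \<in> V. inner x b > C / 2}"
  proof -
    have "lprod inf_vec (A, b, C) = 0"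
      by (simp add: lprod_inf \<open>A = 0\<close>)
    moreover have "lprod (point_vec x) (A, b, C) > 0 \<longleftrightarrow> inner x b > C / 2" for x
      by (simp add: lprod_def point_vec_def \<open>A = 0\<close>)
    ultimately show ?thesis
      unfolding E(3) Int_region_osph F by simp
  qed
  ultimately show ?thesis
    by blast
qed

text \<open>
  If \<open>h \<le> 1\<close>, covering yields a lattice vector \<open>a\<close> of norm 1 between the two base hyperplanes.
  The group then contains the reflection exchanging \<open>0\<close> and \<open>a\<close>, which moves the base
  hyperplanes unless \<open>a\<close> is a multiple of \<open>u\<close>.
\<close>
lemma thin_strip_plane:
  assumes "h \<le> 1"
  shows "\<exists>S \<in> arrangement n R u \<tau> - base_spheres n R u \<tau>. None \<in> fst S"
proof -
  have "\<tau> - h *\<^sub>R uh \<in> V" "inner (\<tau> - h *\<^sub>R uh) uh = 0"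
    using L_V[OF tau_L] uh_V subspace_V by (auto simp: inner_simps h_def intro: subspace_diff subspace_scale)
  then obtain c where c: "c \<in> \<Lambda>" "norm (\<tau> - h *\<^sub>R uh - c) < 1"
    using hyperplane_covered by blast
  \<comment> \<open>By Pythagoras the squared norm of \<open>a\<close> is \<open>h\<^sup>2\<close>
    plus the squared distance of \<open>c\<close> from the projection of \<open>\<tau>\<close>,
    hence less than 2; a positive integer below 2 is 1.\<close>
  define a where "a = \<tau> - c"
  have ah: "inner a uh = h"
    using \<Lambda>_inner[OF c(1)] by (simp add: a_def inner_simps h_def)
  have aL: "a \<in> L"
    using \<Lambda>_L[OF c(1)] tau_L by (simp add: a_def L_diff)
  have aC: "a \<in> centres"
    using \<Lambda>_minus[OF c(1)] by (auto simp: centres_def a_def image_iff intro!: bexI[of _ "- c"])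
  have "nrm (a - h *\<^sub>R uh) = nrm a - h\<^sup>2"
    by (simp add: nrm_diff nrm_scaleR ah) (simp add: nrm_eq_inner power2_eq_square)
  moreover have "nrm (a - h *\<^sub>R uh) < 1"
    using c(2) by (simp add: a_def nrm_eq_norm algebra_simps power_less_one_iff)
  moreover have "h\<^sup>2 \<le> 1"
    using assms h_pos by (simp add: power_le_one)
  ultimately have "nrm a < 2"
    by linarith
  moreover obtain k where "nrm a = of_int k"
    using L_nrm[OF aL] by (auto elim: Ints_cases)
  moreover have "a \<noteq> 0"
    using ah h_pos by auto
  then have "nrm a > 0"
    using nrm_nonneg[of a] by (simp add: less_le del: nrm_nonneg)
  ultimately have a1: "nrm a = 1"
    by simp
  have aa: "inner a a = 1"
    using a1 by (simp add: nrm_eq_inner)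
  \<comment> \<open>The conjugate of one inversion by the other, which is the reflection in the
    perpendicular bisector of 0 and \<open>a\<close>.\<close>
  define \<Phi> where "\<Phi> = lrefl (ball_vec 0) \<circ> (lrefl (ball_vec a) \<circ> (lrefl (ball_vec 0) \<circ> id))"
  define E where "E = \<Phi> wall_0"
  have GP: "(inversion 0 \<circ> (inversion a \<circ> (inversion 0 \<circ> id)), \<Phi>) \<in> GP"
    unfolding \<Phi>_def using aC \<Lambda>_0 by (intro GP.inversion GP.one) (auto simp: centres_def)
  have e1: "lrefl (ball_vec 0) wall_0 = wall_0"
    by (simp add: lrefl_def lprod_commute[of wall_0] lprod_wall_ball)
  have e2: "lrefl (ball_vec a) wall_0 = wall_0 - (2 * h) *\<^sub>R ball_vec a"
    by (simp add: lrefl_def lprod_commute[of wall_0] lprod_wall_ball ah)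
  have e3: "lprod wall_0 (ball_vec 0) = 0" "lprod (ball_vec a) (ball_vec 0) = 1 / 2"
    using a1 by (simp_all add: lprod_commute[of wall_0] lprod_wall_ball lprod_ball_ball)
  have "E = wall_0 - (2 * h) *\<^sub>R (ball_vec a - ball_vec 0)"
    unfolding E_def \<Phi>_def o_apply id_apply e1 e2 by (simp add: lrefl_def e3 algebra_simps)
  then have E: "E = (0, uh - (2 * h) *\<^sub>R a, - 2 * h)"
    using a1 by (simp add: wall_0_def ball_vec_def)
  have aE: "Some a \<in> fst (osph E)"
    using L_V[OF aL] by (simp add: osph_def E lprod_def point_vec_def inner_simps ah aa)
  have "osph E \<noteq> osph wall_0"
  proof
    assume "osph E = osph wall_0"
    then have "Some a \<in> fst (osph wall_0)"
      using aE by simp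
    then show False
      using h_pos by (simp add: osph_def lprod_wall_point ah)
  qed
  moreover have "osph E \<noteq> osph wall_1"
  proof
    assume eq: "osph E = osph wall_1"
    \<comment> \<open>The component of \<open>a\<close> along the base planes. Testing the image
      plane at \<open>a + v\<close>, a point of the second base plane, gives
      \<open>inner v a = 0\<close>, hence \<open>h = 1\<close>, and then
      \<open>v = 0\<close>.\<close>
    define v where "v = a - h *\<^sub>R uh"
    have v: "v \<in> V" "inner v uh = 0"
      using L_V[OF aL] uh_V subspace_V by (auto simp: v_def inner_simps ah intro: subspace_diff subspace_scale)
    have va: "inner v a = 1 - h\<^sup>2"
      by (simp add: v_def inner_simps aa ah inner_commute[of uh] power2_eq_square)
    have "Some (a + v) \<in> fst (osph wall_1)"
      using v L_V[OF aL] subspace_V by (simp add: osph_def lprod_wall_point inner_simps ah subspace_add)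
    then have "Some (a + v) \<in> fst (osph E)"
      by (simp add: eq)
    then have "inner (a + v) (uh - (2 * h) *\<^sub>R a) + h = 0"
      by (simp add: osph_def E lprod_def point_vec_def)
    then have "h * inner v a = 0"
      using v(2) by (simp add: inner_simps ah aa)
    then have "h\<^sup>2 = 1"
      using h_pos va by simp
    then have h1: "h = 1"
      using h_pos by (simp add: power2_eq_1_iff)
    have "inner v v = 0"
      using va h1 v(2) by (simp add: v_def inner_simps)
    then have "a = uh"
      by (simp add: v_def h1)
    then have uu: "u = norm u *\<^sub>R a"
      using u_nz by (simp add: uh_def)
    \<comment> \<open>Now \<open>u\<close> is \<open>norm u\<close> times the lattice vector
      \<open>a\<close>. By integrality \<open>norm u\<close> is half an integer and its square is an
      integer, so it is an integer \<open>j\<close>. The bound on \<open>nrm u\<close> gives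
      \<open>j > 1\<close>, and division of \<open>u\<close> by \<open>j\<close> contradicts
      normalization.\<close>
    have "2 * inner u a \<in> \<int>"
      using L_inner[OF u_L aL] .
    moreover have "inner u a = norm u"
      by (subst uu) (simp add: aa)
    ultimately obtain m where m: "2 * norm u = of_int m"
      by (auto elim: Ints_cases)
    obtain k where k: "nrm u = of_int k"
      using L_nrm[OF u_L] by (auto elim: Ints_cases)
    have "of_int (m * m) = (2 * norm u) * (2 * norm u)"
      by (simp add: m)
    also have "\<dots> = of_int (4 * k)"
      by (simp add: nrm_eq_norm power2_eq_square flip: k)
    finally have "m * m = 4 * k"
      by (simp only: of_int_eq_iff)
    then have "even m"
      by (metis even_mult_iff even_numeral dvd_mult2 dvd_trans even_numeral)
    then obtain j where j: "m = 2 * j"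
      by (auto elim: evenE)
    then have nu: "norm u = of_int j"
      using m by simp
    have "j > 1"
    proof (rule ccontr)
      assume "\<not> j > 1"
      then have "norm u \<le> 1"
        using nu by simp
      then have "nrm u \<le> 1"
        by (simp add: nrm_eq_norm power_le_one)
      then show False
        using nrm_u by simp
    qed
    moreover have "u /\<^sub>R of_int j \<in> R"
    proof -
      have "u /\<^sub>R of_int j = a"
        using nu u_nz \<open>a = uh\<close> by (simp add: uh_def)
      then show ?thesis
        using aL L_subset by auto
    qed
    ultimately show False
      using covering unfolding normalized_covering_vector_def by blast
  qed
  ultimately have "osph E \<notin> base_spheres n R u \<tau>"
    by (simp add: base_spheres_eq)
  moreover have "osph E \<in> arrangement n R u \<tau>"
    unfolding E_def using GP by (rule arrangementI) simp
  moreover have "None \<in> fst (osph E)"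
    by (simp add: None_fst_osph E lprod_inf)
  ultimately show ?thesis
    by blast
qed

lemma countable_L: "countable L"
  using countable_subset[OF L_subset countable_R] .

lemma countable_GP: "countable GP"
proof -
  define st where "st = (\<lambda>(b :: bool, c) (g :: quat option \<Rightarrow> quat option, \<Phi> :: lorentz \<Rightarrow> lorentz).
    if b then (transl c \<circ> g, lshift c \<circ> \<Phi>) else (inversion c \<circ> g, lrefl (ball_vec c) \<circ> \<Phi>))"
  have "GP \<subseteq> (\<lambda>xs. foldr st xs (id, id)) ` lists (UNIV \<times> L)"
  proof (rule subrelI)
    fix g \<Phi> assume "(g, \<Phi>) \<in> GP"
    then show "(g, \<Phi>) \<in> (\<lambda>xs. foldr st xs (id, id)) ` lists (UNIV \<times> L)"
    proof induction
      case one
      then show ?case by (intro image_eqI[of _ _ "[]"]) auto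
    next
      case (translation g \<Phi> w)
      from translation.IH obtain xs where xs: "(g, \<Phi>) = foldr st xs (id, id)" "xs \<in> lists (UNIV \<times> L)"
        by (rule imageE)
      have "foldr st ((True, w) # xs) (id, id) = st (True, w) (foldr st xs (id, id))"
        by simp
      also have "\<dots> = (transl w \<circ> g, lshift w \<circ> \<Phi>)"
        unfolding xs(1)[symmetric] by (simp add: st_def)
      finally have "foldr st ((True, w) # xs) (id, id) = (transl w \<circ> g, lshift w \<circ> \<Phi>)" .
      moreover have "(True, w) # xs \<in> lists (UNIV \<times> L)"
        using \<Lambda>_L[OF translation.hyps(2)] xs(2) by simp
      ultimately show ?case
        by (metis imageI)
    next
      case (inversion g \<Phi> c)
      from inversion.IH obtain xs where xs: "(g, \<Phi>) = foldr st xs (id, id)" "xs \<in> lists (UNIV \<times> L)"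
        by (rule imageE)
      have "foldr st ((False, c) # xs) (id, id) = st (False, c) (foldr st xs (id, id))"
        by simp
      also have "\<dots> = (inversion c \<circ> g, lrefl (ball_vec c) \<circ> \<Phi>)"
        unfolding xs(1)[symmetric] by (simp add: st_def)
      finally have "foldr st ((False, c) # xs) (id, id) = (inversion c \<circ> g, lrefl (ball_vec c) \<circ> \<Phi>)" .
      moreover have "(False, c) # xs \<in> lists (UNIV \<times> L)"
        using centres_L[OF inversion.hyps(2)] xs(2) by simp
      ultimately show ?case
        by (metis imageI)
    qed
  qed
  moreover have "countable ((\<lambda>xs. foldr st xs (id, id)) ` lists (UNIV \<times> L))"
    using countable_L by (intro countable_image countable_lists countable_SIGMA) auto
  ultimately show ?thesis
    by (rule countable_subset)
qed

lemma countable_arrangement: "countable (arrangement n R u \<tau>)"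
proof -
  have "arrangement n R u \<tau> \<subseteq> (\<lambda>((g :: quat option \<Rightarrow> quat option, \<Phi>), E). osph (\<Phi> E)) ` (GP \<times> {wall_0, wall_1})"
  proof
    fix S assume "S \<in> arrangement n R u \<tau>"
    then obtain g \<Phi> E where "(g, \<Phi>) \<in> GP" "E \<in> {wall_0, wall_1}" "S = osph (\<Phi> E)"
      unfolding arrangement_iff by blast
    then show "S \<in> (\<lambda>((g, \<Phi>), E). osph (\<Phi> E)) ` (GP \<times> {wall_0, wall_1})"
      by (intro image_eqI[of _ _ "((g, \<Phi>), E)"]) auto
  qed
  moreover have "countable ((\<lambda>((g :: quat option \<Rightarrow> quat option, \<Phi>), E). osph (\<Phi> E)) ` (GP \<times> {wall_0, wall_1}))"
    using countable_GP by (intro countable_image countable_SIGMA) auto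
  ultimately show ?thesis
    by (rule countable_subset)
qed

end

section \<open>Porosity of the points in no interior\<close>

locale packed_strip = covered_strip +
  assumes no_planes: "S \<in> arrangement n R u \<tau> \<Longrightarrow> None \<in> fst S \<Longrightarrow> S \<in> base_spheres n R u \<tau>"
begin

definition residual :: "quat set"
  where "residual = {x \<in> T. \<forall>S \<in> arrangement n R u \<tau> - base_spheres n R u \<tau>. x \<notin> Int_region n R S}"

text \<open>The points whose orbit runs into infinity or a tangency point, so that expansion along
  the orbit breaks off. As the group and the tangency points are countable, so is this set.\<close>

definition exceptional :: "quat set"
  where "exceptional = {x. \<exists>g \<Phi>. (g, \<Phi>) \<in> GP \<and> (g (Some x) = None \<or> g (Some x) \<in> Some ` tangency)}"

lemma countable_exceptional: "countable exceptional"
proof -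
  let ?F = "\<lambda>((g, \<Phi> :: lorentz \<Rightarrow> lorentz), p). the (g p)"
  have "exceptional \<subseteq> ?F ` (GP \<times> insert None (Some ` tangency))"
  proof
    fix x assume "x \<in> exceptional"
    then obtain g \<Phi> where g: "(g, \<Phi>) \<in> GP" "g (Some x) \<in> insert None (Some ` tangency)"
      unfolding exceptional_def by blast
    obtain g' \<Phi>' where "(g', \<Phi>') \<in> GP" "g' (g (Some x)) = Some x"
      using GP_inverse[OF g(1)] by blast
    then show "x \<in> ?F ` (GP \<times> insert None (Some ` tangency))"
      using g(2) by (intro image_eqI[of _ _ "((g', \<Phi>'), g (Some x))"]) auto
  qed
  moreover have "countable (?F ` (GP \<times> insert None (Some ` tangency)))"
    using countable_GP countable_tangency by (intro countable_image countable_SIGMA) auto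
  ultimately show ?thesis
    by (rule countable_subset)
qed

text \<open>Otherwise the pullback of the wall \<open>E\<close> has \<open>z\<close> strictly on its
  negative side, while infinity is not on that side by \<open>cusps_walls\<close>. If infinity lies
  on the pullback, this is a base plane, and \<open>z\<close> lies in the strip; if not, the
  negative side is the enclosed ball, an interior that contains \<open>z\<close>. Both are
  impossible.\<close>

lemma residual_outside:
  assumes "z \<in> residual" "(g, \<Phi>) \<in> GP" "g (Some z) = Some z'" "E = wall_0 \<or> E = wall_1"
  shows "lprod (point_vec z') E \<ge> 0"
proof (rule ccontr)
  assume neg: "\<not> lprod (point_vec z') E \<ge> 0"
  obtain g' \<Phi>' where g': "(g', \<Phi>') \<in> GP" "\<And>p. g' (g p) = p" "\<And>x. \<Phi>' (\<Phi> x) = x"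
    using GP_inverse[OF assms(2)] by blast
  have adj: "lprod x (\<Phi>' E) = lprod (\<Phi> x) E" for x
    using GP_linear(3)[OF g'(1), of "\<Phi> x" E] by (simp add: g'(3))
  obtain l where l: "moves g \<Phi> z z' l"
    using movesI[OF assms(2,3)] by blast
  have "lprod (point_vec z) (\<Phi>' E) = l * lprod (point_vec z') E"
    using l by (simp add: adj moves_def)
  then have zE: "lprod (point_vec z) (\<Phi>' E) < 0"
    using neg l by (simp add: moves_def mult_pos_neg)
  have S: "osph (\<Phi>' E) \<in> arrangement n R u \<tau>"
    using g'(1) assms(4) by (rule arrangementI)
  have zT: "z \<in> T" "z \<in> V"
    using assms(1) by (auto simp: residual_def T_def)
  have "lprod inf_vec (\<Phi>' E) \<ge> 0"
    using cusps_walls[OF GP_cusps[OF h_gt_1 assms(2)]] assms(4) by (auto simp only: adj)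
  then consider "lprod inf_vec (\<Phi>' E) = 0" | "lprod inf_vec (\<Phi>' E) > 0"
    by linarith
  then show False
  proof cases
    case 1
    then have "osph (\<Phi>' E) \<in> base_spheres n R u \<tau>"
      using no_planes[OF S] by (simp add: None_fst_osph)
    then obtain w where w: "w = wall_0 \<or> w = wall_1" "osph (\<Phi>' E) = osph w"
      unfolding base_spheres_eq by blast
    have "lprod (point_vec z) w \<ge> 0"
      using zT(1) w(1) by (elim disjE) (simp_all add: lprod_wall_point T_def)
    then have "Some z \<in> fst (osph w) \<union> snd (osph w)"
      using zT(2) by (auto simp: osph_def)
    then have "Some z \<in> fst (osph (\<Phi>' E)) \<union> snd (osph (\<Phi>' E))"
      by (simp only: w(2))
    then show False
      using zE by (auto simp: osph_def)
  next
    case 2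
    then have "osph (\<Phi>' E) \<notin> base_spheres n R u \<tau>"
      using base_planes[of "osph (\<Phi>' E)"] None_fst_osph[of "\<Phi>' E"] by linarith
    moreover have "z \<in> Int_region n R (osph (\<Phi>' E))"
      using zE zT(2) 2 by (simp add: Int_region_osph)
    ultimately show False
      using assms(1) S by (auto simp: residual_def)
  qed
qed

lemma residual_regular:
  assumes "z \<in> residual" "z \<notin> exceptional"
  shows "regular z"
  unfolding regular_def
proof (intro allI impI)
  fix g \<Phi> assume g: "(g, \<Phi>) \<in> GP"
  then obtain z' where z': "g (Some z) = Some z'" "z' \<notin> tangency"
    using assms(2) by (auto simp: exceptional_def)
  have "Some z \<in> ext_V"
    using assms(1) by (simp add: residual_def T_def)
  then have "z' \<in> V"
    using GP_ext_V[OF g] z'(1) by fastforce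
  moreover have "lprod (point_vec z') wall_0 \<ge> 0" "lprod (point_vec z') wall_1 \<ge> 0"
    using residual_outside[OF assms(1) g z'(1)] by auto
  ultimately show "\<exists>z'. g (Some z) = Some z' \<and> z' \<in> T \<and> z' \<notin> tangency"
    using z' by (auto simp: T_def lprod_wall_point)
qed

text \<open>A unit vector with \<open>A \<noteq> 0\<close> describes the sphere with centre
  \<open>b /\<^sub>R A\<close> and radius the absolute value of \<open>1 / A\<close>. The sign
  \<open>A < 0\<close> puts infinity on the positive side, so the ball is the negative side.\<close>

lemma lprod_round_sphere:
  assumes "E = (A, b, C)" "A < 0" "lprod E E = 1"
  shows "lprod (point_vec x) E = - A / 2 * (nrm (x - b /\<^sub>R A) - (1 / A)\<^sup>2)"
proof -
  have "nrm b = 1 + A * C"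
    using assms by (simp add: lprod_def nrm_eq_inner)
  then show ?thesis
    using assms(2) by (simp add: assms(1) lprod_def point_vec_def nrm_diff nrm_scaleR power2_eq_square field_simps)
qed

text \<open>The pulled back wall is a sphere of radius \<open>\<rho>\<close> with
  \<open>1 / (2 * \<rho>) = m * y'\<close>, and the distance \<open>d\<close> of \<open>z\<close>
  from its centre satisfies \<open>d\<^sup>2 - \<rho>\<^sup>2 = 2 * \<rho> * (l * y)\<close>.
  Smallness of \<open>l\<close> makes the gap \<open>d - \<rho>\<close> small, and separation of the
  images of \<open>z\<close> and infinity makes \<open>d\<close> comparable to
  \<open>\<rho>\<close>.\<close>

lemma residual_porous:
  "\<exists>K>0. \<forall>z\<in>residual - exceptional. \<forall>\<epsilon>>0. \<exists>s p. 0 < s \<and> s \<le> \<epsilon> \<and> p \<in> V \<and>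
    norm (z - p) + s \<le> K * s \<and> (\<forall>x\<in>V. norm (x - p) < s \<longrightarrow> x \<notin> residual)"
proof -
  obtain \<delta> where \<delta>: "\<delta> > 0" "\<And>z \<epsilon>. regular z \<Longrightarrow> 0 < \<epsilon> \<Longrightarrow>
    (\<exists>g \<Phi> z' w l m. moves g \<Phi> z z' l \<and> moves_inf g \<Phi> w m \<and> l \<le> \<epsilon> \<and> \<delta> \<le> norm (z' - w))"
    using deep_separated_orbit by blast
  \<comment> \<open>Chosen so that \<open>\<rho>\<^sup>2 + (2 * h / \<delta> * \<rho>)\<^sup>2 \<le>
    (K * \<rho>)\<^sup>2\<close>. The porosity constant is \<open>K + 2\<close>: the distance from
    \<open>z\<close> to the hole is at most \<open>K * s\<close>, and its radius counts
    twice.\<close>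
  define K where "K = 1 + 2 * h / \<delta>"
  have K: "K \<ge> 1"
    using h_pos \<delta>(1) by (simp add: K_def)
  have "\<exists>s p. 0 < s \<and> s \<le> \<epsilon> \<and> p \<in> V \<and> norm (z - p) + s \<le> (K + 2) * s \<and>
      (\<forall>x\<in>V. norm (x - p) < s \<longrightarrow> x \<notin> residual)"
    if z: "z \<in> residual" "z \<notin> exceptional" and \<epsilon>: "\<epsilon> > 0" for z \<epsilon>
  proof -
    have reg: "regular z"
      using residual_regular z by blast
    obtain g \<Phi> z' w l m where g: "moves g \<Phi> z z' l" "moves_inf g \<Phi> w m" "l \<le> \<epsilon> / h" "\<delta> \<le> norm (z' - w)"
      using \<delta>(2)[OF reg, of "\<epsilon> / h"] \<epsilon> h_pos by auto
    have GP: "(g, \<Phi>) \<in> GP" and lm: "l > 0" "m > 0"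
      using g by (simp_all add: moves_def moves_inf_def)
    have z'T: "z' \<in> T"
      using regular_self[OF regular_moves[OF reg g(1)]] by simp
    have w: "0 \<le> inner w uh" "inner w uh \<le> h"
      using GP_inf_in_strip[OF h_gt_1 GP] g(2) by (auto simp: moves_inf_def)
    \<comment> \<open>A wall on which \<open>w\<close>, the image of infinity, does not lie; its
      pullback avoids infinity and is a round sphere.\<close>
    define W where "W = (if inner w uh > 0 then wall_0 else wall_1)"
    have W: "W = wall_0 \<or> W = wall_1"
      by (simp add: W_def)
    define y y' where "y = lprod (point_vec z') W" and "y' = lprod (point_vec w) W"
    have y: "0 \<le> y" "y \<le> h" and y': "0 < y'" "y' \<le> h"
      using z'T w h_pos by (auto simp: y_def y'_def W_def lprod_wall_point T_def)
    obtain g' \<Phi>' where g': "(g', \<Phi>') \<in> GP" "\<And>x. \<Phi>' (\<Phi> x) = x"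
      using GP_inverse[OF GP] by blast
    have adj: "lprod x (\<Phi>' W) = lprod (\<Phi> x) W" for x
      using GP_linear(3)[OF g'(1), of "\<Phi> x" W] by (simp add: g'(2))
    obtain A b C where E: "\<Phi>' W = (A, b, C)"
      by (metis prod_cases3)
    have fz: "lprod (point_vec z) (\<Phi>' W) = l * y" and finf: "lprod inf_vec (\<Phi>' W) = m * y'"
      using g by (simp_all add: adj moves_def moves_inf_def y_def y'_def)
    have A: "- A / 2 = m * y'"
      using finf by (simp add: E lprod_inf)
    have "m * y' > 0"
      using lm y' by simp
    then have "A < 0"
      using A by linarith
    define \<rho> p0 where "\<rho> = - 1 / A" and "p0 = b /\<^sub>R A"
    have \<rho>: "\<rho> > 0" "1 / (2 * \<rho>) = m * y'"
      using \<open>A < 0\<close> A by (simp_all add: \<rho>_def divide_neg_neg)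
    have "lprod (\<Phi>' W) (\<Phi>' W) = 1"
      using GP_linear(3)[OF g'(1), of W W] W by auto
    then have sphere: "lprod (point_vec x) (\<Phi>' W) = - A / 2 * (nrm (x - p0) - \<rho>\<^sup>2)" for x
      using lprod_round_sphere[OF E \<open>A < 0\<close>, of x] by (simp add: p0_def \<rho>_def power2_eq_square)
    have p0V: "p0 \<in> V"
      using GP_V[OF g'(1) wall_V[OF W]] subspace_V by (simp add: p0_def E subspace_scale)
    define d where "d = norm (z - p0)"
    have "l * y = 1 / (2 * \<rho>) * (d\<^sup>2 - \<rho>\<^sup>2)"
      unfolding \<rho>(2) A[symmetric] d_def using sphere[of z] fz by (simp only: nrm_eq_norm)
    then have d2: "d\<^sup>2 - \<rho>\<^sup>2 = 2 * \<rho> * (l * y)"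
      using \<rho>(1) by (simp add: field_simps)
    have ly: "0 \<le> l * y" "l * y \<le> \<epsilon>"
    proof -
      have "l * y \<le> \<epsilon> / h * h"
        using g(3) y lm \<epsilon> h_pos by (intro mult_mono) auto
      then show "l * y \<le> \<epsilon>"
        using h_pos by simp
    qed (use lm y in simp)
    have "\<rho>\<^sup>2 \<le> d\<^sup>2"
      using d2 ly(1) \<rho>(1) by (smt (verit) mult_nonneg_nonneg)
    then have d_ge: "\<rho> \<le> d"
      by (rule power2_le_imp_le) (simp add: d_def)
    have gap: "d - \<rho> \<le> l * y"
    proof -
      have "(d - \<rho>) * (2 * \<rho>) \<le> (d - \<rho>) * (d + \<rho>)"
        using d_ge by (intro mult_left_mono) auto
      also have "\<dots> = (l * y) * (2 * \<rho>)"
        using d2 by (simp add: power2_eq_square algebra_simps)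
      finally show ?thesis
        using \<rho>(1) by simp
    qed
    \<comment> \<open>Separation enters here: \<open>l * m * nrm (z' - w) = 1\<close> and
      \<open>\<delta> \<le> norm (z' - w)\<close> bound the product of \<open>l * y\<close> and
      \<open>m * y'\<close> by \<open>(h / \<delta>)\<^sup>2\<close>.\<close>
    have d_le: "d \<le> K * \<rho>"
    proof -
      have "l * m * nrm (z' - w) = 1"
        using moves_inf_pair[OF g(1,2)] .
      have "(l * y) * (m * y') * \<delta>\<^sup>2 \<le> (l * y) * (m * y') * nrm (z' - w)"
        using lm y y' g(4) \<delta>(1) by (intro mult_left_mono) (auto simp: nrm_eq_norm intro: power_mono)
      also have "\<dots> = (l * m * nrm (z' - w)) * (y * y')"
        by (simp add: mult_ac)
      also have "\<dots> = y * y'"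
        using moves_inf_pair[OF g(1,2)] by simp
      also have "\<dots> \<le> h * h"
        using y y' by (intro mult_mono) auto
      finally have "(l * y) * (m * y') \<le> (h / \<delta>)\<^sup>2"
        using \<delta>(1) by (simp add: power2_eq_square field_simps)
      then have "(l * y) * (1 / (2 * \<rho>)) * (4 * \<rho>\<^sup>2) \<le> (h / \<delta>)\<^sup>2 * (4 * \<rho>\<^sup>2)"
        unfolding \<rho>(2) by (intro mult_right_mono) auto
      moreover have "(l * y) * (1 / (2 * \<rho>)) * (4 * \<rho>\<^sup>2) = 2 * \<rho> * (l * y)"
        using \<rho>(1) by (simp add: power2_eq_square)
      moreover have "(2 * h / \<delta> * \<rho>)\<^sup>2 = (h / \<delta>)\<^sup>2 * (4 * \<rho>\<^sup>2)"
        by (simp add: power_mult_distrib power_divide)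
      ultimately have "d\<^sup>2 \<le> \<rho>\<^sup>2 + (2 * h / \<delta> * \<rho>)\<^sup>2"
        using d2 by linarith
      also have "\<dots> \<le> (K * \<rho>)\<^sup>2"
        using h_pos \<delta>(1) \<rho>(1) by (simp add: K_def power2_eq_square algebra_simps)
      finally show ?thesis
        by (rule power2_le_imp_le) (use K \<rho> in simp)
    qed
    \<comment> \<open>The hole is the enclosed ball itself if its radius is at most
      \<open>\<epsilon>\<close>; otherwise it is a ball of radius \<open>\<epsilon>\<close> inside,
      touching the sphere at the point nearest to \<open>z\<close>.\<close>
    define s where "s = min \<rho> \<epsilon>"
    have s: "0 < s" "s \<le> \<rho>" "s \<le> \<epsilon>"
      using \<rho>(1) \<epsilon> by (simp_all add: s_def)
    define p where "p = p0 + ((\<rho> - s) / d) *\<^sub>R (z - p0)"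
    have dpos: "d > 0"
      using d_ge \<rho>(1) by linarith
    have "z \<in> V"
      using z(1) by (simp add: residual_def T_def)
    then have pV: "p \<in> V"
      unfolding p_def using p0V subspace_V by (intro subspace_add subspace_scale subspace_diff)
    have "norm (p - p0) = \<rho> - s"
      using s dpos by (simp add: p_def d_def)
    have "z - p = (1 - (\<rho> - s) / d) *\<^sub>R (z - p0)"
      by (simp add: p_def algebra_simps)
    then have "norm (z - p) = \<bar>1 - (\<rho> - s) / d\<bar> * d"
      by (simp add: d_def)
    also have "(\<rho> - s) / d \<le> 1"
      using d_ge s dpos by simp
    then have "\<bar>1 - (\<rho> - s) / d\<bar> * d = d - (\<rho> - s)"
      using dpos by (simp add: field_simps)
    finally have zp: "norm (z - p) = d - \<rho> + s"
      by simp
    have "d - \<rho> \<le> K * s"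
    proof (cases "\<rho> \<le> \<epsilon>")
      case True
      then show ?thesis
        using d_le \<rho>(1) by (simp add: s_def)
    next
      case False
      then have "d - \<rho> \<le> s"
        using gap ly(2) by (simp add: s_def)
      also have "\<dots> \<le> K * s"
        using K s(1) by simp
      finally show ?thesis .
    qed
    then have "norm (z - p) + s \<le> (K + 2) * s"
      unfolding zp by (simp add: algebra_simps)
    moreover have "x \<notin> residual" if x: "x \<in> V" "norm (x - p) < s" for x
    proof -
      have "norm (x - p0) \<le> norm (x - p) + norm (p - p0)"
        using norm_triangle_ineq[of "x - p" "p - p0"] by simp
      then have "norm (x - p0) < \<rho>"
        using x(2) \<open>norm (p - p0) = \<rho> - s\<close> by linarith
      then have "nrm (x - p0) < \<rho>\<^sup>2"
        by (simp add: nrm_eq_norm power_strict_mono)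
      then have "lprod (point_vec x) (\<Phi>' W) < 0"
        unfolding sphere using \<open>A < 0\<close> by (intro mult_pos_neg) auto
      moreover have inf: "lprod inf_vec (\<Phi>' W) > 0"
        unfolding finf by fact
      ultimately have "x \<in> Int_region n R (osph (\<Phi>' W))"
        using x(1) by (simp add: Int_region_osph)
      moreover have "osph (\<Phi>' W) \<notin> base_spheres n R u \<tau>"
        using inf base_planes[of "osph (\<Phi>' W)"] None_fst_osph[of "\<Phi>' W"] by linarith
      moreover have "osph (\<Phi>' W) \<in> arrangement n R u \<tau>"
        using g'(1) W by (rule arrangementI)
      ultimately show ?thesis
        by (auto simp: residual_def)
    qed
    ultimately show ?thesis
      using s pV by blast
  qed
  then show ?thesis
    using K by (intro exI[of _ "K + 2"]) auto
qed

end

section \<open>Porous sets and fundamental domains\<close>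

lemma countable_imp_negligible:
  fixes S :: "'a::euclidean_space set"
  shows "countable S \<Longrightarrow> negligible S"
  by (simp add: negligible_iff_null_sets null_sets_completionI countable_imp_null_set_lborel)

text \<open>At no point does the upper density of a uniformly porous set reach 1.\<close>
lemma porous_negligible:
  fixes Z :: "'a::euclidean_space set"
  assumes Z: "Z \<in> sets lebesgue" and X: "countable X" and K: "K > 0"
    and porous: "\<And>z \<epsilon>. z \<in> Z \<Longrightarrow> z \<notin> X \<Longrightarrow> 0 < \<epsilon> \<Longrightarrow>
      \<exists>s p. 0 < s \<and> s \<le> \<epsilon> \<and> norm (z - p) + s \<le> K * s \<and> ball p s \<inter> Z = {}"
  shows "negligible Z"
proof -
  define d where "d = DIM('a)"
  \<comment> \<open>The share of a ball that remains after removal of a hole whose radius is smaller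
    by the factor \<open>K\<close>.\<close>
  define q where "q = 1 - (1 / K) ^ d"
  have half: "\<exists>r>0. r < \<epsilon> \<and> emeasure lebesgue (Z \<inter> ball z r) \<le> ennreal q * emeasure lebesgue (ball z r)"
    if z: "z \<in> Z" "z \<notin> X" and \<epsilon>: "\<epsilon> > 0" for z \<epsilon>
  proof -
    \<comment> \<open>With this scale the ball around \<open>z\<close> of radius
      \<open>K * s\<close> contains the hole and has radius at most
      \<open>\<epsilon> / 2\<close>.\<close>
    obtain s p where s: "0 < s" "s \<le> \<epsilon> / (2 * K)" "norm (z - p) + s \<le> K * s" "ball p s \<inter> Z = {}"
      using porous[OF z, of "\<epsilon> / (2 * K)"] \<epsilon> K by auto
    define r where "r = K * s"
    have r: "r > 0" "r < \<epsilon>"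
      using s(1,2) K \<epsilon> by (simp_all add: r_def field_simps)
    have "ball p s \<subseteq> ball z r"
    proof
      fix x assume "x \<in> ball p s"
      then have "dist z x < norm (z - p) + s"
        using dist_triangle[of z x p] by (simp add: dist_norm)
      then show "x \<in> ball z r"
        using s(3) by (simp add: r_def)
    qed
    have "K \<ge> 1"
    proof -
      have "1 * s \<le> K * s"
        using s(3) norm_ge_zero[of "z - p"] by linarith
      then show ?thesis
        using s(1) by (simp only: mult_le_cancel_right_pos)
    qed
    have q: "q \<ge> 0"
      using \<open>K \<ge> 1\<close> by (simp add: q_def power_le_one)
    have "emeasure lebesgue (Z \<inter> ball z r) \<le> emeasure lebesgue (ball z r - ball p s)"
      using s(4) by (intro emeasure_mono) auto
    also have "\<dots> = emeasure lebesgue (ball z r) - emeasure lebesgue (ball p s)"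
      using \<open>ball p s \<subseteq> ball z r\<close> s(1) by (intro emeasure_Diff) (auto simp: emeasure_ball less_top[symmetric])
    also have "\<dots> = ennreal (unit_ball_vol d * r ^ d) - ennreal (unit_ball_vol d * s ^ d)"
      using r(1) s(1) by (simp add: emeasure_ball d_def)
    also have "\<dots> = ennreal (unit_ball_vol d * r ^ d - unit_ball_vol d * s ^ d)"
      using s(1) by (intro ennreal_minus) auto
    also have "unit_ball_vol d * r ^ d - unit_ball_vol d * s ^ d = q * (unit_ball_vol d * r ^ d)"
      using K s(1) by (simp add: q_def r_def power_mult_distrib field_simps)
    also have "ennreal (q * (unit_ball_vol d * r ^ d)) = ennreal q * emeasure lebesgue (ball z r)"
      using q r(1) by (simp add: ennreal_mult emeasure_ball d_def)
    finally show ?thesis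
      using r by blast
  qed
  have bounded: "negligible (Z \<inter> ball 0 M)" for M
  proof (cases "Z \<inter> ball 0 M \<subseteq> X")
    case True
    then show ?thesis
      using X countable_subset countable_imp_negligible by blast
  next
    case False
    define A where "A = Z \<inter> ball 0 M"
    obtain z0 where "z0 \<in> Z" "z0 \<notin> X"
      using False by auto
    have "q < 1"
      using K by (simp add: q_def)
    show ?thesis
    proof (rule ccontr)
      assume nonneg: "\<not> negligible (Z \<inter> ball 0 M)"
      have A: "A \<in> lmeasurable"
        unfolding A_def using Z by (intro bounded_set_imp_lmeasurable) (auto intro: bounded_subset[OF bounded_ball])
      define \<mu> where "\<mu> = measure lebesgue A"
      have "emeasure lebesgue A \<noteq> 0"
        using nonneg A by (simp add: A_def negligible_iff_emeasure0 fmeasurableD)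
      then have \<mu>: "\<mu> > 0" "emeasure lebesgue A = ennreal \<mu>"
        using A by (auto simp: \<mu>_def emeasure_eq_measure2 less_le ennreal_eq_0_iff)
      \<comment> \<open>The Vitali covering will give
        \<open>\<mu> \<le> max q 0 * (\<mu> + \<theta>)\<close>, which is false for this
        \<open>\<theta>\<close>. The maximum covers the possibility \<open>K < 1\<close>, for which
        \<open>q\<close> is negative.\<close>
      define \<theta> where "\<theta> = (1 - max q 0) * \<mu> / 2"
      have \<theta>: "\<theta> > 0"
        using \<open>q < 1\<close> \<mu> by (simp add: \<theta>_def)
      obtain U where U: "open U" "A \<subseteq> U" "U - A \<in> lmeasurable" "emeasure lebesgue (U - A) < ennreal \<theta>"
        using sets_lebesgue_outer_open[of A \<theta>] A \<theta> by (metis fmeasurableD)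
      \<comment> \<open>Disjoint balls inside \<open>U\<close> have total volume at most
        \<open>\<mu> + \<theta>\<close>, and \<open>A\<close> fills at most the share
        \<open>q\<close> of each.\<close>
      define I where "I = {(z, r). r > 0 \<and> ball z r \<subseteq> U \<and>
        emeasure lebesgue (Z \<inter> ball z r) \<le> ennreal q * emeasure lebesgue (ball z r)}"
      have fine: "\<exists>i. i \<in> I \<and> x \<in> ball (fst i) (snd i) \<and> snd i < e" if x: "x \<in> A - X" and "e > 0" for x e
      proof -
        obtain e' where e': "e' > 0" "ball x e' \<subseteq> U"
          using x U(1,2) by (metis DiffD1 open_contains_ball subsetD)
        obtain r where "r > 0" "r < min e e'" "emeasure lebesgue (Z \<inter> ball x r) \<le> ennreal q * emeasure lebesgue (ball x r)"
          using half[of x "min e e'"] x e'(1) \<open>e > 0\<close> by (auto simp: A_def)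
        then show ?thesis
          using e'(2) subset_ball[of r e' x] by (intro exI[of _ "(x, r)"]) (auto simp: I_def)
      qed
      obtain C where C: "countable C" "C \<subseteq> I"
        "pairwise (\<lambda>i j. disjnt (ball (fst i) (snd i)) (ball (fst j) (snd j))) C"
        "negligible ((A - X) - (\<Union>i\<in>C. ball (fst i) (snd i)))"
        using Vitali_covering_theorem_balls[of "A - X" I fst snd] fine by blast
      define B where "B i = ball (fst i) (snd i)" for i :: "'a \<times> real"
      have "B i \<inter> B j = {}" if "i \<in> C" "j \<in> C" "i \<noteq> j" for i j
        using pairwiseD[OF C(3) that] by (simp add: disjnt_def B_def)
      then have disj: "disjoint_family_on B C" "disjoint_family_on (\<lambda>i. Z \<inter> B i) C"
        unfolding disjoint_family_on_def by blast+
      let ?N = "((A - X) - (\<Union>i\<in>C. B i)) \<union> (A \<inter> X)"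
      have N: "negligible ?N"
        using C(4) X by (intro negligible_Un countable_imp_negligible[of "A \<inter> X"]) (auto simp: B_def)
      have "emeasure lebesgue A \<le> emeasure lebesgue ((\<Union>i\<in>C. Z \<inter> B i) \<union> ?N)"
      proof (rule emeasure_mono)
        show "A \<subseteq> (\<Union>i\<in>C. Z \<inter> B i) \<union> ?N"
          by (auto simp: A_def)
        show "(\<Union>i\<in>C. Z \<inter> B i) \<union> ?N \<in> sets lebesgue"
          using C(1) Z N by (intro sets.Un sets.countable_UN') (auto simp: B_def negligible_imp_sets)
      qed
      also have "\<dots> \<le> emeasure lebesgue (\<Union>i\<in>C. Z \<inter> B i) + emeasure lebesgue ?N"
        using C(1) Z N by (intro emeasure_subadditive sets.countable_UN') (auto simp: B_def negligible_imp_sets)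
      also have "emeasure lebesgue ?N = 0"
        using N negligible_iff_emeasure0 negligible_imp_sets by blast
      also have "emeasure lebesgue (\<Union>i\<in>C. Z \<inter> B i) = (\<integral>\<^sup>+i. emeasure lebesgue (Z \<inter> B i) \<partial>count_space C)"
        using C(1) Z disj(2) by (intro emeasure_UN_countable) (auto simp: B_def)
      also have "\<dots> \<le> (\<integral>\<^sup>+i. ennreal q * emeasure lebesgue (B i) \<partial>count_space C)"
        using C(2) by (intro nn_integral_mono) (auto simp: I_def B_def)
      also have "\<dots> = ennreal q * (\<integral>\<^sup>+i. emeasure lebesgue (B i) \<partial>count_space C)"
        by (intro nn_integral_cmult) auto
      also have "(\<integral>\<^sup>+i. emeasure lebesgue (B i) \<partial>count_space C) = emeasure lebesgue (\<Union>i\<in>C. B i)"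
        by (rule emeasure_UN_countable[OF _ C(1) disj(1), symmetric]) (simp add: B_def)
      also have "ennreal q * \<dots> \<le> ennreal q * emeasure lebesgue (A \<union> (U - A))"
      proof (intro mult_left_mono emeasure_mono)
        show "(\<Union>i\<in>C. B i) \<subseteq> A \<union> (U - A)"
          using C(2) unfolding I_def B_def by fastforce
        show "A \<union> (U - A) \<in> sets lebesgue"
          using A U(3) by (intro sets.Un fmeasurableD)
      qed simp
      also have "\<dots> \<le> ennreal q * (emeasure lebesgue A + emeasure lebesgue (U - A))"
        using A U(3) by (intro mult_left_mono emeasure_subadditive) auto
      also have "\<dots> \<le> ennreal (max q 0) * (ennreal \<mu> + ennreal \<theta>)"
        using U(4) \<mu> by (intro mult_mono add_mono ennreal_leI) auto
      also have "\<dots> = ennreal (max q 0 * (\<mu> + \<theta>))"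
        using \<mu>(1) \<theta> by (simp add: ennreal_mult del: ennreal_plus flip: ennreal_plus)
      finally have "ennreal \<mu> \<le> ennreal (max q 0 * (\<mu> + \<theta>))"
        using \<mu>(2) by simp
      then have "\<mu> \<le> max q 0 * (\<mu> + \<theta>)"
        using \<mu>(1) \<theta> by (subst (asm) ennreal_le_iff) auto
      also have "\<dots> = max q 0 * \<mu> + max q 0 * \<theta>"
        by (simp add: algebra_simps)
      also have "max q 0 * \<theta> \<le> 1 * \<theta>"
        using \<open>q < 1\<close> \<theta> by (intro mult_right_mono) auto
      finally have "\<mu> - max q 0 * \<mu> \<le> \<theta>"
        by simp
      moreover have "\<theta> = (\<mu> - max q 0 * \<mu>) / 2"
        by (simp add: \<theta>_def algebra_simps)
      moreover have "x \<le> \<theta> \<Longrightarrow> \<theta> = x / 2 \<Longrightarrow> False" for x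
        using \<theta> by linarith
      ultimately show False
        by blast
    qed
  qed
  have "Z = (\<Union>M::nat. Z \<inter> ball 0 (real M))"
    by (auto simp: reals_Archimedean2)
  moreover have "negligible (\<Union>M::nat. Z \<inter> ball 0 (real M))"
    using bounded by (intro negligible_Union_nat) auto
  ultimately show ?thesis
    by simp
qed

section \<open>Translates and fundamental domains of lattices\<close>

lemma emeasure_lborel_translate:
  fixes A :: "'a::euclidean_space set"
  assumes "A \<in> sets borel"
  shows "emeasure lborel {x. x + c \<in> A} = emeasure lborel A"
proof -
  have "emeasure lborel A = emeasure (distr lborel borel ((+) c)) A"
    by (simp add: lborel_distr_plus)
  also have "\<dots> = emeasure lborel ((+) c -` A \<inter> space lborel)"
    using assms by (intro emeasure_distr) auto
  also have "(+) c -` A \<inter> space lborel = {x. x + c \<in> A}"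
    by (auto simp: add.commute)
  finally show ?thesis ..
qed

lemma translate_borel:
  fixes A :: "'a::euclidean_space set"
  assumes A: "A \<in> sets borel"
  shows "{x. x + c \<in> A} \<in> sets borel"
proof -
  have "continuous_on UNIV (\<lambda>x :: 'a. x + c)"
    by (intro continuous_on_add continuous_on_id continuous_on_const)
  then have "(\<lambda>x. x + c) -` A \<inter> space borel \<in> sets borel"
    using A by (intro measurable_sets[of _ borel borel] borel_measurable_continuous_onI)
  then show ?thesis
    by (simp add: vimage_def)
qed

locale lattice_domain =
  fixes M :: "'a::euclidean_space set" and F :: "'a set"
  assumes countable: "countable M" and zero: "0 \<in> M" and diff: "x \<in> M \<Longrightarrow> y \<in> M \<Longrightarrow> x - y \<in> M"
    and borel: "F \<in> sets borel" and reps: "\<exists>!y. y \<in> F \<and> x - y \<in> M"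
begin

lemma uminus: "x \<in> M \<Longrightarrow> - x \<in> M"
  using diff[OF zero] by simp

lemma rep_unique: "y \<in> F \<Longrightarrow> z \<in> F \<Longrightarrow> y - z \<in> M \<Longrightarrow> y = z"
  using reps[of y] zero by auto

text \<open>Up to a null set \<open>F\<close> is covered by its intersections with translates of
  \<open>U\<close>. Translated back, these become disjoint pieces of \<open>U\<close>, because the
  translates of \<open>F\<close> are disjoint.\<close>

lemma emeasure_le_cover:
  assumes U: "U \<in> sets borel" and N: "N \<in> null_sets lborel"
    and cover: "\<And>x. x \<in> N \<or> (\<exists>l\<in>M. x - l \<in> U)"
  shows "emeasure lborel F \<le> emeasure lborel U"
proof -
  let ?G = "\<lambda>l. F \<inter> {x. x - l \<in> U}"
  let ?H = "\<lambda>l. {x. x + l \<in> F} \<inter> U"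
  have GH: "?G l \<in> sets borel" "?H l \<in> sets borel" for l
    using sets.Int[OF borel translate_borel[OF U, of "- l"]] sets.Int[OF translate_borel[OF borel, of l] U]
    by simp_all
  have "F \<subseteq> (\<Union>l\<in>M. ?G l) \<union> N"
    using cover by blast
  then have "emeasure lborel F \<le> emeasure lborel ((\<Union>l\<in>M. ?G l) \<union> N)"
    using N countable GH by (intro emeasure_mono sets.Un sets.countable_UN') auto
  also have "\<dots> \<le> emeasure lborel (\<Union>l\<in>M. ?G l) + emeasure lborel N"
    using N countable GH by (intro emeasure_subadditive sets.countable_UN') auto
  also have "emeasure lborel N = 0"
    using N by auto
  also have "emeasure lborel (\<Union>l\<in>M. ?G l) + 0 \<le> (\<integral>\<^sup>+l. emeasure lborel (?G l) \<partial>count_space M)"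
  proof -
    have "emeasure lborel (\<Union>l\<in>M. ?G l) = (\<integral>\<^sup>+x. indicator (\<Union>l\<in>M. ?G l) x \<partial>lborel)"
      using countable GH by (intro nn_integral_indicator[symmetric] sets.countable_UN') auto
    also have "\<dots> \<le> (\<integral>\<^sup>+x. (\<integral>\<^sup>+l. indicator (?G l) x \<partial>count_space M) \<partial>lborel)"
    proof (rule nn_integral_mono)
      fix x
      show "indicator (\<Union>l\<in>M. ?G l) x \<le> (\<integral>\<^sup>+l. indicator (?G l) x \<partial>count_space M)"
      proof (cases "x \<in> (\<Union>l\<in>M. ?G l)")
        case True
        then obtain l where l: "l \<in> M" "x \<in> ?G l" by blast
        have "1 = (\<integral>\<^sup>+l'. indicator {l} l' \<partial>count_space M)"
          using l(1) by (subst nn_integral_indicator) (auto simp: emeasure_count_space)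
        also have "\<dots> \<le> (\<integral>\<^sup>+l. indicator (?G l) x \<partial>count_space M)"
          using l(2) by (intro nn_integral_mono) (auto simp: indicator_def)
        finally show ?thesis
          using True by simp
      qed simp
    qed
    also have "\<dots> = (\<integral>\<^sup>+l. (\<integral>\<^sup>+x. indicator (?G l) x \<partial>lborel) \<partial>count_space M)"
      using countable GH by (intro nn_integral_count_space_nn_integral) auto
    finally show ?thesis
      using GH by simp
  qed
  also have "(\<integral>\<^sup>+l. emeasure lborel (?G l) \<partial>count_space M) = (\<integral>\<^sup>+l. emeasure lborel (?H l) \<partial>count_space M)"
  proof (intro nn_integral_cong)
    fix l
    have "?H l = {x. x + l \<in> ?G l}"
      by auto
    then show "emeasure lborel (?G l) = emeasure lborel (?H l)"
      using emeasure_lborel_translate[OF GH(1), of l l] by simp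
  qed
  also have "\<dots> = emeasure lborel (\<Union>l\<in>M. ?H l)"
  proof (intro emeasure_UN_countable[symmetric])
    show "disjoint_family_on ?H M"
      unfolding disjoint_family_on_def
    proof (intro ballI impI)
      fix l l' assume l: "l \<in> M" "l' \<in> M" "l \<noteq> l'"
      have False if "x + l \<in> F" "x + l' \<in> F" for x
        using rep_unique[OF that] diff[OF l(1,2)] l(3) by simp
      then show "?H l \<inter> ?H l' = {}"
        by blast
    qed
  qed (use countable GH in auto)
  also have "\<dots> \<le> emeasure lborel U"
    using U by (intro emeasure_mono) auto
  finally show ?thesis .
qed

lemma emeasure_pos: "emeasure lborel F \<noteq> 0"
proof
  assume F0: "emeasure lborel F = 0"
  have "\<exists>l\<in>M. x + l \<in> F" for x
  proof -
    obtain y where "y \<in> F" "x - y \<in> M"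
      using reps[of x] by blast
    then show ?thesis
      using uminus[of "x - y"] by (intro bexI[of _ "y - x"]) auto
  qed
  then have "UNIV = (\<Union>l\<in>M. {x. x + l \<in> F})"
    by auto
  moreover have "{x. x + l \<in> F} \<in> null_sets lborel" for l
    using F0 translate_borel[OF borel] emeasure_lborel_translate[OF borel] by (simp add: null_sets_def)
  then have "(\<Union>l\<in>M. {x. x + l \<in> F}) \<in> null_sets lborel"
    using countable by (intro null_sets_UN') auto
  ultimately have "emeasure lborel (UNIV :: 'a set) = 0"
    by (simp add: null_sets_def)
  then show False
    by simp
qed

end

text \<open>Finitely many balls of radius 1/3 meet every coset, and each contains at most one point
  of a coset, since nonzero lattice vectors have norm at least 1. Removing from each ball the cosets
  met by earlier balls leaves exactly one representative.\<close>

lemma lattice_domain_exists: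
  fixes M :: "'a::euclidean_space set"
  assumes "countable M" "0 \<in> M" "\<And>x y. x \<in> M \<Longrightarrow> y \<in> M \<Longrightarrow> x - y \<in> M"
    and discrete: "\<And>x. x \<in> M \<Longrightarrow> x \<noteq> 0 \<Longrightarrow> 1 \<le> norm x"
    and cobounded: "\<And>x. \<exists>l\<in>M. norm (x - l) \<le> r"
  shows "\<exists>F. lattice_domain M F"
proof -
  have cov: "cball (0 :: 'a) r \<subseteq> (\<Union>x\<in>UNIV. ball x (1/3))"
  proof
    fix x :: 'a
    have "x \<in> ball x (1/3)"
      by simp
    then show "x \<in> (\<Union>x\<in>UNIV. ball x (1/3))"
      by blast
  qed
  obtain X where X: "finite X" "cball (0 :: 'a) r \<subseteq> (\<Union>x\<in>X. ball x (1/3))"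
    by (rule compactE_image[OF compact_cball[of 0 r] _ cov]) auto
  obtain xs where xs: "set xs = X"
    using finite_list[OF X(1)] by blast
  define P where "P i x \<longleftrightarrow> (\<exists>l\<in>M. x - l \<in> ball (xs ! i) (1/3))" for i x
  define F where "F = (\<Union>i\<in>{..<length xs}. ball (xs ! i) (1/3) - (\<Union>j\<in>{..<i}. {x. P j x}))"
  have P_shift: "P j (x - l) \<longleftrightarrow> P j x" if "l \<in> M" for j x l
  proof
    assume "P j (x - l)"
    then obtain k where "k \<in> M" "x - l - k \<in> ball (xs ! j) (1/3)"
      by (auto simp: P_def)
    moreover have "l + k \<in> M"
      using assms(3)[OF \<open>l \<in> M\<close> assms(3)[OF assms(2) \<open>k \<in> M\<close>]] by simp
    ultimately show "P j x"
      unfolding P_def by (intro bexI[of _ "l + k"]) (auto simp: algebra_simps)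
  next
    assume "P j x"
    then obtain k where "k \<in> M" "x - k \<in> ball (xs ! j) (1/3)"
      by (auto simp: P_def)
    then show "P j (x - l)"
      unfolding P_def using assms(3)[OF \<open>k \<in> M\<close> that] by (intro bexI[of _ "k - l"]) (auto simp: algebra_simps)
  qed
  have "open {x. P j x}" for j
  proof -
    have "{x. P j x} = (\<Union>l\<in>M. (+) l ` ball (xs ! j) (1/3))"
    proof (intro equalityI subsetI)
      fix x assume "x \<in> {x. P j x}"
      then obtain l where "l \<in> M" "x - l \<in> ball (xs ! j) (1/3)"
        by (auto simp only: P_def mem_Collect_eq)
      moreover have "x = l + (x - l)"
        by simp
      ultimately show "x \<in> (\<Union>l\<in>M. (+) l ` ball (xs ! j) (1/3))"
        by blast
    next
      fix x assume "x \<in> (\<Union>l\<in>M. (+) l ` ball (xs ! j) (1/3))"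
      then obtain l y where "l \<in> M" "y \<in> ball (xs ! j) (1/3)" "x = l + y"
        by blast
      then show "x \<in> {x. P j x}"
        unfolding P_def by (intro CollectI bexI[of _ l]) simp_all
    qed
    then show ?thesis
      by (auto intro: open_translation)
  qed
  then have "F \<in> sets borel"
    unfolding F_def by (intro sets.finite_UN sets.Diff) auto
  moreover have "\<exists>!y. y \<in> F \<and> x - y \<in> M" for x
  proof -
    have ex: "\<exists>i<length xs. P i x"
    proof -
      obtain l where l: "l \<in> M" "norm (x - l) \<le> r"
        using cobounded by blast
      then obtain c where "c \<in> X" "x - l \<in> ball c (1/3)"
        using X(2) by (auto simp: subset_iff)
      then show ?thesis
        using l(1) xs unfolding P_def by (metis in_set_conv_nth)
    qed
    define i where "i = (LEAST i. i < length xs \<and> P i x)"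
    have i: "i < length xs" "P i x"
      using LeastI_ex[of "\<lambda>i. i < length xs \<and> P i x"] ex by (auto simp: i_def)
    have i_min: "\<not> P j x" if "j < i" for j
      using not_less_Least[of j "\<lambda>i. i < length xs \<and> P i x"] that i(1) by (auto simp: i_def)
    obtain l where l: "l \<in> M" "x - l \<in> ball (xs ! i) (1/3)"
      using i(2) by (auto simp: P_def)
    have in_F: "x - l \<in> F"
      unfolding F_def using i(1) l i_min P_shift[OF l(1)] by blast
    have unique: "y = x - l" if y: "y \<in> F" "x - y \<in> M" for y
    proof -
      obtain k where k: "k < length xs" "y \<in> ball (xs ! k) (1/3)" "\<And>j. j < k \<Longrightarrow> \<not> P j y"
        using y(1) unfolding F_def by blast
      have Py: "P j y \<longleftrightarrow> P j x" for j
        using P_shift[OF y(2), of j x] by simp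
      have "P k y"
        unfolding P_def using assms(2) k(2) by (intro bexI[of _ 0]) auto
      then have "k = i"
        using k(3) i_min i(2) Py by (metis linorder_neqE_nat)
      have "dist y (x - l) < 1"
        using dist_triangle2[of y "x - l" "xs ! i"] k(2) l(2) unfolding \<open>k = i\<close> by (simp add: dist_commute)
      moreover have "(x - l) - y \<in> M"
        using assms(3)[OF y(2) l(1)] by (simp add: algebra_simps)
      ultimately show ?thesis
        using discrete[of "(x - l) - y"] by (force simp: dist_norm norm_minus_commute)
    qed
    show ?thesis
    proof (rule ex1I[of _ "x - l"])
      show "x - l \<in> F \<and> x - (x - l) \<in> M"
        using in_F l(1) by simp
      show "y = x - l" if "y \<in> F \<and> x - y \<in> M" for y
        using that unique by blast
    qed
  qed
  ultimately show ?thesis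
    using assms by (intro exI[of _ F]) (unfold_locales; blast)
qed

text \<open>Finite unions over initial segments of an enumeration increase to the whole union. Using
  images of segments as index sets makes repetitions in the enumeration harmless.\<close>

lemma emeasure_UN_le_infsum:
  fixes A :: "'b \<Rightarrow> 'a set"
  assumes "countable I" "\<And>i. i \<in> I \<Longrightarrow> A i \<in> sets M"
  shows "emeasure M (\<Union>i\<in>I. A i) \<le> (\<Sum>\<^sub>\<infinity>i\<in>I. emeasure M (A i))"
proof (cases "I = {}")
  case False
  define e where "e = from_nat_into I"
  have e: "range e = I"
    using assms(1) False by (simp add: e_def range_from_nat_into)
  have eI: "e i \<in> I" for i
    using e by blast
  have "(\<Union>i\<in>range e. A i) = (\<Union>k::nat. \<Union>i\<in>e ` {..k}. A i)"
  proof (intro equalityI subsetI)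
    fix x assume "x \<in> (\<Union>i\<in>range e. A i)"
    then obtain k where "x \<in> A (e k)"
      by blast
    then have "x \<in> (\<Union>i\<in>e ` {..k}. A i)"
      by blast
    then show "x \<in> (\<Union>k::nat. \<Union>i\<in>e ` {..k}. A i)"
      by blast
  qed blast
  then have U: "(\<Union>i\<in>I. A i) = (\<Union>k::nat. \<Union>i\<in>e ` {..k}. A i)"
    by (simp only: e)
  have "emeasure M (\<Union>i\<in>I. A i) = (SUP k::nat. emeasure M (\<Union>i\<in>e ` {..k}. A i))"
    unfolding U
  proof (rule SUP_emeasure_incseq[symmetric])
    show "range (\<lambda>k::nat. \<Union>i\<in>e ` {..k}. A i) \<subseteq> sets M"
      using assms(2) eI by auto
    show "incseq (\<lambda>k::nat. \<Union>i\<in>e ` {..k}. A i)"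
      unfolding incseq_def by (intro allI impI UN_mono image_mono) auto
  qed
  also have "\<dots> \<le> (\<Sum>\<^sub>\<infinity>i\<in>I. emeasure M (A i))"
  proof (rule SUP_least)
    fix k :: nat
    have "emeasure M (\<Union>i\<in>e ` {..k}. A i) \<le> (\<Sum>i\<in>e ` {..k}. emeasure M (A i))"
      using assms(2) eI by (intro emeasure_subadditive_finite) auto
    also have "\<dots> \<le> (SUP F\<in>{F. finite F \<and> F \<subseteq> I}. \<Sum>i\<in>F. emeasure M (A i))"
      using eI by (intro SUP_upper) auto
    also have "\<dots> = (\<Sum>\<^sub>\<infinity>i\<in>I. emeasure M (A i))"
      by (intro nonneg_infsum_complete[symmetric]) auto
    finally show "emeasure M (\<Union>i\<in>e ` {..k}. A i) \<le> (\<Sum>\<^sub>\<infinity>i\<in>I. emeasure M (A i))" .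
  qed
  finally show ?thesis .
qed simp

text \<open>This carries the product measure that defines \<open>vol\<close> to Lebesgue measure on
  a Euclidean space of dimension \<open>n - 1\<close>, where negligibility and the Vitali covering
  theorem are available. Measurability is transferred in both directions.\<close>

lemma coordinate_isometry:
  assumes "DIM('a::euclidean_space) = n - 1" "n \<le> 5"
  obtains \<phi> :: "'a::euclidean_space \<Rightarrow> quat" where
    "linear \<phi>" "\<And>y. norm (\<phi> y) = norm y" "range \<phi> = span (qunit ` {..<n - 1})"
    "\<And>A. \<phi> -` A \<in> sets borel \<Longrightarrow> vol n A = emeasure lborel (\<phi> -` A)"
    "\<And>A. coord_set n A \<in> sets (coord_measure n) \<longleftrightarrow> \<phi> -` A \<in> sets borel"
proof -
  define m where "m = n - 1"
  have m: "m = DIM('a)" "m \<le> 4"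
    using assms by (simp_all add: m_def)
  obtain bb where bb: "bij_betw bb {..<m} (Basis :: 'a set)"
    using ex_bij_betw_nat_finite[of "Basis :: 'a set"] by (auto simp: m(1) atLeast0LessThan)
  have inj: "inj_on bb {..<m}" and img: "bb ` {..<m} = Basis"
    using bb by (auto simp: bij_betw_def)
  have bbB: "bb k \<in> Basis" if "k < m" for k
    using img that by blast
  have bb_inner: "inner (bb k) (bb l) = (if k = l then 1 else 0)" if "k < m" "l < m" for k l
    using inner_Basis[OF bbB[OF that(1)] bbB[OF that(2)]] inj that by (auto simp: inj_on_def)
  define \<psi> where "\<psi> x = (\<Sum>k<m. x k *\<^sub>R bb k)" for x :: "nat \<Rightarrow> real"
  define \<xi> where "\<xi> y = restrict (\<lambda>k. inner y (bb k)) {..<m}" for y :: 'a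
  define \<phi> where "\<phi> y = (\<Sum>k<m. inner y (bb k) *\<^sub>R qunit k)" for y :: 'a
  have \<psi>_inner: "inner (\<psi> x) (bb k) = x k" if "k < m" for x k
    using that by (simp add: \<psi>_def inner_sum_left bb_inner if_distrib[of "\<lambda>t. _ * t"] cong: if_cong)
  have \<phi>\<psi>: "\<phi> (\<psi> x) = (\<Sum>k<m. x k *\<^sub>R qunit k)" for x
    unfolding \<phi>_def by (intro sum.cong) (auto simp: \<psi>_inner)
  have \<phi>\<xi>: "\<phi> y = (\<Sum>k<m. \<xi> y k *\<^sub>R qunit k)" for y
    unfolding \<phi>_def by (intro sum.cong) (auto simp: \<xi>_def)
  have cm: "coord_measure n = (\<Pi>\<^sub>M k\<in>{..<m}. lborel)"
    by (simp add: coord_measure_def m_def)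
  have \<psi>_meas [measurable]: "\<psi> \<in> measurable (coord_measure n) borel"
    unfolding cm \<psi>_def by measurable
  have \<xi>_meas: "\<xi> \<in> measurable borel (coord_measure n)"
    unfolding cm \<xi>_def by (intro measurable_restrict) simp
  have coord: "coord_set n A = \<psi> -` (\<phi> -` A) \<inter> space (coord_measure n)" for A
    by (auto simp: coord_set_def \<phi>\<psi> m_def)
  have lb: "distr (coord_measure n) borel \<psi> = lborel"
  proof (rule lborel_eqI[symmetric])
    fix l u :: 'a assume le: "\<And>b. b \<in> Basis \<Longrightarrow> inner l b \<le> inner u b"
    interpret product_sigma_finite "\<lambda>k::nat. lborel :: real measure"
      by unfold_locales
    have "\<psi> -` box l u \<inter> space (coord_measure n) = (\<Pi>\<^sub>E k\<in>{..<m}. {inner l (bb k)<..<inner u (bb k)})"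
    proof -
      have "\<psi> x \<in> box l u \<longleftrightarrow> (\<forall>k<m. inner l (bb k) < x k \<and> x k < inner u (bb k))" for x
        unfolding mem_box img[symmetric] by (auto simp: \<psi>_inner)
      then show ?thesis
        by (auto simp: cm space_PiM PiE_def Pi_def)
    qed
    then have "emeasure (distr (coord_measure n) borel \<psi>) (box l u) =
        emeasure (\<Pi>\<^sub>M k\<in>{..<m}. lborel) (\<Pi>\<^sub>E k\<in>{..<m}. {inner l (bb k)<..<inner u (bb k)})"
      using \<psi>_meas by (subst emeasure_distr) (auto simp: cm)
    also have "\<dots> = (\<Prod>k<m. emeasure lborel {inner l (bb k)<..<inner u (bb k)})"
      by (subst emeasure_PiM) auto
    also have "\<dots> = (\<Prod>k<m. ennreal (inner (u - l) (bb k)))"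
      using le bbB by (intro prod.cong) (auto simp: inner_simps)
    also have "\<dots> = ennreal (\<Prod>k<m. inner (u - l) (bb k))"
      using le bbB by (intro prod_ennreal) (auto simp: inner_simps)
    also have "(\<Prod>k<m. inner (u - l) (bb k)) = (\<Prod>b\<in>Basis. inner (u - l) b)"
      using prod.reindex[OF inj, of "inner (u - l)"] by (simp add: img)
    finally show "emeasure (distr (coord_measure n) borel \<psi>) (box l u) = ennreal (\<Prod>b\<in>Basis. inner (u - l) b)" .
  qed simp
  have q_inner: "inner (qunit k) (qunit l) = (if k = l then 1 else 0)" if "k < m" "l < m" for k l
  proof -
    have "k \<in> {0,1,2,3}" "l \<in> {0,1,2,3}"
      using that m(2) by auto
    then show ?thesis
      by (auto simp: qunit_def inner_quat_def)
  qed
  have lin: "linear \<phi>"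
    unfolding \<phi>_def by (intro linearI) (simp_all add: inner_simps sum.distrib scaleR_sum_right algebra_simps)
  moreover have "norm (\<phi> y) = norm y" for y
  proof -
    have "inner (\<phi> y) (\<phi> y) = (\<Sum>k<m. \<Sum>l<m. inner y (bb k) * (inner y (bb l) * inner (qunit k) (qunit l)))"
      by (simp add: \<phi>_def inner_sum_left inner_sum_right sum_distrib_left inner_commute[of "qunit _" "qunit _"])
    also have "\<dots> = (\<Sum>k<m. inner y (bb k) * inner y (bb k))"
      by (intro sum.cong refl) (simp add: q_inner if_distrib[of "\<lambda>t. _ * t"] cong: if_cong)
    also have "\<dots> = (\<Sum>b\<in>Basis. inner y b * inner y b)"
      using sum.reindex[OF inj, of "\<lambda>b. inner y b * inner y b"] by (simp add: img)
    also have "\<dots> = inner y y"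
      by (rule euclidean_inner[symmetric])
    finally show ?thesis
      by (simp add: norm_eq_sqrt_inner)
  qed
  moreover have "range \<phi> = span (qunit ` {..<n - 1})"
  proof
    show "range \<phi> \<subseteq> span (qunit ` {..<n - 1})"
      unfolding \<phi>_def m_def by (intro image_subsetI span_sum span_scale) (auto intro: span_base)
    have "qunit k \<in> range \<phi>" if "k < m" for k
    proof -
      have "\<phi> (bb k) = (\<Sum>l<m. (if k = l then 1 else 0) *\<^sub>R qunit l)"
        unfolding \<phi>_def using that by (intro sum.cong) (auto simp: bb_inner)
      also have "\<dots> = qunit k"
        using that by (simp add: if_distrib[of "\<lambda>t. t *\<^sub>R _"] cong: if_cong)
      finally show ?thesis
        by (metis rangeI)
    qed
    then show "span (qunit ` {..<n - 1}) \<subseteq> range \<phi>"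
      using linear_subspace_image[OF lin subspace_UNIV] by (intro span_minimal) (auto simp: m_def)
  qed
  moreover have "vol n A = emeasure lborel (\<phi> -` A)" if "\<phi> -` A \<in> sets borel" for A
    unfolding vol_def coord lb[symmetric] using that by (subst emeasure_distr) auto
  moreover have "coord_set n A \<in> sets (coord_measure n) \<longleftrightarrow> \<phi> -` A \<in> sets borel" for A
  proof
    assume "coord_set n A \<in> sets (coord_measure n)"
    then have "\<xi> -` coord_set n A \<inter> space borel \<in> sets borel"
      using \<xi>_meas by (rule measurable_sets[rotated])
    moreover have "\<xi> -` coord_set n A \<inter> space borel = \<phi> -` A"
      using measurable_space[OF \<xi>_meas] by (auto simp: coord_set_def \<phi>\<xi> m_def)
    ultimately show "\<phi> -` A \<in> sets borel"
      by simp
  next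
    assume "\<phi> -` A \<in> sets borel"
    then show "coord_set n A \<in> sets (coord_measure n)"
      unfolding coord by (intro measurable_sets) auto
  qed
  ultimately show ?thesis
    using that by blast
qed

section \<open>Density\<close>

context strip
begin

lemma V_span: "span (qunit ` {..<n - 1}) = V"
proof
  have sub: "qunit k \<in> V" if "k < n - 1" for k
  proof -
    have "k = 0 \<or> k = 1 \<or> k = 2 \<and> n \<ge> 4 \<or> k = 3 \<and> n \<ge> 5"
      using that dimension_cases by auto
    then show ?thesis
      by (auto simp: qunit_def coordinate_space_def)
  qed
  then show "span (qunit ` {..<n - 1}) \<subseteq> V"
    using subspace_V by (intro span_minimal) auto
  show "V \<subseteq> span (qunit ` {..<n - 1})"
  proof
    fix x assume x: "x \<in> V"
    have base: "qunit k \<in> span (qunit ` {..<n - 1})" if "k < n - 1" for k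
      using that by (intro span_base) auto
    have "x = qRe x *\<^sub>R qunit 0 + qI x *\<^sub>R qunit 1 + qJ x *\<^sub>R qunit 2 + qK x *\<^sub>R qunit 3"
      by (simp add: quat_eq_iff qunit_def)
    moreover have "qRe x *\<^sub>R qunit 0 \<in> span (qunit ` {..<n - 1})" "qI x *\<^sub>R qunit 1 \<in> span (qunit ` {..<n - 1})"
      using dimension_cases base by (auto intro!: span_scale)
    moreover have "qJ x *\<^sub>R qunit 2 \<in> span (qunit ` {..<n - 1})"
    proof (cases "n = 3")
      case True
      then show ?thesis using x by (simp add: coordinate_space_def span_zero)
    next
      case False
      then show ?thesis using dimension_cases base by (auto intro!: span_scale)
    qed
    moreover have "qK x *\<^sub>R qunit 3 \<in> span (qunit ` {..<n - 1})"
    proof (cases "n = 5")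
      case True
      then show ?thesis using base by (auto intro!: span_scale)
    next
      case False
      then show ?thesis using dimension_cases x by (auto simp: coordinate_space_def span_zero)
    qed
    ultimately show "x \<in> span (qunit ` {..<n - 1})"
      by (metis span_add)
  qed
qed

lemma transl_arrangement:
  assumes "S \<in> arrangement n R u \<tau>" "w \<in> \<Lambda>"
  shows "act (transl w) S \<in> arrangement n R u \<tau>"
    "Int_region n R (act (transl w) S) = {x. x - w \<in> Int_region n R S}"
proof -
  obtain g \<Phi> E where E: "(g, \<Phi>) \<in> GP" "E = wall_0 \<or> E = wall_1" "S = osph (\<Phi> E)"
    using assms(1) unfolding arrangement_iff insert_iff empty_iff by blast
  have GP: "(transl w, lshift w) \<in> GP"
    using GP.translation[OF GP.one assms(2)] by (simp only: comp_id)
  have act: "act (transl w) S = osph (lshift w (\<Phi> E))"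
    unfolding E(3) by (rule act_osph[OF GP])
  have "(transl w \<circ> g, lshift w \<circ> \<Phi>) \<in> GP"
    using E(1) assms(2) by (rule GP.translation)
  from arrangementI[OF this E(2)] show "act (transl w) S \<in> arrangement n R u \<tau>"
    by (simp add: act)
  have V: "x - w \<in> V \<longleftrightarrow> x \<in> V" for x
    using subspace_add[OF subspace_V, of "x - w" w] subspace_diff[OF subspace_V, of x w] L_V[OF \<Lambda>_L[OF assms(2)]] by auto
  have inf: "lprod inf_vec (lshift w F) = lprod inf_vec F" for F
    using lprod_lshift[of w inf_vec F] by (simp add: lshift_vecs)
  have pt: "lprod (point_vec x) (lshift w F) = lprod (point_vec (x - w)) F" for x F
    using lprod_lshift[of w "point_vec (x - w)" F] by (simp add: lshift_vecs)
  show "Int_region n R (act (transl w) S) = {x. x - w \<in> Int_region n R S}"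
    unfolding act unfolding E(3) Int_region_osph inf pt by (simp add: V)
qed

text \<open>A gap is open with a uniform margin \<open>e'\<close>, and the points whose multiple by
  \<open>N\<close> is a lattice point come within \<open>(h + 1) / N\<close> of every point of the
  space.\<close>

lemma rational_gap:
  assumes "x \<in> V" "\<And>c. c \<in> L \<Longrightarrow> norm (x - c) > 1"
  shows "\<exists>N y. N > 0 \<and> of_nat N * y \<in> L \<and> (\<forall>c\<in>L. nrm (y - c) > 1)"
proof -
  have "\<exists>e>0. \<forall>c\<in>L \<inter> cball x 2. 1 + e \<le> norm (x - c)"
  proof (rule finite_uniform_radius[OF finite_L_cball])
    fix c assume "c \<in> L \<inter> cball x 2"
    then show "\<exists>e>0. 1 + e \<le> norm (x - c)"
      using assms(2)[of c] by (intro exI[of _ "norm (x - c) - 1"]) auto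
  qed auto
  then obtain e where e: "e > 0" "\<And>c. c \<in> L \<Longrightarrow> norm (x - c) \<le> 2 \<Longrightarrow> 1 + e \<le> norm (x - c)"
    by (auto simp: dist_norm)
  define e' where "e' = min e 1"
  have e': "e' > 0" "\<And>c. c \<in> L \<Longrightarrow> 1 + e' \<le> norm (x - c)"
    using e by (force simp: e'_def)+
  obtain N :: nat where N: "(h + 1) / e' < real N"
    using reals_Archimedean2 by blast
  have "0 < (h + 1) / e'"
    using h_pos e'(1) by simp
  then have N0: "N > 0"
    using N by (intro Nat.gr0I) auto
  obtain l where l: "l \<in> L" "norm (real N *\<^sub>R x - l) \<le> h + 1"
    using L_cobounded[OF subspace_scale[OF subspace_V assms(1)]] by blast
  define y where "y = l /\<^sub>R real N"
  have "real N *\<^sub>R (x - y) = real N *\<^sub>R x - l"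
    using N0 by (simp add: y_def algebra_simps)
  then have "real N * norm (x - y) \<le> h + 1"
    using l(2) by (metis abs_of_nat norm_scaleR)
  also have "\<dots> < real N * e'"
    using N e'(1) by (simp add: field_simps)
  finally have xy: "norm (x - y) < e'"
    using N0 by simp
  have "nrm (y - c) > 1" if "c \<in> L" for c
  proof -
    have "norm (x - c) \<le> norm (x - y) + norm (y - c)"
      using norm_triangle_ineq[of "x - y" "y - c"] by simp
    then have "1 < norm (y - c)"
      using e'(2)[OF that] xy by linarith
    then show ?thesis
      by (simp add: nrm_eq_norm)
  qed
  moreover have "of_nat N * y = l"
    using N0 by (simp add: y_def quat_eq_iff quat_sel_mult)
  ultimately show ?thesis
    using N0 l(1) by auto
qed

lemma lprod_point_continuous: "continuous_on UNIV (\<lambda>x. lprod (point_vec x) E)"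
  unfolding lprod_def point_vec_def fst_conv snd_conv nrm_eq_inner by (intro continuous_intros) auto

end

section \<open>Volumes and density in a Euclidean chart\<close>

locale strip_chart = strip +
  fixes \<phi> :: "'a::euclidean_space \<Rightarrow> quat"
  assumes linear: "linear \<phi>" and isometric: "norm (\<phi> y) = norm y" and range: "range \<phi> = V"
    and vol_chart: "\<phi> -` A \<in> sets borel \<Longrightarrow> vol n A = emeasure lborel (\<phi> -` A)"
    and coord_chart: "coord_set n A \<in> sets (coord_measure n) \<longleftrightarrow> \<phi> -` A \<in> sets borel"
begin

lemma chart_diff: "\<phi> (x - y) = \<phi> x - \<phi> y" and chart_0: "\<phi> 0 = 0"
  using linear by (simp_all add: linear_diff linear_0)

lemma inj_chart: "inj \<phi>"
  using linear isometric by (simp add: linear_injective_0[OF linear]) (metis norm_eq_zero)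

lemma countable_vimage_chart: "countable A \<Longrightarrow> countable (\<phi> -` A)"
proof -
  assume "countable A"
  then have "countable (\<phi> ` (\<phi> -` A))"
    by (rule countable_subset[rotated]) blast
  then show ?thesis
    using inj_on_subset[OF inj_chart subset_UNIV] by (rule countable_image_inj_on)
qed

lemma chart_V: "\<phi> y \<in> V"
  using range by blast

lemma chart_cases:
  assumes "x \<in> V"
  obtains y where "x = \<phi> y"
  using assms unfolding range[symmetric] by (rule rangeE)

lemma continuous_chart: "continuous_on UNIV \<phi>"
  using linear by (simp add: linear_continuous_on linear_conv_bounded_linear)

definition lattice :: "'a set"
  where "lattice = \<phi> -` L"

lemma lattice_domain_iff: "is_fundamental_domain n L F \<longleftrightarrow> F \<subseteq> V \<and> lattice_domain lattice (\<phi> -` F)"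
proof
  assume F: "is_fundamental_domain n L F"
  then have FV: "F \<subseteq> V" and b: "\<phi> -` F \<in> sets borel"
    and r: "\<And>x. x \<in> V \<Longrightarrow> \<exists>!y. y \<in> F \<and> x - y \<in> L"
    by (auto simp: is_fundamental_domain_def span_L coord_chart)
  have "lattice_domain lattice (\<phi> -` F)"
  proof
    show "countable lattice"
      unfolding lattice_def using countable_L by (rule countable_vimage_chart)
    show "\<exists>!y. y \<in> \<phi> -` F \<and> x - y \<in> lattice" for x
    proof -
      obtain z where z: "z \<in> F" "\<phi> x - z \<in> L" "\<And>z'. z' \<in> F \<Longrightarrow> \<phi> x - z' \<in> L \<Longrightarrow> z' = z"
        using r[OF chart_V[of x]] by blast
      obtain y where y: "z = \<phi> y"
        using chart_cases[of z] z(1) FV by blast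
      show ?thesis
      proof (rule ex1I[of _ y])
        show "y \<in> \<phi> -` F \<and> x - y \<in> lattice"
          using z(1,2) y by (simp add: lattice_def chart_diff)
        fix y' assume "y' \<in> \<phi> -` F \<and> x - y' \<in> lattice"
        then have "\<phi> y' = \<phi> y"
          using z(3)[of "\<phi> y'"] y by (simp add: lattice_def chart_diff)
        then show "y' = y"
          using inj_chart by (simp add: inj_eq)
      qed
    qed
  qed (use b in \<open>auto simp: lattice_def chart_diff chart_0 L_0 L_diff\<close>)
  then show "F \<subseteq> V \<and> lattice_domain lattice (\<phi> -` F)"
    using FV by blast
next
  assume F: "F \<subseteq> V \<and> lattice_domain lattice (\<phi> -` F)"
  then interpret lattice_domain lattice "\<phi> -` F"
    by blast
  have "\<exists>!y. y \<in> F \<and> x - y \<in> L" if xV: "x \<in> V" for x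
  proof -
    obtain x' where x': "x = \<phi> x'"
      using xV by (rule chart_cases)
    obtain y where y: "y \<in> \<phi> -` F" "x' - y \<in> lattice"
      "\<And>y'. y' \<in> \<phi> -` F \<Longrightarrow> x' - y' \<in> lattice \<Longrightarrow> y' = y"
      using reps[of x'] by blast
    show ?thesis
    proof (rule ex1I[of _ "\<phi> y"])
      show "\<phi> y \<in> F \<and> x - \<phi> y \<in> L"
        using y(1,2) by (simp add: lattice_def chart_diff x')
      fix z assume z: "z \<in> F \<and> x - z \<in> L"
      then have "z \<in> V"
        using F by blast
      then obtain y' where y': "z = \<phi> y'"
        by (rule chart_cases)
      show "z = \<phi> y"
        using y(3)[of y'] z unfolding lattice_def x' y' by (simp add: chart_diff)
    qed
  qed
  then show "is_fundamental_domain n L F"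
    using F borel by (simp add: is_fundamental_domain_def span_L coord_chart)
qed

lemma fundamental_domain_exists: "\<exists>F. is_fundamental_domain n L F"
proof -
  have "\<exists>F. lattice_domain lattice F"
  proof (rule lattice_domain_exists)
    show "countable lattice"
      unfolding lattice_def using countable_L by (rule countable_vimage_chart)
    show "1 \<le> norm x" if "x \<in> lattice" "x \<noteq> 0" for x
    proof -
      have "\<phi> x \<noteq> 0"
        using that(2) isometric[of x] by auto
      then show ?thesis
        using L_norm_ge_1[of "\<phi> x"] that(1) isometric[of x] by (simp add: lattice_def)
    qed
    show "\<exists>l\<in>lattice. norm (x - l) \<le> h + 1" for x
    proof -
      obtain l where l: "l \<in> L" "norm (\<phi> x - l) \<le> h + 1"
        using L_cobounded[OF chart_V] by blast
      obtain l' where "l = \<phi> l'"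
        using L_V[OF l(1)] by (rule chart_cases)
      then show ?thesis
        using l isometric[of "x - l'"] by (intro bexI[of _ l']) (auto simp: lattice_def chart_diff)
    qed
  qed (auto simp: lattice_def chart_diff chart_0 L_0 L_diff)
  then obtain F where F: "lattice_domain lattice F"
    by blast
  have "\<phi> -` (\<phi> ` F) = F"
    using inj_chart by (rule inj_vimage_image_eq)
  then have "is_fundamental_domain n L (\<phi> ` F)"
    unfolding lattice_domain_iff using F chart_V by auto
  then show ?thesis
    by blast
qed

lemma Int_region_open:
  assumes "S \<in> arrangement n R u \<tau>"
  shows "open (\<phi> -` Int_region n R S)"
proof -
  obtain g \<Phi> E where E: "S = osph (\<Phi> E)"
    using assms unfolding arrangement_iff by blast
  have "continuous_on UNIV (\<lambda>y. lprod (point_vec (\<phi> y)) (\<Phi> E))"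
    using continuous_on_compose2[OF lprod_point_continuous continuous_chart] by simp
  then have "open {y. lprod (point_vec (\<phi> y)) (\<Phi> E) < 0}" "open {y. lprod (point_vec (\<phi> y)) (\<Phi> E) > 0}"
    by (auto intro: open_Collect_less continuous_on_const)
  then show ?thesis
    by (simp add: E Int_region_osph vimage_def chart_V)
qed

text \<open>The density depends on chosen representatives of orbits. These differ from the given
  spheres by translations in \<open>\<Lambda>\<close>, which lie in \<open>L\<close>, so the lattice
  translates of the chosen interiors still cover. Their union therefore has at least the volume of a
  fundamental domain.\<close>

lemma packing_density_ge_1:
  assumes N: "\<phi> -` N \<in> null_sets lborel"
    and cover: "\<And>x. x \<in> V \<Longrightarrow> x \<in> N \<or> (\<exists>l\<in>L. \<exists>S\<in>arrangement n R u \<tau> - base_spheres n R u \<tau>. x - l \<in> Int_region n R S)"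
  shows "1 \<le> packing_density n R u \<tau>"
proof -
  define F where "F = (SOME F. is_fundamental_domain n L F)"
  have "is_fundamental_domain n L F"
    unfolding F_def using fundamental_domain_exists by (rule someI_ex)
  then interpret D: lattice_domain lattice "\<phi> -` F"
    by (simp add: lattice_domain_iff)
  define b where "b = emeasure lborel (\<phi> -` F)"
  have covol: "covolume n L = b"
    using vol_chart[OF D.borel] by (simp add: covolume_def F_def b_def)
  \<comment> \<open>The final division in \<open>ennreal\<close> needs a covolume that is neither 0
    nor infinite.\<close>
  have "b \<noteq> 0"
    unfolding b_def by (rule D.emeasure_pos)
  have "b \<le> emeasure lborel (cball (0 :: 'a) (h + 1))"
    unfolding b_def
  proof (rule D.emeasure_le_cover)
    fix x :: 'a
    obtain l where l: "l \<in> L" "norm (\<phi> x - l) \<le> h + 1"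
      using L_cobounded[OF chart_V] by blast
    obtain l' where "l = \<phi> l'"
      using L_V[OF l(1)] by (rule chart_cases)
    then show "x \<in> {} \<or> (\<exists>l\<in>lattice. x - l \<in> cball 0 (h + 1))"
      using l isometric[of "x - l'"] by (intro disjI2 bexI[of _ l']) (auto simp: lattice_def chart_diff)
  qed auto
  then have "b \<noteq> \<infinity>"
    using emeasure_lborel_cball_finite[of "0 :: 'a" "h + 1"] by (auto simp: top_unique)
  define Q where "Q = (arrangement n R u \<tau> - base_spheres n R u \<tau>) // translation_rel n R u"
  define rep where "rep X = (SOME S. S \<in> X)" for X :: "osphere set"
  have rep: "\<exists>w\<in>\<Lambda>. rep (translation_rel n R u `` {S}) = act (transl w) S" for S
  proof -
    have "S = act (transl 0) S"
      by (simp add: act_def prod_eq_iff image_def)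
    then have "(S, S) \<in> translation_rel n R u"
      using \<Lambda>_0 unfolding translation_rel_def \<Lambda>_eq[symmetric] by blast
    then have "S \<in> translation_rel n R u `` {S}"
      by blast
    then have "rep (translation_rel n R u `` {S}) \<in> translation_rel n R u `` {S}"
      unfolding rep_def by (rule someI)
    then show ?thesis
      unfolding translation_rel_def \<Lambda>_eq[symmetric] by blast
  qed
  have rep_arr: "rep X \<in> arrangement n R u \<tau>" if X: "X \<in> Q" for X
  proof -
    obtain S where S: "S \<in> arrangement n R u \<tau>" "X = translation_rel n R u `` {S}"
      using X by (auto simp: Q_def elim!: quotientE)
    obtain w where "w \<in> \<Lambda>" "rep X = act (transl w) S"
      using rep[of S] S(2) by auto
    then show ?thesis
      using transl_arrangement(1)[OF S(1)] by simp
  qed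
  define A where "A X = \<phi> -` Int_region n R (rep X)" for X
  have A: "A X \<in> sets lborel" if "X \<in> Q" for X
    using Int_region_open[OF rep_arr[OF that]] by (simp add: A_def)
  have Q: "countable Q"
    unfolding Q_def quotient_def using countable_arrangement by auto
  have "b \<le> emeasure lborel (\<Union>X\<in>Q. A X)"
    unfolding b_def
  proof (rule D.emeasure_le_cover[OF _ N])
    show "(\<Union>X\<in>Q. A X) \<in> sets borel"
      using A Q by (intro sets.countable_UN') auto
    fix x
    from cover[OF chart_V[of x]] show "x \<in> \<phi> -` N \<or> (\<exists>l\<in>lattice. x - l \<in> (\<Union>X\<in>Q. A X))"
    proof
      assume "\<exists>l\<in>L. \<exists>S\<in>arrangement n R u \<tau> - base_spheres n R u \<tau>. \<phi> x - l \<in> Int_region n R S"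
      then obtain l S where l: "l \<in> L" "S \<in> arrangement n R u \<tau>" "S \<notin> base_spheres n R u \<tau>" "\<phi> x - l \<in> Int_region n R S"
        by blast
      define X where "X = translation_rel n R u `` {S}"
      have "X \<in> Q"
        unfolding Q_def X_def using l by (intro quotientI) auto
      obtain w where w: "w \<in> \<Lambda>" "rep X = act (transl w) S"
        using rep[of S] by (auto simp: X_def)
      have lw: "l - w \<in> L"
        using l(1) \<Lambda>_L[OF w(1)] by (rule L_diff)
      obtain k where k: "l - w = \<phi> k"
        using L_V[OF lw] by (rule chart_cases)
      have "\<phi> (x - k) - w \<in> Int_region n R S"
        using l(4) by (simp add: chart_diff k[symmetric])
      then have "x - k \<in> A X"
        using transl_arrangement(2)[OF l(2) w(1)] w(2) by (simp add: A_def)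
      moreover have "k \<in> lattice"
        using lw by (simp add: lattice_def k)
      ultimately show ?thesis
        using \<open>X \<in> Q\<close> by blast
    qed simp
  qed
  also have "\<dots> \<le> (\<Sum>\<^sub>\<infinity>X\<in>Q. emeasure lborel (A X))"
    using Q A by (rule emeasure_UN_le_infsum)
  also have "\<dots> = (\<Sum>\<^sub>\<infinity>X\<in>Q. vol n (Int_region n R (rep X)))"
    using A vol_chart by (intro infsum_cong) (simp add: A_def)
  finally have "b / b \<le> (\<Sum>\<^sub>\<infinity>X\<in>Q. vol n (Int_region n R (rep X))) / b"
    by (rule divide_right_mono_ennreal)
  moreover have "b / b = 1"
    using \<open>b \<noteq> 0\<close> \<open>b \<noteq> \<infinity>\<close> by (simp add: ennreal_divide_self less_top)
  ultimately show ?thesis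
    by (simp add: packing_density_def covol Q_def rep_def)
qed

lemma plane_imp_density_ge_1:
  assumes "S \<in> arrangement n R u \<tau> - base_spheres n R u \<tau>" "None \<in> fst S"
  shows "1 \<le> packing_density n R u \<tau>"
proof (rule packing_density_ge_1[of "{}"])
  obtain b C where b: "b \<in> V" "b \<noteq> 0" "Int_region n R S = {x \<in> V. inner x b > C}"
    using plane_Int_region[of S] assms by blast
  have "\<exists>l\<in>L. inner l b \<noteq> 0"
  proof (rule ccontr)
    assume "\<not> (\<exists>l\<in>L. inner l b \<noteq> 0)"
    then have "L \<subseteq> {x. inner x b = 0}"
      by blast
    moreover have "subspace {x. inner x b = 0}"
      by (simp add: subspace_def inner_simps)
    ultimately have "span L \<subseteq> {x. inner x b = 0}"
      by (rule span_minimal)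
    \<comment> \<open>The vector \<open>b\<close> would be orthogonal to the span of
      \<open>L\<close>, to which it belongs itself.\<close>
    then show False
      using b(1,2) span_L by auto
  qed
  then obtain l where l: "l \<in> L" "inner l b > 0"
    by (metis L_minus inner_minus_left linorder_neqE_linordered_idom neg_0_less_iff_less)
  fix x assume x: "x \<in> V"
  obtain k :: nat where "(C - inner x b) / inner l b < real k"
    using reals_Archimedean2 by blast
  then have k: "C - inner x b < real k * inner l b"
    using l(2) by (simp add: field_simps)
  have kl: "of_int (- int k) *\<^sub>R l \<in> L"
    using L_of_int[OF l(1)] .
  have "x - of_int (- int k) *\<^sub>R l \<in> Int_region n R S"
    using subspace_diff[OF subspace_V x L_V[OF kl]] k unfolding b(3) by (simp add: inner_simps)
  then show "x \<in> {} \<or> (\<exists>l\<in>L. \<exists>S\<in>arrangement n R u \<tau> - base_spheres n R u \<tau>. x - l \<in> Int_region n R S)"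
    using kl assms(1) by blast
qed simp

lemma density_less_1_imp_gap:
  assumes "packing_density n R u \<tau> < 1"
  shows "\<exists>x\<in>V. \<forall>c\<in>L. norm (x - c) > 1"
proof (rule ccontr)
  assume no_gap: "\<not> (\<exists>x\<in>V. \<forall>c\<in>L. norm (x - c) > 1)"
  have planes: "S \<in> base_spheres n R u \<tau>" if "S \<in> arrangement n R u \<tau>" "None \<in> fst S" for S
    using plane_imp_density_ge_1[of S] that assms by (auto simp: not_le[symmetric])
  have "h > 1"
    using thin_strip_plane planes by (meson DiffD1 DiffD2 not_le)
  then interpret packed_strip n R u \<tau>
    using no_gap planes by unfold_locales (auto simp: not_less)
  obtain K where K: "K > 0" "\<And>z \<epsilon>. z \<in> residual \<Longrightarrow> z \<notin> exceptional \<Longrightarrow> \<epsilon> > 0 \<Longrightarrow>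
      \<exists>s p. 0 < s \<and> s \<le> \<epsilon> \<and> p \<in> V \<and> norm (z - p) + s \<le> K * s \<and> (\<forall>x\<in>V. norm (x - p) < s \<longrightarrow> x \<notin> residual)"
    using residual_porous by blast
  have "closed (\<phi> -` residual)"
  proof -
    have "\<phi> -` residual = {y. 0 \<le> inner (\<phi> y) uh} \<inter> {y. inner (\<phi> y) uh \<le> h} \<inter>
        (\<Inter>S\<in>arrangement n R u \<tau> - base_spheres n R u \<tau>. - (\<phi> -` Int_region n R S))"
      by (auto simp: residual_def T_def chart_V)
    moreover have "closed {y. 0 \<le> inner (\<phi> y) uh}" "closed {y. inner (\<phi> y) uh \<le> h}"
      by (intro closed_Collect_le continuous_intros continuous_chart)+
    ultimately show ?thesis
      using Int_region_open by (auto intro!: closed_Int closed_INT)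
  qed
  then have borel: "\<phi> -` residual \<in> sets borel"
    by simp
  have "negligible (\<phi> -` residual)"
  proof (rule porous_negligible[OF _ _ K(1)])
    show "\<phi> -` residual \<in> sets lebesgue"
      using borel by simp
    show "countable (\<phi> -` exceptional)"
      using countable_exceptional by (rule countable_vimage_chart)
    fix z :: 'a and \<epsilon> :: real
    assume "z \<in> \<phi> -` residual" "z \<notin> \<phi> -` exceptional" "0 < \<epsilon>"
    then obtain s p where s: "0 < s" "s \<le> \<epsilon>" "p \<in> V" "norm (\<phi> z - p) + s \<le> K * s"
      "\<forall>x\<in>V. norm (x - p) < s \<longrightarrow> x \<notin> residual"
      using K(2)[of "\<phi> z" \<epsilon>] by auto
    obtain p' where p': "p = \<phi> p'"
      using s(3) by (rule chart_cases)
    have "norm (z - p') + s \<le> K * s"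
      using s(4) isometric[of "z - p'"] by (simp add: p' chart_diff)
    moreover have "x \<notin> \<phi> -` residual" if "x \<in> ball p' s" for x
      using s(5) chart_V[of x] that isometric[of "x - p'"]
      by (simp add: p' chart_diff dist_norm norm_minus_commute)
    ultimately show "\<exists>s p. 0 < s \<and> s \<le> \<epsilon> \<and> norm (z - p) + s \<le> K * s \<and> ball p s \<inter> \<phi> -` residual = {}"
      using s(1,2) by blast
  qed
  then have null: "emeasure lborel (\<phi> -` residual) = 0"
    using borel by (simp add: negligible_iff_emeasure0)
  \<comment> \<open>Residual points lie in one strip only; the lattice translates account for the
    whole space.\<close>
  define N where "N = (\<Union>l\<in>L. {x. x - l \<in> residual})"
  have "\<phi> -` N \<in> null_sets lborel"
  proof -
    have "\<phi> -` {x. x - l \<in> residual} \<in> null_sets lborel" if l: "l \<in> L" for l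
    proof -
      obtain k where k: "l = \<phi> k"
        using L_V[OF l] by (rule chart_cases)
      have "\<phi> -` {x. x - l \<in> residual} = {y. y + (- k) \<in> \<phi> -` residual}"
        by (auto simp: k chart_diff)
      then show ?thesis
        using null translate_borel[OF borel, of "- k"] emeasure_lborel_translate[OF borel, of "- k"]
        by (simp add: null_sets_def)
    qed
    then have "(\<Union>l\<in>L. \<phi> -` {x. x - l \<in> residual}) \<in> null_sets lborel"
      using countable_L by (intro null_sets_UN') auto
    moreover have "\<phi> -` N = (\<Union>l\<in>L. \<phi> -` {x. x - l \<in> residual})"
      by (auto simp: N_def)
    ultimately show ?thesis
      by simp
  qed
  then have "1 \<le> packing_density n R u \<tau>"
  proof (rule packing_density_ge_1)
    fix x assume x: "x \<in> V"
    obtain k :: int where k: "0 \<le> inner (x - of_int k *\<^sub>R \<tau>) uh" "inner (x - of_int k *\<^sub>R \<tau>) uh < h"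
      using strip_representative[OF x] by blast
    have kL: "of_int k *\<^sub>R \<tau> \<in> L"
      using L_of_int[OF tau_L] .
    have "x - of_int k *\<^sub>R \<tau> \<in> T"
      using k x L_V[OF kL] by (simp add: T_def subspace_diff[OF subspace_V])
    then show "x \<in> N \<or> (\<exists>l\<in>L. \<exists>S\<in>arrangement n R u \<tau> - base_spheres n R u \<tau>. x - l \<in> Int_region n R S)"
      using kL unfolding N_def residual_def by blast
  qed
  then show False
    using assms by (simp add: not_le[symmetric])
qed

end

context strip
begin

text \<open>The dimension \<open>n - 1\<close> of the chart has to be given by a type, so the type
  is left open here and chosen separately for each of the three dimensions.\<close>

lemma gap_if_chart:
  assumes "DIM('a::euclidean_space) = n - 1" "packing_density n R u \<tau> < 1"
  shows "\<exists>x\<in>V. \<forall>c\<in>L. norm (x - c) > 1"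
proof -
  have "n \<le> 5"
    using dimension_cases by auto
  obtain \<phi> :: "'a \<Rightarrow> quat" where \<phi>: "linear \<phi>" "\<And>y. norm (\<phi> y) = norm y" "range \<phi> = span (qunit ` {..<n - 1})"
    "\<And>A. \<phi> -` A \<in> sets borel \<Longrightarrow> vol n A = emeasure lborel (\<phi> -` A)"
    "\<And>A. coord_set n A \<in> sets (coord_measure n) \<longleftrightarrow> \<phi> -` A \<in> sets borel"
    using coordinate_isometry[OF assms(1) \<open>n \<le> 5\<close>] by blast
  have "range \<phi> = V"
    unfolding \<phi>(3) by (rule V_span)
  with \<phi>(1,2) interpret strip_chart n R u \<tau> \<phi>
    using \<phi>(4,5) by (intro strip_chart.intro strip_axioms strip_chart_axioms.intro)
  show ?thesis
    using assms(2) by (rule density_less_1_imp_gap)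
qed

lemma density_less_1_imp_infinite_index:
  assumes "packing_density n R u \<tau> < 1"
  shows "infinite (rcosets\<^bsub>G_group n R\<^esub> E_group n R)"
proof -
  consider "n = 3" | "n = 4" | "n = 5"
    using dimension_cases by blast
  then have "\<exists>x\<in>V. \<forall>c\<in>L. norm (x - c) > 1"
  proof cases
    case 1
    then show ?thesis
      using gap_if_chart[where 'a = "real^2"] assms by simp
  next
    case 2
    then show ?thesis
      using gap_if_chart[where 'a = "real^3"] assms by simp
  next
    case 3
    then show ?thesis
      using gap_if_chart[where 'a = "real^4"] assms by simp
  qed
  then obtain N y where "N > 0" "of_nat N * y \<in> L" "\<forall>c\<in>L. nrm (y - c) > 1"
    using rational_gap by blast
  then show ?thesis
    by (intro infinite_index_if_gap[of N y]) auto
qed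

end

theorem theorem5p21:
  fixes n :: nat and R :: "quat set" and u \<tau> :: quat
  assumes "is_integer_ring n R"
    and "normalized_covering_vector n R u"
    and "nrm u > 3"
    and "admissible_shift n R u \<tau>"
    and "packing_density n R u \<tau> < 1"
  shows "subgroup (E_group n R) (G_group n R) \<and>
    infinite (rcosets\<^bsub>G_group n R\<^esub> E_group n R)"
proof -
  interpret strip n R u \<tau>
    using assms by unfold_locales
  show ?thesis
    using subgroup_E density_less_1_imp_infinite_index[OF assms(5)]
    by (simp add: E_group_eq G_group_def)
qed

end
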